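(* Let $\mathcal R_{\mathcal T}=\mathcal N\rtimes\mathcal T$ be a solvable Lie algebra of maximal rank whose nilradical $\mathcal N$ has nilindex $s+1$, and which satisfies the standing assumptions (A1) and (A2) given in the context. Suppose that $H^i(\mathcal R_{\mathcal T},\mathcal R_{\mathcal T})=0$ for all $0\le i\le s-1$. Then $H^i(\mathcal R_{\mathcal T},\mathcal R_{\mathcal T})=0$ for all $i\ge 0$.
   Context: All algebras and modules are finite-dimensional over $\mathbb C$. Let $\mathcal N$ be a nilpotent Lie algebra and $\mathcal T$ a maximal torus of $\mathcal N$, i.e. a maximal abelian subalgebra of $\mathrm{Der}(\mathcal N)$ consisting of diagonalizable derivations. $\mathcal R_{\mathcal T}:=\mathcal N\rtimes\mathcal T$ is the semidirect product ($\mathcal T$ abelian, $[x,e]=x(e)$ for $x\in\mathcal T$, $e\in\mathcal N$). Write $\mathcal N=\bigoplus_{\alpha\in W}\mathcal N_\alpha$ for the weight decomposition, where $W\subset\mathcal T^*$ is the set of weights of $\mathcal T$ on $\mathcal N$. Put $\mathcal N^2=[\mathcal N,\mathcal N]$, $\mathcal N^{k+1}=[\mathcal N,\mathcal N^k]$; the nilindex of $\mathcal N$ is the smallest $k$ with $\mathcal N^k=0$ (so nilindex $s+1$ means $\mathcal N^{s+1}=0\ne\mathcal N^s$). Standing assumptions: (A1) (maximal rank) $\dim\mathcal T=\dim(\mathcal N/\mathcal N^2)$; (A2) $\dim\mathcal N_\alpha=1$ for every $\alpha\in W$, and if $\alpha\ne\beta$ and $\alpha,\beta,\alpha+\beta\in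 W$, then $[\mathcal N_\alpha,\mathcal N_\beta]=\mathcal N_{\alpha+\beta}$. The nilindex of $\mathcal N$ is assumed greater than $3$, i.e. $s\ge 3$. $H^i(\mathcal R_{\mathcal T},\mathcal R_{\mathcal T})$ is Chevalley--Eilenberg cohomology with coefficients in the adjoint module. *)

theory Defs
  imports Complex_Main "HOL-Library.Function_Algebras" "HOL-Library.Product_Plus"
begin

section \<open>Complex Lie algebras on a subspace of a vector space\<close>

locale lie_algebra_on = vector_space scale
  for scale :: "complex \<Rightarrow> 'l::ab_group_add \<Rightarrow> 'l" (infixr \<open>*\<^sub>L\<close> 75) +
  fixes L :: "'l set"
    and bracket :: "'l \<Rightarrow> 'l \<Rightarrow> 'l"
  assumes subspace_L: "subspace L"
    and bracket_closed: "\<lbrakk>x \<in> L; y \<in> L\<rbrakk> \<Longrightarrow> bracket x y \<in> L"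
    and bracket_add_left:
      "\<lbrakk>x \<in> L; y \<in> L; z \<in> L\<rbrakk> \<Longrightarrow> bracket (x + y) z = bracket x z + bracket y z"
    and bracket_add_right:
      "\<lbrakk>x \<in> L; y \<in> L; z \<in> L\<rbrakk> \<Longrightarrow> bracket x (y + z) = bracket x y + bracket x z"
    and bracket_scale_left:
      "\<lbrakk>x \<in> L; y \<in> L\<rbrakk> \<Longrightarrow> bracket (c *\<^sub>L x) y = c *\<^sub>L bracket x y"
    and bracket_scale_right:
      "\<lbrakk>x \<in> L; y \<in> L\<rbrakk> \<Longrightarrow> bracket x (c *\<^sub>L y) = c *\<^sub>L bracket x y"
    and bracket_self: "x \<in> L \<Longrightarrow> bracket x x = 0"
    and jacobi: "\<lbrakk>x \<in> L; y \<in> L; z \<in> L\<rbrakk> \<Longrightarrow>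
      bracket x (bracket y z) + bracket y (bracket z x) + bracket z (bracket x y) = 0"
begin

definition set_bracket :: "'l set \<Rightarrow> 'l set \<Rightarrow> 'l set" where
  "set_bracket A B = span {bracket x y | x y. x \<in> A \<and> y \<in> B}"

text \<open>
  The series is indexed from 1: \<open>N\<^sup>1 = N\<close>, \<open>N\<^sup>k\<^sup>+\<^sup>1 = [N, N\<^sup>k]\<close>. The value at 0 is a dummy.
\<close>

fun lower_central :: "nat \<Rightarrow> 'l set" where
  "lower_central 0 = L"
| "lower_central (Suc 0) = L"
| "lower_central (Suc (Suc k)) = set_bracket L (lower_central (Suc k))"

definition nilpotent :: bool where
  "nilpotent \<longleftrightarrow> (\<exists>k\<ge>1. lower_central k = {0})"

definition nilindex :: nat where
  "nilindex = (LEAST k. 1 \<le> k \<and> lower_central k = {0})"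

text \<open>
  For \<open>U \<subseteq> V\<close>: the cosets \<open>b + U\<close>, \<open>b \<in> B\<close>, are pairwise distinct and form a basis of \<open>V/U\<close>.
\<close>

definition basis_modulo :: "'l set \<Rightarrow> 'l set \<Rightarrow> 'l set \<Rightarrow> bool" where
  "basis_modulo V U B \<longleftrightarrow>
     B \<subseteq> V \<and> span (B \<union> U) = V \<and>
     (\<forall>F c. finite F \<and> F \<subseteq> B \<and> (\<Sum>b\<in>F. c b *\<^sub>L b) \<in> U \<longrightarrow> (\<forall>b\<in>F. c b = 0))"

definition quotient_dim :: "'l set \<Rightarrow> 'l set \<Rightarrow> nat" where
  "quotient_dim V U = card (SOME B. basis_modulo V U B)"

lemma bracket_anticomm:
  assumes "x \<in> L" "y \<in> L"
  shows "bracket x y = - bracket y x"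
proof -
  have xy: "x + y \<in> L"
    using assms subspace_L by (simp add: subspace_add)
  have "bracket x y + bracket y x = bracket (x + y) (x + y)"
    using assms xy bracket_self[of x] bracket_self[of y]
    by (simp add: bracket_add_left bracket_add_right del: bracket_self)
  also have "\<dots> = 0"
    using xy by (rule bracket_self)
  finally have "bracket x y + bracket y x = 0" .
  then show ?thesis by (simp add: eq_neg_iff_add_eq_0)
qed

end


section \<open>Chevalley--Eilenberg cohomology\<close>

locale lie_module_on =
  lie_algebra_on scale L bracket + M: vector_space scaleM
  for scale :: "complex \<Rightarrow> 'l::ab_group_add \<Rightarrow> 'l" (infixr \<open>*\<^sub>L\<close> 75)
    and L bracket
    and scaleM :: "complex \<Rightarrow> 'm::ab_group_add \<Rightarrow> 'm" (infixr \<open>*\<^sub>M\<close> 75) +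
  fixes M :: "'m set"
    and act :: "'l \<Rightarrow> 'm \<Rightarrow> 'm"
  assumes subspace_M: "M.subspace M"
    and act_closed: "\<lbrakk>x \<in> L; m \<in> M\<rbrakk> \<Longrightarrow> act x m \<in> M"
    and act_add_left: "\<lbrakk>x \<in> L; y \<in> L; m \<in> M\<rbrakk> \<Longrightarrow> act (x + y) m = act x m + act y m"
    and act_add_right: "\<lbrakk>x \<in> L; m \<in> M; n \<in> M\<rbrakk> \<Longrightarrow> act x (m + n) = act x m + act x n"
    and act_scale_left: "\<lbrakk>x \<in> L; m \<in> M\<rbrakk> \<Longrightarrow> act (c *\<^sub>L x) m = c *\<^sub>M act x m"
    and act_scale_right: "\<lbrakk>x \<in> L; m \<in> M\<rbrakk> \<Longrightarrow> act x (c *\<^sub>M m) = c *\<^sub>M act x m"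
    and act_bracket: "\<lbrakk>x \<in> L; y \<in> L; m \<in> M\<rbrakk> \<Longrightarrow>
      act (bracket x y) m = act x (act y m) - act y (act x m)"
begin

definition tuples :: "nat \<Rightarrow> 'l list set" where
  "tuples n = {xs. length xs = n \<and> set xs \<subseteq> L}"

text \<open>
  Alternating \<open>n\<close>-linear maps \<open>L\<^sup>n \<rightarrow> M\<close>, as functions on lists that are normalised to be \<open>0\<close>
  off \<open>L\<^sup>n\<close>, so that equality of cochains is equality of functions.
\<close>

definition cochains :: "nat \<Rightarrow> ('l list \<Rightarrow> 'm) set" where
  "cochains n = {f.
     (\<forall>xs\<in>tuples n. f xs \<in> M) \<and>
     (\<forall>xs. xs \<notin> tuples n \<longrightarrow> f xs = 0) \<and>
     (\<forall>xs\<in>tuples n. \<forall>i<n. \<forall>x\<in>L. \<forall>y\<in>L. f (xs[i := x + y]) = f (xs[i := x]) + f (xs[i := y])) \<and>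
     (\<forall>xs\<in>tuples n. \<forall>i<n. \<forall>x\<in>L. \<forall>c. f (xs[i := c *\<^sub>L x]) = c *\<^sub>M f (xs[i := x])) \<and>
     (\<forall>xs\<in>tuples n. \<forall>i j. i < j \<and> j < n \<and> xs ! i = xs ! j \<longrightarrow> f xs = 0)}"

text \<open>
  \<open>(df)(x\<^sub>0, \<dots>, x\<^sub>n) = \<Sum>\<^sub>i (-1)\<^sup>i x\<^sub>i \<cdot> f(\<dots>, x\<^sub>i omitted, \<dots>)
    + \<Sum>\<^sub>i\<^sub><\<^sub>j (-1)\<^sup>i\<^sup>+\<^sup>j f([x\<^sub>i, x\<^sub>j], \<dots>, x\<^sub>i and x\<^sub>j omitted, \<dots>)\<close>
  for an \<open>n\<close>-cochain \<open>f\<close>; \<open>nths xs (- I)\<close> deletes the entries of \<open>xs\<close> at the positions in \<open>I\<close>.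
\<close>

definition differential :: "nat \<Rightarrow> ('l list \<Rightarrow> 'm) \<Rightarrow> 'l list \<Rightarrow> 'm" where
  "differential n f xs =
     (if xs \<in> tuples (Suc n) then
        (\<Sum>i\<le>n. (-1) ^ i *\<^sub>M act (xs ! i) (f (nths xs (- {i})))) +
        (\<Sum>j\<le>n. \<Sum>i<j. (-1) ^ (i + j) *\<^sub>M f (bracket (xs ! i) (xs ! j) # nths xs (- {i, j})))
      else 0)"

definition cocycles :: "nat \<Rightarrow> ('l list \<Rightarrow> 'm) set" where
  "cocycles n = {f \<in> cochains n. differential n f = 0}"

fun coboundaries :: "nat \<Rightarrow> ('l list \<Rightarrow> 'm) set" where
  "coboundaries 0 = {0}"
| "coboundaries (Suc n) = differential n ` cochains n"

text \<open>The quotient \<open>Z\<^sup>n/B\<^sup>n\<close> as a set of cosets; its zero element is \<open>B\<^sup>n\<close>.\<close>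

definition cohomology :: "nat \<Rightarrow> ('l list \<Rightarrow> 'm) set set" where
  "cohomology n = (\<lambda>f. (+) f ` coboundaries n) ` cocycles n"

definition cohomology_vanishes :: "nat \<Rightarrow> bool" where
  "cohomology_vanishes n \<longleftrightarrow> cohomology n = {coboundaries n}"

end

lemma (in lie_algebra_on) adjoint_module: "lie_module_on scale L bracket scale L bracket"
proof (unfold_locales, goal_cases)
  case (7 x y m)
  have "bracket m (bracket x y) = - bracket (bracket x y) m"
    using 7 by (intro bracket_anticomm bracket_closed)
  moreover have "bracket y (bracket m x) = - bracket y (bracket x m)"
    using 7 bracket_anticomm[of m x] bracket_scale_right[of y "bracket x m" "-1"]
    by (simp add: bracket_closed)
  ultimately show ?case
    using jacobi[of x y m] 7 by (simp add: algebra_simps)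
qed (simp_all add: subspace_L bracket_closed bracket_add_left bracket_add_right
       bracket_scale_left bracket_scale_right)


section \<open>Tori, weights and the semidirect product with a torus\<close>

text \<open>The Lie algebra \<open>N\<close> is the whole type, so that \<open>End(N)\<close> consists of functions on that type.\<close>

locale fin_dim_lie_algebra = lie_algebra_on scale UNIV bracket
  for scale :: "complex \<Rightarrow> 'n::ab_group_add \<Rightarrow> 'n" (infixr \<open>*\<^sub>N\<close> 75)
    and bracket :: "'n \<Rightarrow> 'n \<Rightarrow> 'n" +
  assumes finite_dimensional: "\<exists>B. finite B \<and> span B = UNIV"
begin

definition endo_scale :: "complex \<Rightarrow> ('n \<Rightarrow> 'n) \<Rightarrow> ('n \<Rightarrow> 'n)" where
  "endo_scale c f = (\<lambda>v. c *\<^sub>N f v)"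

sublocale endo: vector_space endo_scale
  by unfold_locales (auto simp: endo_scale_def fun_eq_iff scale_right_distrib scale_left_distrib)

definition derivations :: "('n \<Rightarrow> 'n) set" where
  "derivations = {d. Vector_Spaces.linear scale scale d \<and>
     (\<forall>u v. d (bracket u v) = bracket (d u) v + bracket u (d v))}"

definition diagonalizable :: "('n \<Rightarrow> 'n) \<Rightarrow> bool" where
  "diagonalizable d \<longleftrightarrow> (\<exists>B. independent B \<and> span B = UNIV \<and> (\<forall>b\<in>B. \<exists>c. d b = c *\<^sub>N b))"

definition torus :: "('n \<Rightarrow> 'n) set \<Rightarrow> bool" where
  "torus T \<longleftrightarrow> endo.subspace T \<and> T \<subseteq> derivations \<and>
     (\<forall>x\<in>T. \<forall>y\<in>T. (x \<circ> y) - (y \<circ> x) = 0) \<and> (\<forall>x\<in>T. diagonalizable x)"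

definition maximal_torus :: "('n \<Rightarrow> 'n) set \<Rightarrow> bool" where
  "maximal_torus T \<longleftrightarrow> torus T \<and> (\<forall>T'. torus T' \<and> T \<subseteq> T' \<longrightarrow> T' = T)"

text \<open>\<open>T\<^sup>*\<close>; functionals are normalised to be \<open>0\<close> off \<open>T\<close>, so that equal functionals are equal functions.\<close>

definition dual :: "('n \<Rightarrow> 'n) set \<Rightarrow> (('n \<Rightarrow> 'n) \<Rightarrow> complex) set" where
  "dual T = {\<alpha>. (\<forall>x\<in>T. \<forall>y\<in>T. \<alpha> (x + y) = \<alpha> x + \<alpha> y) \<and>
     (\<forall>c. \<forall>x\<in>T. \<alpha> (endo_scale c x) = c * \<alpha> x) \<and> (\<forall>x. x \<notin> T \<longrightarrow> \<alpha> x = 0)}"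

definition weight_space :: "('n \<Rightarrow> 'n) set \<Rightarrow> (('n \<Rightarrow> 'n) \<Rightarrow> complex) \<Rightarrow> 'n set" where
  "weight_space T \<alpha> = {e. \<forall>x\<in>T. x e = \<alpha> x *\<^sub>N e}"

definition weights :: "('n \<Rightarrow> 'n) set \<Rightarrow> (('n \<Rightarrow> 'n) \<Rightarrow> complex) set" where
  "weights T = {\<alpha> \<in> dual T. weight_space T \<alpha> \<noteq> {0}}"

definition maximal_rank :: "('n \<Rightarrow> 'n) set \<Rightarrow> bool" where
  "maximal_rank T \<longleftrightarrow> endo.dim T = quotient_dim UNIV (lower_central 2)"

definition weight_condition :: "('n \<Rightarrow> 'n) set \<Rightarrow> bool" where
  "weight_condition T \<longleftrightarrow>
     (\<forall>\<alpha>\<in>weights T. dim (weight_space T \<alpha>) = 1) \<and>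
     (\<forall>\<alpha>\<in>weights T. \<forall>\<beta>\<in>weights T. \<alpha> \<noteq> \<beta> \<and> \<alpha> + \<beta> \<in> weights T \<longrightarrow>
        set_bracket (weight_space T \<alpha>) (weight_space T \<beta>) = weight_space T (\<alpha> + \<beta>))"

definition sd_scale :: "complex \<Rightarrow> 'n \<times> ('n \<Rightarrow> 'n) \<Rightarrow> 'n \<times> ('n \<Rightarrow> 'n)" where
  "sd_scale c = (\<lambda>(e, x). (c *\<^sub>N e, endo_scale c x))"

text \<open>The second component vanishes when \<open>x\<close> and \<open>y\<close> lie in a common torus.\<close>

definition sd_bracket :: "'n \<times> ('n \<Rightarrow> 'n) \<Rightarrow> 'n \<times> ('n \<Rightarrow> 'n) \<Rightarrow> 'n \<times> ('n \<Rightarrow> 'n)" where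
  "sd_bracket = (\<lambda>(e, x) (e', y). (bracket e e' + x e' - y e, (x \<circ> y) - (y \<circ> x)))"

definition semidirect :: "('n \<Rightarrow> 'n) set \<Rightarrow> ('n \<times> ('n \<Rightarrow> 'n)) set" where
  "semidirect T = UNIV \<times> T"

lemma lie_algebra_semidirect:
  assumes "torus T"
  shows "lie_algebra_on sd_scale (semidirect T) sd_bracket"
proof -
  have sub: "endo.subspace T" and der: "T \<subseteq> derivations"
    and comm: "\<And>x y. x \<in> T \<Longrightarrow> y \<in> T \<Longrightarrow> (x \<circ> y) - (y \<circ> x) = 0"
    using assms by (auto simp: torus_def)
  have comm': "x (y v) = y (x v)" if "x \<in> T" "y \<in> T" for x y v
  proof -
    have "x \<circ> y = y \<circ> x"
      using comm[OF that] by (rule eq_iff_diff_eq_0[THEN iffD2])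
    then show ?thesis by (rule comp_eq_dest)
  qed
  have lin: "x (u + v) = x u + x v" "x (c *\<^sub>N u) = c *\<^sub>N x u" "x (u - v) = x u - x v"
    "x (bracket u v) = bracket (x u) v + bracket u (x v)"
    if "x \<in> T" for x u v c
  proof -
    interpret Vector_Spaces.linear scale scale x
      using der that by (auto simp: derivations_def)
    show "x (u + v) = x u + x v" "x (c *\<^sub>N u) = c *\<^sub>N x u" "x (u - v) = x u - x v"
      by (simp_all add: add scale diff)
    show "x (bracket u v) = bracket (x u) v + bracket u (x v)"
      using der that by (auto simp: derivations_def)
  qed
  interpret sd: vector_space sd_scale
    by unfold_locales
      (auto simp: sd_scale_def endo_scale_def fun_eq_iff scale_right_distrib scale_left_distrib)
  have neg: "bracket (- u) v = - bracket u v" "bracket u (- v) = - bracket u v" for u v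
    using bracket_scale_left[of u v "-1"] bracket_scale_right[of u v "-1"] by simp_all
  have dif: "bracket (u - w) v = bracket u v - bracket w v"
    "bracket v (u - w) = bracket v u - bracket v w" for u v w
    using bracket_add_left[of u "-w" v] bracket_add_right[of v u "-w"] by (simp_all add: neg)
  have add: "bracket (u + w) v = bracket u v + bracket w v"
    "bracket v (u + w) = bracket v u + bracket v w" for u v w
    by (simp_all add: bracket_add_left bracket_add_right)
  note sd = semidirect_def sd_bracket_def sd_scale_def
  show ?thesis
  proof (unfold_locales, goal_cases)
    case 1
    show ?case
      using sub by (auto simp: sd.subspace_def endo.subspace_def sd zero_prod_def)
  next
    case (2 x y)
    then show ?case
      using comm endo.subspace_0[OF sub] by (auto simp: sd)
  next
    case (3 x y z)
    then show ?case by (auto simp: sd add lin fun_eq_iff algebra_simps)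
  next
    case (4 x y z)
    then show ?case by (auto simp: sd add lin fun_eq_iff algebra_simps)
  next
    case (5 x y c)
    then show ?case
      by (auto simp: sd endo_scale_def lin fun_eq_iff algebra_simps bracket_scale_left)
  next
    case (6 x y c)
    then show ?case
      by (auto simp: sd endo_scale_def lin fun_eq_iff algebra_simps bracket_scale_right)
  next
    case (7 x)
    then show ?case by (auto simp: sd bracket_self zero_prod_def)
  next
    case (8 x y z)
    obtain a p b q c r where xyz: "x = (a, p)" "y = (b, q)" "z = (c, r)"
      by (metis surj_pair)
    have T: "p \<in> T" "q \<in> T" "r \<in> T" using 8 xyz by (auto simp: sd)
    have A: "bracket c (p b) = - bracket (p b) c" "bracket b (p c) = - bracket (p c) b"
      "bracket c (q a) = - bracket (q a) c" "bracket a (q c) = - bracket (q c) a"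
      "bracket a (r b) = - bracket (r b) a" "bracket b (r a) = - bracket (r a) b"
      by (rule bracket_anticomm; simp)+
    have J: "bracket a (bracket b c) = - bracket b (bracket c a) - bracket c (bracket a b)"
      using jacobi[of a b c] by (simp add: algebra_simps eq_neg_iff_add_eq_0)
    have C: "q (p v) = p (q v)" "r (p v) = p (r v)" "r (q v) = q (r v)" for v
      using T comm' by blast+
    have c0: "sd_bracket (u, f) (v, g) = (bracket u v + f v - g u, 0)"
      if "f \<in> T" "g \<in> T" for u v f g
      using comm[OF that] by (simp add: sd)
    have "bracket a (bracket b c + q c - r b) + p (bracket b c + q c - r b)
        + (bracket b (bracket c a + r a - p c) + q (bracket c a + r a - p c))
        + (bracket c (bracket a b + p b - q a) + r (bracket a b + p b - q a)) = 0"
      by (simp add: add dif lin T C A J)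
    then show ?case
      using T endo.subspace_0[OF sub] by (simp add: xyz c0 zero_prod_def)
  qed
qed

definition semidirect_cohomology_vanishes :: "('n \<Rightarrow> 'n) set \<Rightarrow> nat \<Rightarrow> bool" where
  "semidirect_cohomology_vanishes T i \<longleftrightarrow>
     lie_module_on.cohomology_vanishes
       sd_scale (semidirect T) sd_bracket sd_scale (semidirect T) sd_bracket i"

end

end

theory Submission
  imports Defs "HOL-Library.Multiset"
begin

text \<open>
  Let \<open>R = N \<rtimes> T\<close>. A set \<open>E\<close> of weight vectors that is a basis of \<open>N\<close> modulo \<open>[N, N]\<close> generates the
  nilpotent algebra \<open>N\<close>, so \<open>T\<close> acts faithfully on the span of \<open>E\<close>, by diagonal matrices; as the rank is
  maximal, \<open>T\<close> consists of all of them. Hence \<open>T\<close> has a basis \<open>X e\<close>, \<open>e \<in> E\<close>, that counts generators: an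
  iterated bracket of a word in \<open>E\<close> is an eigenvector of \<open>X e\<close>, and its eigenvalue is the number of
  occurrences of \<open>e\<close> in the word. Words longer than \<open>s\<close> have bracket \<open>0\<close>.

  The torus is removed from the complex by the argument of Hochschild and Serre. Call a cochain basic if
  it is invariant under \<open>T\<close> and vanishes as soon as one argument lies in \<open>T\<close>. By Cartan's formula
  \<open>theta x = d \<circ> i\<^sub>x + i\<^sub>x \<circ> d\<close> and semisimplicity, cocycles can be made invariant; and if \<open>\<xi>\<close> is a closed
  1-form with \<open>\<xi> x = 1\<close>, then \<open>f \<mapsto> f - \<xi> \<and> i\<^sub>x f\<close> kills the contraction with \<open>x\<close>. Handling the basis
  elements of \<open>T\<close> one at a time (\<open>exact_at_insert\<close>, \<open>exact_at_remove\<close>), exactness of the whole complex in a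
  given degree implies exactness of the basic complex in that degree, and exactness of the basic
  complex in all degrees implies exactness of the whole complex in all degrees
  (\<open>exact_at_split_toral\<close>).

  It remains to see that the basic complex is exact in every degree \<open>n \<ge> s\<close>. The value of a basic
  cochain on \<open>n\<close> iterated brackets has as its weight the sum of the \<open>n\<close> weights. This weight is not zero,
  so the value lies in \<open>N\<close>; and if the value is not zero, the weight is that of a word of length at most
  \<open>s\<close>, whereas the \<open>n\<close> given words have total length at least \<open>n\<close>. So basic cochains of degree greater
  than \<open>s\<close> vanish (\<open>exact_above\<close>), and a basic cochain \<open>f\<close> of degree \<open>s\<close> is determined by its values
  on \<open>s\<close> distinct generators. If such a value \<open>c\<close> is not zero, then its weight space contains a nonzero
  iterated bracket of the same \<open>s\<close> generators, and its innermost bracket \<open>[p, q]\<close> is not zero. Let \<open>\<phi>\<close>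
  be a 1-form supported on the weight space of \<open>[p, q]\<close> with \<open>\<phi> [p, q] = 1\<close>, and form the exterior product
  of \<open>\<phi>\<close> and the coordinates of the other \<open>s - 2\<close> generators, with coefficient \<open>c\<close>. For weight reasons the
  coboundary of this basic cochain is \<open>\<plusminus>c\<close> on the given generators, and it is \<open>0\<close> on every \<open>s\<close>-tuple of
  generators that does not rearrange them. Hence it cancels one value of \<open>f\<close> and its rearrangements
  (\<open>cancel_top_value\<close>), and after finitely many steps \<open>f\<close> is a coboundary
  (\<open>exact_top\<close>). Degrees below \<open>s\<close> are the hypothesis.
\<close>

section \<open>Diagonalizable operators on a subspace\<close>

text \<open>
  The product of the commuting factors \<open>A - m\<close> for \<open>m\<close> in \<open>ms\<close>, applied to \<open>v\<close>. Diagonalizability of \<open>A\<close>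
  is used in the form that such a product with distinct \<open>m\<close> is zero.
\<close>

fun factors :: "('a \<Rightarrow> 'b \<Rightarrow> 'b) \<Rightarrow> ('b \<Rightarrow> 'b) \<Rightarrow> 'a list \<Rightarrow> 'b \<Rightarrow> 'b::ab_group_add" where
  "factors sc A [] v = v"
| "factors sc A (m # ms) v = factors sc A ms (A v - sc m v)"

locale endomorphism_on = vector_space scale
  for scale :: "'a::field \<Rightarrow> 'b::ab_group_add \<Rightarrow> 'b" (infixr \<open>*s\<close> 75) +
  fixes U :: "'b set" and A :: "'b \<Rightarrow> 'b"
  assumes subspace_U: "subspace U"
    and A_closed: "u \<in> U \<Longrightarrow> A u \<in> U"
    and A_add: "u \<in> U \<Longrightarrow> v \<in> U \<Longrightarrow> A (u + v) = A u + A v"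
    and A_scale: "u \<in> U \<Longrightarrow> A (c *s u) = c *s A u"
begin

lemma U_closed [simp]:
  "0 \<in> U" "u \<in> U \<Longrightarrow> v \<in> U \<Longrightarrow> u + v \<in> U" "u \<in> U \<Longrightarrow> v \<in> U \<Longrightarrow> u - v \<in> U"
  "u \<in> U \<Longrightarrow> - u \<in> U" "u \<in> U \<Longrightarrow> c *s u \<in> U" "u \<in> U \<Longrightarrow> A u \<in> U"
  using subspace_U
  by (simp_all add: subspace_0 subspace_add subspace_diff subspace_neg subspace_scale A_closed)

lemma A_diff: "u \<in> U \<Longrightarrow> v \<in> U \<Longrightarrow> A (u - v) = A u - A v"
  using A_add[of u "(- 1) *s v"] A_scale[of v "- 1"] U_closed(5)[of v "- 1"] by simp

lemma A_zero [simp]: "A 0 = 0"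
  using A_scale[of 0 0] by simp

abbreviation "fac \<equiv> factors scale A"

lemma factors_append: "fac (ms @ ns) v = fac ns (fac ms v)"
  by (induction ms arbitrary: v) auto

lemma factors_closed [simp]: "v \<in> U \<Longrightarrow> fac ms v \<in> U"
  by (induction ms arbitrary: v) auto

lemma factors_add: "u \<in> U \<Longrightarrow> v \<in> U \<Longrightarrow> fac ms (u + v) = fac ms u + fac ms v"
proof (induction ms arbitrary: u v)
  case (Cons m ms)
  have "A (u + v) - m *s (u + v) = (A u - m *s u) + (A v - m *s v)"
    using Cons.prems by (simp add: A_add scale_right_distrib)
  then show ?case using Cons by simp
qed simp

lemma factors_scale: "u \<in> U \<Longrightarrow> fac ms (c *s u) = c *s fac ms u"
proof (induction ms arbitrary: u)
  case (Cons m ms)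
  have "A (c *s u) - m *s (c *s u) = c *s (A u - m *s u)"
    using Cons.prems by (simp add: A_scale scale_right_diff_distrib mult.commute)
  then show ?case using Cons by simp
qed simp

lemma factors_A: "u \<in> U \<Longrightarrow> fac ms (A u) = A (fac ms u)"
proof (induction ms arbitrary: u)
  case (Cons m ms)
  have "A (A u) - m *s A u = A (A u - m *s u)"
    using Cons.prems by (simp add: A_scale A_diff)
  then show ?case using Cons by simp
qed simp

lemma factors_diff:
  assumes "u \<in> U" "v \<in> U"
  shows "fac ms (u - v) = fac ms u - fac ms v"
  using factors_add[OF assms(1), of "(- 1) *s v" ms] factors_scale[OF assms(2), of ms "- 1"] assms
  by simp

lemma factors_zero [simp]: "fac ms 0 = 0"
  using factors_scale[of 0 ms 0] by simp

lemma factors_move_front: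
  assumes "v \<in> U"
  shows "fac (as @ m # bs) v = fac (as @ bs) (A v - m *s v)"
proof -
  have "fac as (A v - m *s v) = A (fac as v) - m *s fac as v"
    using assms by (simp add: factors_diff factors_A factors_scale)
  then show ?thesis by (simp add: factors_append)
qed

text \<open>
  Different vectors have different annihilating products; enlarging the set of roots gives a common one.
\<close>

lemma factors_superset:
  assumes "v \<in> U" "fac ms v = 0" "distinct ms" "set ms \<subseteq> set ns"
  shows "fac ns v = 0"
  using assms
proof (induction ms arbitrary: v ns)
  case (Cons m ms)
  have "m \<in> set ns" using Cons.prems(4) by simp
  then obtain as bs where ns: "ns = as @ m # bs" by (metis split_list)
  have "set ms \<subseteq> set (as @ bs)" using Cons.prems(3,4) ns by auto
  moreover have "fac ms (A v - m *s v) = 0" using Cons.prems(2) by simp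
  ultimately have "fac (as @ bs) (A v - m *s v) = 0"
    using Cons.prems(1,3) Cons.IH[of "A v - m *s v" "as @ bs"] by simp
  then show ?case by (simp only: ns factors_move_front[OF Cons.prems(1)])
qed simp

lemma factors_eigenvector:
  assumes "v \<in> U" "A v = c *s v" "c \<in> set ms"
  shows "fac ms v = 0"
  by (rule factors_superset[of _ "[c]"]) (use assms in auto)

lemma factors_span:
  assumes "v \<in> span {u \<in> U. \<exists>c\<in>set ms. A u = c *s u}"
  shows "v \<in> U \<and> fac ms v = 0"
  using assms
proof (induction rule: span_induct_alt)
  case (step c x y)
  then have "x \<in> U" "fac ms x = 0" using factors_eigenvector by auto
  then show ?case using step.IH by (simp add: factors_add factors_scale)
qed simp

text \<open>
  A root of multiplicity one of an annihilating polynomial: \<open>v\<close> splits into a part in the kernel of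
  \<open>A\<close> and a part in its image, within any subspace that is stable under \<open>A\<close>.
\<close>

lemma kernel_image_split:
  assumes "v \<in> U" "fac ms (A v) = 0" "0 \<notin> set ms"
  shows "\<exists>k\<in>U. \<exists>w\<in>U. v = k + A w \<and> A k = 0"
  using assms
proof (induction ms arbitrary: v)
  case Nil
  then show ?case by (intro bexI[of _ v] bexI[of _ 0]) auto
next
  case (Cons m ms)
  have "A (A v - m *s v) = A (A v) - m *s A v"
    using Cons.prems(1) by (simp add: A_diff A_scale)
  then obtain k w where k: "k \<in> U" "A k = 0" and w: "w \<in> U" and uk: "A v - m *s v = k + A w"
    using Cons.IH[of "A v - m *s v"] Cons.prems by auto
  have m: "m \<noteq> 0" using Cons.prems by auto
  have "m *s v = - k + A (v - w)"
    using uk A_diff[OF Cons.prems(1) w] by (simp add: algebra_simps)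
  then have "(1 / m) *s (m *s v) = (1 / m) *s (- k) + (1 / m) *s A (v - w)"
    by (simp only: scale_right_distrib)
  then have "v = (1 / m) *s (- k) + A ((1 / m) *s (v - w))"
    using m Cons.prems w A_scale[of "v - w" "1 / m"] by simp
  moreover have "A ((1 / m) *s (- k)) = 0"
    using A_scale[OF k(1), of "- (1 / m)"] k by simp
  ultimately show ?case using Cons.prems k w U_closed by (meson)
qed

text \<open>
  If \<open>A v - m v\<close> is a sum of eigenvectors for eigenvalues \<open>d \<noteq> m\<close>, then it equals \<open>A w - m w\<close>, where \<open>w\<close>
  rescales these eigenvectors by \<open>1 / (d - m)\<close>; the rest \<open>v - w\<close> is an eigenvector for \<open>m\<close>.
\<close>

lemma eigenvector_decomposition:
  assumes "v \<in> U" "fac ms v = 0" "distinct ms"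
  shows "v \<in> span {u \<in> U. \<exists>c\<in>set ms. A u = c *s u}"
  using assms
proof (induction ms arbitrary: v)
  case Nil
  then show ?case by (simp add: span_zero)
next
  case (Cons m ms)
  let ?E = "\<lambda>ms. {u \<in> U. \<exists>c\<in>set ms. A u = c *s u}"
  have "A v - m *s v \<in> span (?E ms)"
    using Cons by simp
  then have "\<exists>w. w \<in> U \<and> w \<in> span (?E ms) \<and> A v - m *s v = A w - m *s w"
  proof (induction rule: span_induct_alt)
    case base
    show ?case by (rule exI[of _ 0]) (auto intro: span_zero)
  next
    case (step c x y)
    then obtain w d where w: "w \<in> U" "w \<in> span (?E ms)" "y = A w - m *s w"
      and x: "x \<in> U" "A x = d *s x" "d \<in> set ms" by auto
    have dm: "d - m \<noteq> 0" using x Cons.prems by auto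
    let ?x = "(c / (d - m)) *s x"
    have "A (?x + w) - m *s (?x + w) = (A ?x - m *s ?x) + y"
      using w x by (simp add: A_add scale_right_distrib)
    also have "A ?x - m *s ?x = ((c / (d - m)) * (d - m)) *s x"
      using x by (simp add: A_scale scale_left_diff_distrib right_diff_distrib diff_divide_distrib mult.commute)
    also have "\<dots> = c *s x" using dm by simp
    finally have "A (?x + w) - m *s (?x + w) = c *s x + y" .
    moreover have "?x + w \<in> span (?E ms)"
      using w x by (intro span_add span_scale) (auto intro: span_base)
    moreover have "?x + w \<in> U" using w x by simp
    ultimately show ?case by (intro exI[of _ "?x + w"] conjI) simp_all
  qed
  then obtain w where w: "w \<in> U" "w \<in> span (?E ms)" "A v - m *s v = A w - m *s w" by blast
  have "A (v - w) = m *s (v - w)"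
    using w Cons.prems by (simp add: A_diff algebra_simps)
  then have "v - w \<in> ?E (m # ms)"
    using w Cons.prems by simp
  moreover have "w \<in> span (?E (m # ms))"
    using w(2) by (rule rev_subsetD) (rule span_mono, auto)
  ultimately have "(v - w) + w \<in> span (?E (m # ms))"
    by (intro span_add) (auto intro: span_base)
  then show ?case by simp
qed

end

section \<open>Cochains and contractions\<close>

lemma nths_Cons_compl [simp]:
  "nths (y # ys) (- {0}) = ys"
  "nths (y # ys) (- {Suc i}) = y # nths ys (- {i})"
  "nths (y # ys) (- {0, Suc l}) = nths ys (- {l})"
  "nths (y # ys) (- {Suc k, Suc l}) = y # nths ys (- {k, l})"
  by (auto simp: nths_Cons Compl_eq nths_all intro!: arg_cong[where f = "nths ys"])

context lie_module_on
begin

definition cscale :: "complex \<Rightarrow> ('l list \<Rightarrow> 'm) \<Rightarrow> 'l list \<Rightarrow> 'm" where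
  "cscale c f = (\<lambda>xs. c *\<^sub>M f xs)"

sublocale fn: vector_space cscale
  by unfold_locales
    (auto simp: cscale_def fun_eq_iff M.scale_right_distrib M.scale_left_distrib)

lemma cscale_apply [simp]: "cscale c f xs = c *\<^sub>M f xs"
  by (simp add: cscale_def)

text \<open>
  The contraction \<open>i\<^sub>y\<close>. It makes recursion on the argument list into an operator calculus: a cochain of
  positive degree is determined by its contractions, and the operators below are described by their
  commutation rules with contractions.
\<close>

definition contract :: "'l \<Rightarrow> ('l list \<Rightarrow> 'm) \<Rightarrow> 'l list \<Rightarrow> 'm" where
  "contract y f = (\<lambda>ys. f (y # ys))"

lemma contract_linear [simp]:
  "contract y (f + g) = contract y f + contract y g"
  "contract y (f - g) = contract y f - contract y g"
  "contract y (- f) = - contract y f"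
  "contract y (cscale c f) = cscale c (contract y f)"
  "contract y 0 = 0"
  by (auto simp: contract_def cscale_def fun_eq_iff)

lemma L_closed [simp]:
  "0 \<in> L" "x \<in> L \<Longrightarrow> y \<in> L \<Longrightarrow> x + y \<in> L" "x \<in> L \<Longrightarrow> c *\<^sub>L x \<in> L"
  "x \<in> L \<Longrightarrow> y \<in> L \<Longrightarrow> bracket x y \<in> L"
  using subspace_L by (auto intro: subspace_0 subspace_add subspace_scale bracket_closed)

lemma M_closed [simp]:
  "0 \<in> M" "m \<in> M \<Longrightarrow> n \<in> M \<Longrightarrow> m + n \<in> M" "m \<in> M \<Longrightarrow> n \<in> M \<Longrightarrow> m - n \<in> M"
  "m \<in> M \<Longrightarrow> c *\<^sub>M m \<in> M" "x \<in> L \<Longrightarrow> m \<in> M \<Longrightarrow> act x m \<in> M"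
  using subspace_M
  by (auto intro: M.subspace_0 M.subspace_add M.subspace_diff M.subspace_scale act_closed)

lemma act_zero_right [simp]: "x \<in> L \<Longrightarrow> act x 0 = 0"
  using act_scale_right[of x 0 0] by simp

lemma bracket_zero [simp]: "x \<in> L \<Longrightarrow> bracket x 0 = 0" "x \<in> L \<Longrightarrow> bracket 0 x = 0"
  using bracket_scale_right[of x 0 0] bracket_scale_left[of 0 x 0] by auto

lemma cochains_0_iff: "f \<in> cochains 0 \<longleftrightarrow> f [] \<in> M \<and> (\<forall>xs. xs \<noteq> [] \<longrightarrow> f xs = 0)"
  by (auto simp: cochains_def tuples_def)

lemma tuples_Suc_iff: "xs \<in> tuples (Suc n) \<longleftrightarrow> (\<exists>y ys. xs = y # ys \<and> y \<in> L \<and> ys \<in> tuples n)"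
  by (auto simp: tuples_def length_Suc_conv)

lemma cochainsD:
  assumes "f \<in> cochains n"
  shows "\<And>xs. xs \<in> tuples n \<Longrightarrow> f xs \<in> M" "\<And>xs. xs \<notin> tuples n \<Longrightarrow> f xs = 0"
    and "\<And>xs i x y. xs \<in> tuples n \<Longrightarrow> i < n \<Longrightarrow> x \<in> L \<Longrightarrow> y \<in> L \<Longrightarrow>
      f (xs[i := x + y]) = f (xs[i := x]) + f (xs[i := y])"
    and "\<And>xs i x c. xs \<in> tuples n \<Longrightarrow> i < n \<Longrightarrow> x \<in> L \<Longrightarrow>
      f (xs[i := c *\<^sub>L x]) = c *\<^sub>M f (xs[i := x])"
    and "\<And>xs i j. xs \<in> tuples n \<Longrightarrow> i < j \<Longrightarrow> j < n \<Longrightarrow> xs ! i = xs ! j \<Longrightarrow> f xs = 0"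
  using assms unfolding cochains_def mem_Collect_eq by blast+

lemma cochainsI:
  assumes "\<And>xs. xs \<in> tuples n \<Longrightarrow> f xs \<in> M" "\<And>xs. xs \<notin> tuples n \<Longrightarrow> f xs = 0"
    and "\<And>xs i x y. xs \<in> tuples n \<Longrightarrow> i < n \<Longrightarrow> x \<in> L \<Longrightarrow> y \<in> L \<Longrightarrow>
      f (xs[i := x + y]) = f (xs[i := x]) + f (xs[i := y])"
    and "\<And>xs i x c. xs \<in> tuples n \<Longrightarrow> i < n \<Longrightarrow> x \<in> L \<Longrightarrow>
      f (xs[i := c *\<^sub>L x]) = c *\<^sub>M f (xs[i := x])"
    and "\<And>xs i j. xs \<in> tuples n \<Longrightarrow> i < j \<Longrightarrow> j < n \<Longrightarrow> xs ! i = xs ! j \<Longrightarrow> f xs = 0"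
  shows "f \<in> cochains n"
  using assms unfolding cochains_def mem_Collect_eq by blast

lemma cochains_Suc_D:
  assumes f: "f \<in> cochains (Suc n)"
  shows "f [] = 0" "\<And>y ys. y \<notin> L \<Longrightarrow> f (y # ys) = 0"
    and "\<And>y. y \<in> L \<Longrightarrow> contract y f \<in> cochains n"
    and "\<And>y z. y \<in> L \<Longrightarrow> z \<in> L \<Longrightarrow> contract (y + z) f = contract y f + contract z f"
    and "\<And>y c. y \<in> L \<Longrightarrow> contract (c *\<^sub>L y) f = cscale c (contract y f)"
    and "\<And>y. y \<in> L \<Longrightarrow> contract y (contract y f) = 0"
proof -
  note val = cochainsD(1)[OF f] and off = cochainsD(2)[OF f] and add = cochainsD(3)[OF f]
    and scl = cochainsD(4)[OF f] and alt = cochainsD(5)[OF f]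
  show "f [] = 0" "\<And>y ys. y \<notin> L \<Longrightarrow> f (y # ys) = 0" by (auto intro: off simp: tuples_def)
  show "contract y f \<in> cochains n" if y: "y \<in> L" for y
    unfolding cochains_def mem_Collect_eq contract_def
  proof (intro conjI ballI allI impI)
    fix xs assume xs: "xs \<in> tuples n"
    then have yxs: "y # xs \<in> tuples (Suc n)" using y by (auto simp: tuples_Suc_iff)
    show "f (y # xs) \<in> M" using val yxs .
    fix i assume i: "i < n"
    show "f (y # xs[i := x + z]) = f (y # xs[i := x]) + f (y # xs[i := z])"
      if "x \<in> L" "z \<in> L" for x z
      using add[OF yxs, of "Suc i" x z] i that by simp
    show "f (y # xs[i := c *\<^sub>L x]) = c *\<^sub>M f (y # xs[i := x])" if "x \<in> L" for x c
      using scl[OF yxs, of "Suc i" x] i that by simp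
  next
    fix xs i j assume "xs \<in> tuples n" "i < j \<and> j < n \<and> xs ! i = xs ! j"
    then show "f (y # xs) = 0"
      using alt[of "y # xs" "Suc i" "Suc j"] y by (auto simp: tuples_Suc_iff)
  next
    fix xs assume "xs \<notin> tuples n"
    then show "f (y # xs) = 0" by (intro off) (auto simp: tuples_Suc_iff)
  qed
  show "contract (y + z) f = contract y f + contract z f" if "y \<in> L" "z \<in> L" for y z
  proof
    fix ys
    show "contract (y + z) f ys = (contract y f + contract z f) ys"
      using add[of "y # ys" 0 y z] off[of "y # ys"] off[of "z # ys"] off[of "(y + z) # ys"] that
      by (cases "ys \<in> tuples n") (auto simp: contract_def tuples_Suc_iff)
  qed
  show "contract (c *\<^sub>L y) f = cscale c (contract y f)" if "y \<in> L" for y c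
  proof
    fix ys
    show "contract (c *\<^sub>L y) f ys = cscale c (contract y f) ys"
      using scl[of "y # ys" 0 y c] off[of "y # ys"] off[of "(c *\<^sub>L y) # ys"] that
      by (cases "ys \<in> tuples n") (auto simp: contract_def cscale_def tuples_Suc_iff)
  qed
  show "contract y (contract y f) = 0" if "y \<in> L" for y
  proof
    fix ys
    show "contract y (contract y f) ys = 0 ys"
    proof (cases "y # y # ys \<in> tuples (Suc n)")
      case True
      then show ?thesis using alt[of "y # y # ys" 0 1] by (auto simp: contract_def tuples_def)
    qed (simp add: contract_def off)
  qed
qed

text \<open>
  Alternation in the first two entries and alternation of all contractions imply alternation in all
  entries, because an entry can be moved to the front by transpositions.
\<close>

lemma cochains_Suc_I:
  assumes nil: "f [] = 0" and off: "\<And>y ys. y \<notin> L \<Longrightarrow> f (y # ys) = 0"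
    and con: "\<And>y. y \<in> L \<Longrightarrow> contract y f \<in> cochains n"
    and add: "\<And>y z. y \<in> L \<Longrightarrow> z \<in> L \<Longrightarrow> contract (y + z) f = contract y f + contract z f"
    and scl: "\<And>y c. y \<in> L \<Longrightarrow> contract (c *\<^sub>L y) f = cscale c (contract y f)"
    and alt: "\<And>y. y \<in> L \<Longrightarrow> contract y (contract y f) = 0"
  shows "f \<in> cochains (Suc n)"
proof -
  have val': "f (y # ys) \<in> M" if "y \<in> L" "ys \<in> tuples n" for y ys
    using cochainsD(1)[OF con[OF that(1)], of ys] that by (simp add: contract_def)
  have off': "f (y # ys) = 0" if "y \<in> L" "ys \<notin> tuples n" for y ys
    using cochainsD(2)[OF con[OF that(1)], of ys] that by (simp add: contract_def)
  have add': "f (y # xs[i := x + z]) = f (y # xs[i := x]) + f (y # xs[i := z])"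
    if "y \<in> L" "xs \<in> tuples n" "i < n" "x \<in> L" "z \<in> L" for y xs i x z
    using cochainsD(3)[OF con[OF that(1)], of xs] that by (simp add: contract_def)
  have scl': "f (y # xs[i := c *\<^sub>L x]) = c *\<^sub>M f (y # xs[i := x])"
    if "y \<in> L" "xs \<in> tuples n" "i < n" "x \<in> L" for y xs i x c
    using cochainsD(4)[OF con[OF that(1)], of xs] that by (simp add: contract_def)
  have alt': "f (y # xs) = 0"
    if "y \<in> L" "xs \<in> tuples n" "i < j" "j < n" "xs ! i = xs ! j" for y xs i j
    using cochainsD(5)[OF con[OF that(1)], of xs] that by (simp add: contract_def)
  show ?thesis
    unfolding cochains_def mem_Collect_eq
  proof (intro conjI ballI allI impI)
    fix xs assume xs: "xs \<in> tuples (Suc n)"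
    then obtain y ys where [simp]: "xs = y # ys" and y: "y \<in> L" and ys: "ys \<in> tuples n"
      by (auto simp: tuples_Suc_iff)
    show "f xs \<in> M" using val' y ys by simp
    {
      fix i assume i: "i < Suc n"
      show "f (xs[i := x + z]) = f (xs[i := x]) + f (xs[i := z])" if "x \<in> L" "z \<in> L" for x z
        using i add' y ys that fun_cong[OF add[OF that], of ys]
        by (cases i) (auto simp: contract_def)
      show "f (xs[i := c *\<^sub>L x]) = c *\<^sub>M f (xs[i := x])" if "x \<in> L" for x c
        using i scl' y ys that fun_cong[OF scl[OF that], of c ys]
        by (cases i) (auto simp: contract_def cscale_def)
    }
    fix i j assume ij: "i < j \<and> j < Suc n \<and> xs ! i = xs ! j"
    show "f xs = 0"
    proof (cases i)
      case (Suc k)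
      then show ?thesis using ij alt'[OF y ys, of k "j - 1"] by (auto simp: nth_Cons')
    next
      case 0
      then obtain k where j: "j = Suc k" "k < n" and yk: "ys ! k = y"
        using ij by (cases j) auto
      from ys j obtain z zs where zs: "ys = z # zs" and z: "z \<in> L"
        by (cases ys) (auto simp: tuples_def)
      have aux: "f (u # u # zs) = 0" if "u \<in> L" for u
        using fun_cong[OF alt[OF that], of zs] by (simp add: contract_def)
      have tail: "zs \<in> tuples (n - 1)" using ys zs by (auto simp: tuples_def)
      have yz: "y + z \<in> L" using y z by simp
      have l1: "f (a # b # zs) = f (y # b # zs) + f (z # b # zs)" if "a = y + z" for a b
        using fun_cong[OF add[OF y z], of "b # zs"] that by (simp add: contract_def)
      have l2: "f (b # (y + z) # zs) = f (b # y # zs) + f (b # z # zs)" if "b \<in> L" for b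
        using add'[OF that ys, of 0 y z] j y z zs by simp
      have swap: "f (y # z # zs) = - f (z # y # zs)"
        using aux[OF yz] l1[OF refl, of "y + z"] l2[OF y] l2[OF z] aux[OF y] aux[OF z]
        by (simp add: add_eq_0_iff)
      show ?thesis
      proof (cases k)
        case 0
        then show ?thesis using yk zs aux y by simp
      next
        case (Suc l)
        have "f (z # y # zs) = 0"
          using alt'[OF z, of "y # zs" 0 k] ys zs y yk j Suc by (auto simp: tuples_def)
        then show ?thesis using swap zs by simp
      qed
    qed
  next
    fix xs assume xs: "xs \<notin> tuples (Suc n)"
    show "f xs = 0"
    proof (cases xs)
      case (Cons y ys)
      then have "y \<notin> L \<or> y \<in> L \<and> ys \<notin> tuples n" using xs by (auto simp: tuples_Suc_iff)
      then show ?thesis using Cons off off' by auto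
    qed (simp add: nil)
  qed
qed

lemma cochains_eqI:
  assumes "f \<in> cochains (Suc n)" "g \<in> cochains (Suc n)"
    and "\<And>y. y \<in> L \<Longrightarrow> contract y f = contract y g"
  shows "f = g"
proof
  fix xs
  show "f xs = g xs"
  proof (cases xs)
    case Nil
    then show ?thesis using cochains_Suc_D(1) assms by metis
  next
    case (Cons y ys)
    then show ?thesis
      using cochains_Suc_D(2)[OF assms(1), of y ys] cochains_Suc_D(2)[OF assms(2), of y ys]
        fun_cong[OF assms(3), of y ys]
      by (cases "y \<in> L") (auto simp: contract_def)
  qed
qed

lemma cochains_0_eqI:
  "f \<in> cochains 0 \<Longrightarrow> g \<in> cochains 0 \<Longrightarrow> f [] = g [] \<Longrightarrow> f = g"
  by (rule ext) (metis cochains_0_iff)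

lemma contract_cochain_0 [simp]: "f \<in> cochains 0 \<Longrightarrow> contract y f = 0"
  by (auto simp: cochains_0_iff contract_def fun_eq_iff)

lemma contract_cochain [simp]:
  "f \<in> cochains (Suc n) \<Longrightarrow> y \<in> L \<Longrightarrow> contract y f \<in> cochains n"
  by (rule cochains_Suc_D)

lemma contract_add_vec:
  "f \<in> cochains n \<Longrightarrow> y \<in> L \<Longrightarrow> z \<in> L \<Longrightarrow> contract (y + z) f = contract y f + contract z f"
  by (cases n) (auto simp: cochains_Suc_D)

lemma contract_scale_vec:
  "f \<in> cochains n \<Longrightarrow> y \<in> L \<Longrightarrow> contract (c *\<^sub>L y) f = cscale c (contract y f)"
  by (cases n) (auto simp: cochains_Suc_D)

lemma contract_self [simp]: "f \<in> cochains n \<Longrightarrow> y \<in> L \<Longrightarrow> contract y (contract y f) = 0"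
  by (cases n) (auto simp: cochains_Suc_D)

lemma contract_zero_vec [simp]: "f \<in> cochains n \<Longrightarrow> contract 0 f = 0"
  using contract_scale_vec[of f n 0 0] by simp

lemma fn_subspace_cochains: "fn.subspace (cochains n)"
proof -
  have "0 \<in> cochains n"
    by (simp add: cochains_def)
  moreover have "f + g \<in> cochains n" if f: "f \<in> cochains n" and g: "g \<in> cochains n" for f g
  proof (rule cochainsI)
    show "(f + g) xs = 0" if "xs \<in> tuples n" "i < j" "j < n" "xs ! i = xs ! j" for xs i j
      using cochainsD(5)[OF f that] cochainsD(5)[OF g that] by simp
  qed (simp_all add: cochainsD[OF f] cochainsD[OF g] M.scale_right_distrib)
  moreover have "cscale c f \<in> cochains n" if f: "f \<in> cochains n" for c f
  proof (rule cochainsI)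
    show "cscale c f xs = 0" if "xs \<in> tuples n" "i < j" "j < n" "xs ! i = xs ! j" for xs i j
      using cochainsD(5)[OF f that] by (simp add: cscale_def)
  qed (simp_all add: cscale_def cochainsD[OF f] M.scale_right_distrib mult.commute)
  ultimately show ?thesis by (simp add: fn.subspace_def)
qed

lemma cochains_closed [simp]:
  "0 \<in> cochains n"
  "f \<in> cochains n \<Longrightarrow> g \<in> cochains n \<Longrightarrow> f + g \<in> cochains n"
  "f \<in> cochains n \<Longrightarrow> g \<in> cochains n \<Longrightarrow> f - g \<in> cochains n"
  "f \<in> cochains n \<Longrightarrow> - f \<in> cochains n"
  "f \<in> cochains n \<Longrightarrow> cscale c f \<in> cochains n"
  using fn_subspace_cochains[of n]
  by (simp_all add: fn.subspace_0 fn.subspace_add fn.subspace_diff fn.subspace_neg fn.subspace_scale)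

lemma contract_swap:
  assumes f: "f \<in> cochains n" and y: "y \<in> L" and z: "z \<in> L"
  shows "contract y (contract z f) = - contract z (contract y f)"
proof (cases n)
  case (Suc k)
  have "0 = contract (y + z) (contract (y + z) f)" using assms by simp
  also have "\<dots> = contract (y + z) (contract y f) + contract (y + z) (contract z f)"
    using assms by (simp add: contract_add_vec)
  also have "\<dots> = contract z (contract y f) + contract y (contract z f)"
    using assms Suc contract_add_vec[of "contract y f" k y z]
      contract_add_vec[of "contract z f" k y z] by simp
  finally show ?thesis by (metis add.commute eq_neg_iff_add_eq_0)
qed (use f in auto)

section \<open>Cartan's calculus\<close>

text \<open>
  The Lie derivative along \<open>x\<close>, defined by the rule \<open>i\<^sub>y \<circ> theta x = theta x \<circ> i\<^sub>y - i\<^bsub>[x, y]\<^esub>\<close>. The test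
  \<open>y \<in> L\<close> keeps cochains normalised off \<open>L\<close>.
\<close>

fun theta :: "'l \<Rightarrow> ('l list \<Rightarrow> 'm) \<Rightarrow> 'l list \<Rightarrow> 'm" where
  "theta x f [] = act x (f [])"
| "theta x f (y # ys) = (if y \<in> L then theta x (contract y f) ys - f (bracket x y # ys) else 0)"

text \<open>
  The Chevalley--Eilenberg differential, defined by Cartan's formula \<open>i\<^sub>y \<circ> d = theta y - d \<circ> i\<^sub>y\<close>.
\<close>

fun ce_d :: "('l list \<Rightarrow> 'm) \<Rightarrow> 'l list \<Rightarrow> 'm" where
  "ce_d f [] = 0"
| "ce_d f (y # ys) = (if y \<in> L then theta y f ys - ce_d (contract y f) ys else 0)"

text \<open>
  The exterior product with a 1-form: \<open>(\<xi> \<and> g)(y\<^sub>0, \<dots>, y\<^sub>n) = \<Sum>\<^sub>i (-1)\<^sup>i \<xi>(y\<^sub>i) g(\<dots>, y\<^sub>i omitted, \<dots>)\<close>.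
\<close>

fun wedge :: "('l \<Rightarrow> complex) \<Rightarrow> ('l list \<Rightarrow> 'm) \<Rightarrow> 'l list \<Rightarrow> 'm" where
  "wedge \<xi> g [] = 0"
| "wedge \<xi> g (y # ys) = (if y \<in> L then \<xi> y *\<^sub>M g ys - wedge \<xi> (contract y g) ys else 0)"

lemma contract_theta:
  "y \<in> L \<Longrightarrow> contract y (theta x f) = theta x (contract y f) - contract (bracket x y) f"
  by (rule ext) (simp add: contract_def[of y "theta x f"] contract_def[of "bracket x y"])

lemma contract_ce_d: "y \<in> L \<Longrightarrow> contract y (ce_d f) = theta y f - ce_d (contract y f)"
  by (rule ext) (simp add: contract_def[of y "ce_d f"])

lemma contract_wedge:
  "y \<in> L \<Longrightarrow> contract y (wedge \<xi> g) = cscale (\<xi> y) g - wedge \<xi> (contract y g)"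
  by (rule ext) (simp add: contract_def[of y "wedge \<xi> g"] cscale_def)

text \<open>
  The action is linear only on \<open>M\<close>, so \<open>theta\<close> and \<open>ce_d\<close> are linear only on functions with values in \<open>M\<close>.
\<close>

definition values_in_M :: "('l list \<Rightarrow> 'm) \<Rightarrow> bool" where
  "values_in_M f \<longleftrightarrow> range f \<subseteq> M"

lemma values_in_M_cochain [simp]: "f \<in> cochains n \<Longrightarrow> values_in_M f"
  unfolding values_in_M_def using cochainsD(1,2) M_closed(1) by (metis image_subsetI)

lemma values_in_M_contract [simp]: "values_in_M f \<Longrightarrow> values_in_M (contract y f)"
  by (auto simp: values_in_M_def contract_def)

lemma values_in_M_D: "values_in_M f \<Longrightarrow> f xs \<in> M"
  by (auto simp: values_in_M_def)

lemma theta_zero [simp]: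
  assumes "x \<in> L"
  shows "theta x 0 = 0"
proof -
  have "theta x f ys = 0" if "f = 0" for f ys
    using that assms by (induction ys arbitrary: f) auto
  then show ?thesis by (simp add: fun_eq_iff)
qed

lemma theta_add:
  assumes "x \<in> L" "values_in_M f" "values_in_M g"
  shows "theta x (f + g) = theta x f + theta x g"
proof
  fix ys show "theta x (f + g) ys = (theta x f + theta x g) ys"
    using assms by (induction ys arbitrary: f g) (simp_all add: act_add_right values_in_M_D)
qed

lemma theta_scale:
  assumes "x \<in> L" "values_in_M f"
  shows "theta x (cscale c f) = cscale c (theta x f)"
proof
  fix ys show "theta x (cscale c f) ys = cscale c (theta x f) ys"
    using assms
    by (induction ys arbitrary: f)
      (simp_all add: act_scale_right values_in_M_D M.scale_right_diff_distrib)
qed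

lemma ce_d_zero [simp]: "ce_d 0 = 0"
proof -
  have "ce_d f ys = 0" if "f = 0" for f ys
    using that by (induction ys arbitrary: f) auto
  then show ?thesis by (simp add: fun_eq_iff)
qed

lemma ce_d_add:
  assumes "values_in_M f" "values_in_M g"
  shows "ce_d (f + g) = ce_d f + ce_d g"
proof
  fix ys show "ce_d (f + g) ys = (ce_d f + ce_d g) ys"
    using assms by (induction ys arbitrary: f g) (simp_all add: theta_add)
qed

lemma ce_d_scale:
  assumes "values_in_M f"
  shows "ce_d (cscale c f) = cscale c (ce_d f)"
proof
  fix ys show "ce_d (cscale c f) ys = cscale c (ce_d f) ys"
    using assms
    by (induction ys arbitrary: f) (simp_all add: theta_scale M.scale_right_diff_distrib)
qed

lemma wedge_zero [simp]: "wedge \<xi> 0 = 0"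
proof -
  have "wedge \<xi> f ys = 0" if "f = 0" for f ys
    using that by (induction ys arbitrary: f) auto
  then show ?thesis by (simp add: fun_eq_iff)
qed

lemma wedge_add: "wedge \<xi> (f + g) = wedge \<xi> f + wedge \<xi> g"
proof
  fix ys show "wedge \<xi> (f + g) ys = (wedge \<xi> f + wedge \<xi> g) ys"
    by (induction ys arbitrary: f g) (simp_all add: M.scale_right_distrib)
qed

lemma wedge_scale: "wedge \<xi> (cscale c f) = cscale c (wedge \<xi> f)"
proof
  fix ys show "wedge \<xi> (cscale c f) ys = cscale c (wedge \<xi> f) ys"
    by (induction ys arbitrary: f) (simp_all add: M.scale_right_diff_distrib mult.commute)
qed

lemma values_in_M_neg: "values_in_M f \<Longrightarrow> values_in_M (- f)"
  using M.subspace_neg[OF subspace_M] by (auto simp: values_in_M_def)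

lemma theta_neg: "x \<in> L \<Longrightarrow> values_in_M f \<Longrightarrow> theta x (- f) = - theta x f"
  using theta_scale[of x f "-1"] by simp

lemma theta_diff:
  assumes "x \<in> L" "values_in_M f" "values_in_M g"
  shows "theta x (f - g) = theta x f - theta x g"
  using assms by (simp add: theta_add theta_neg values_in_M_neg flip: add_uminus_conv_diff)

lemma ce_d_neg: "values_in_M f \<Longrightarrow> ce_d (- f) = - ce_d f"
  using ce_d_scale[of f "-1"] by simp

lemma ce_d_diff:
  assumes "values_in_M f" "values_in_M g"
  shows "ce_d (f - g) = ce_d f - ce_d g"
  using assms by (simp add: ce_d_add ce_d_neg values_in_M_neg flip: add_uminus_conv_diff)

lemma wedge_neg: "wedge \<xi> (- f) = - wedge \<xi> f"
  using wedge_scale[of \<xi> "-1" f] by simp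

lemma wedge_diff: "wedge \<xi> (f - g) = wedge \<xi> f - wedge \<xi> g"
  by (simp add: wedge_add wedge_neg flip: add_uminus_conv_diff)

text \<open>
  From here on sums and multiples of cochains stay folded, so that the operator identities rewrite them.
\<close>

lemmas pointwise = plus_fun_apply minus_apply uminus_apply zero_fun_apply cscale_apply

declare pointwise [simp del]

declare bracket_self [simp]

lemma theta_closed [simp]:
  assumes x: "x \<in> L" and f: "f \<in> cochains n"
  shows "theta x f \<in> cochains n"
  using f
proof (induction n arbitrary: f)
  case 0
  have "theta x f xs = 0" if xs: "xs \<noteq> []" for xs
  proof (cases xs)
    case (Cons y ys)
    then show ?thesis using 0 x by (simp add: cochains_0_iff zero_fun_apply)
  qed (use xs in simp)
  then show ?case using 0 x by (simp add: cochains_0_iff)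
next
  case (Suc n)
  note f = Suc.prems
  show ?case
  proof (rule cochains_Suc_I)
    show "theta x f [] = 0" using x cochains_Suc_D(1)[OF f] by simp
  next
    fix y z assume y: "y \<in> L" and z: "z \<in> L"
    show "contract (y + z) (theta x f) = contract y (theta x f) + contract z (theta x f)"
      using f x y z
      by (simp add: contract_theta contract_add_vec[OF f] theta_add bracket_add_right
          values_in_M_cochain[OF contract_cochain[OF f]])
  next
    fix y c assume y: "y \<in> L"
    show "contract (c *\<^sub>L y) (theta x f) = cscale c (contract y (theta x f))"
      using f x y
      by (simp add: contract_theta contract_scale_vec[OF f] theta_scale bracket_scale_right
          values_in_M_cochain[OF contract_cochain[OF f]] fn.scale_right_diff_distrib)
  next
    fix y assume y: "y \<in> L"
    have "contract y f \<in> cochains n" using f y by simp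
    then show "contract y (contract y (theta x f)) = 0"
      using f x y contract_swap[OF f y, of "bracket x y"] by (simp add: contract_theta)
  qed (use f x Suc.IH in \<open>simp_all add: contract_theta\<close>)
qed

lemma theta_add_vec:
  assumes "f \<in> cochains n" "x \<in> L" "y \<in> L"
  shows "theta (x + y) f = theta x f + theta y f"
  using assms(1)
proof (induction n arbitrary: f)
  case 0
  show ?case
  proof (rule cochains_0_eqI[where g = "theta x f + theta y f"])
  qed (use 0 assms in \<open>simp_all add: act_add_left pointwise values_in_M_D[OF values_in_M_cochain[OF 0]]\<close>)
next
  case (Suc n)
  show ?case
  proof (rule cochains_eqI[where n = n])
    fix z assume "z \<in> L"
    then show "contract z (theta (x + y) f) = contract z (theta x f + theta y f)"
      using Suc assms by (simp add: contract_theta Suc.IH bracket_add_left contract_add_vec[OF Suc.prems])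
  qed (use Suc assms in simp_all)
qed

lemma theta_scale_vec:
  assumes "f \<in> cochains n" "x \<in> L"
  shows "theta (c *\<^sub>L x) f = cscale c (theta x f)"
  using assms(1)
proof (induction n arbitrary: f)
  case 0
  show ?case
  proof (rule cochains_0_eqI[where g = "cscale c (theta x f)"])
  qed (use 0 assms in \<open>simp_all add: act_scale_left pointwise values_in_M_D[OF values_in_M_cochain[OF 0]]\<close>)
next
  case (Suc n)
  show ?case
  proof (rule cochains_eqI[where n = n])
    fix z assume "z \<in> L"
    then show "contract z (theta (c *\<^sub>L x) f) = contract z (cscale c (theta x f))"
      using Suc assms
      by (simp add: contract_theta Suc.IH bracket_scale_left contract_scale_vec[OF Suc.prems]
          fn.scale_right_diff_distrib)
  qed (use Suc assms in simp_all)
qed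

lemma ce_d_closed [simp]:
  assumes "f \<in> cochains n"
  shows "ce_d f \<in> cochains (Suc n)"
  using assms
proof (induction n arbitrary: f)
  case (Suc n)
  note f = Suc.prems
  show ?case
  proof (rule cochains_Suc_I)
    fix y z assume y: "y \<in> L" and z: "z \<in> L"
    show "contract (y + z) (ce_d f) = contract y (ce_d f) + contract z (ce_d f)"
      using f y z by (simp add: contract_ce_d contract_add_vec[OF f] theta_add_vec[OF f] ce_d_add
          values_in_M_cochain[OF contract_cochain[OF f]])
  next
    fix y c assume y: "y \<in> L"
    show "contract (c *\<^sub>L y) (ce_d f) = cscale c (contract y (ce_d f))"
      using f y by (simp add: contract_ce_d contract_scale_vec[OF f] theta_scale_vec[OF f] ce_d_scale
          values_in_M_cochain[OF contract_cochain[OF f]] fn.scale_right_diff_distrib)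
  next
    fix y assume y: "y \<in> L"
    then show "contract y (contract y (ce_d f)) = 0"
      using f by (simp add: contract_ce_d contract_theta)
  qed (use f Suc.IH in \<open>simp_all add: contract_ce_d\<close>)
next
  case 0
  note f = 0
  show ?case
    by (rule cochains_Suc_I; (use f in
      \<open>simp add: contract_ce_d theta_add_vec[OF f] theta_scale_vec[OF f] contract_theta\<close>))
qed

text \<open>
  Both sides have the same commutation rule with contractions, by the Jacobi identity; the degree \<open>0\<close> case
  is the module axiom.
\<close>

lemma theta_commutator:
  assumes f: "f \<in> cochains n" and x: "x \<in> L" and y: "y \<in> L"
  shows "theta x (theta y f) = theta y (theta x f) + theta (bracket x y) f"
  using f
proof (induction n arbitrary: f)
  case 0
  show ?case
  proof (rule cochains_0_eqI[where g = "theta y (theta x f) + theta (bracket x y) f"])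
  qed (use 0 x y in \<open>simp_all add: act_bracket pointwise values_in_M_D[OF values_in_M_cochain[OF 0]]\<close>)
next
  case (Suc n)
  note f = Suc.prems
  have J: "contract (bracket (bracket x y) z) f
      = contract (bracket x (bracket y z)) f - contract (bracket y (bracket x z)) f"
    if z: "z \<in> L" for z
  proof -
    have "bracket y (bracket x z) = - bracket y (bracket z x)"
      using bracket_scale_right[of y "bracket z x" "-1"] bracket_anticomm[OF x z] y z x by simp
    moreover have "bracket (bracket x y) z = - bracket z (bracket x y)"
      using x y z by (intro bracket_anticomm) auto
    moreover have "bracket x (bracket y z) = - (bracket y (bracket z x) + bracket z (bracket x y))"
      using jacobi[OF x y z] by (simp only: add.assoc eq_neg_iff_add_eq_0)
    ultimately have "bracket x (bracket y z) = bracket (bracket x y) z + bracket y (bracket x z)"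
      by simp
    then show ?thesis
      using contract_add_vec[OF f, of "bracket (bracket x y) z" "bracket y (bracket x z)"] x y z
      by simp
  qed
  show ?case
  proof (rule cochains_eqI[where n = n])
    fix z assume z: "z \<in> L"
    note g = contract_cochain[OF f]
    show "contract z (theta x (theta y f)) = contract z (theta y (theta x f) + theta (bracket x y) f)"
      using f x y z J[OF z]
      by (simp add: contract_theta theta_diff values_in_M_cochain[OF g]
          values_in_M_cochain[OF theta_closed[OF _ g]] Suc.IH[OF g[OF z]])
  qed (use f x y in simp_all)
qed

text \<open>
  Contraction with \<open>z\<close> reduces the claim to the commutator of \<open>theta x\<close> and \<open>theta z\<close> and to the claim in
  the degree below.
\<close>

lemma theta_ce_d:
  assumes f: "f \<in> cochains n" and x: "x \<in> L"
  shows "theta x (ce_d f) = ce_d (theta x f)"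
  using f
proof (induction n arbitrary: f)
  case 0
  show ?case
  proof (rule cochains_eqI[where n = 0])
    fix z assume z: "z \<in> L"
    show "contract z (theta x (ce_d f)) = contract z (ce_d (theta x f))"
      using 0 x z theta_commutator[OF 0 x z] by (simp add: contract_theta contract_ce_d)
  qed (use 0 x in simp_all)
next
  case (Suc n)
  note f = Suc.prems
  note g = contract_cochain[OF f]
  show ?case
  proof (rule cochains_eqI[where n = "Suc n"])
    fix z assume z: "z \<in> L"
    show "contract z (theta x (ce_d f)) = contract z (ce_d (theta x f))"
      using f x z theta_commutator[OF f x z]
      by (simp add: contract_theta contract_ce_d theta_diff ce_d_diff values_in_M_cochain[OF g]
          values_in_M_cochain[OF theta_closed[OF _ g]] values_in_M_cochain[OF ce_d_closed[OF g]]
          values_in_M_cochain[OF theta_closed[OF _ f]]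
          Suc.IH[OF g[OF z]])
  qed (use f x in simp_all)
qed

definition functional :: "('l \<Rightarrow> complex) \<Rightarrow> bool" where
  "functional \<xi> \<longleftrightarrow> (\<forall>a\<in>L. \<forall>b\<in>L. \<xi> (a + b) = \<xi> a + \<xi> b) \<and> (\<forall>c. \<forall>a\<in>L. \<xi> (c *\<^sub>L a) = c * \<xi> a)"

lemma functionalD:
  assumes "functional \<xi>"
  shows "a \<in> L \<Longrightarrow> b \<in> L \<Longrightarrow> \<xi> (a + b) = \<xi> a + \<xi> b" "a \<in> L \<Longrightarrow> \<xi> (c *\<^sub>L a) = c * \<xi> a"
  using assms by (auto simp: functional_def)

lemma wedge_closed [simp]:
  assumes \<xi>: "functional \<xi>" and "f \<in> cochains n"
  shows "wedge \<xi> f \<in> cochains (Suc n)"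
  using assms(2)
proof (induction n arbitrary: f)
  case (Suc n)
  note f = Suc.prems
  show ?case
    by (rule cochains_Suc_I; use f Suc.IH in
        \<open>simp add: contract_wedge functionalD[OF \<xi>] contract_add_vec[OF f] contract_scale_vec[OF f]
           wedge_add wedge_scale fn.scale_left_distrib fn.scale_right_diff_distrib\<close>)
next
  case 0
  note f = 0
  show ?case
    by (rule cochains_Suc_I; (use f in
      \<open>simp add: contract_wedge functionalD[OF \<xi>] fn.scale_left_distrib\<close>))
qed

lemma theta_wedge:
  assumes \<xi>: "functional \<xi>" and x: "x \<in> L" and eig: "\<And>y. y \<in> L \<Longrightarrow> \<xi> (bracket x y) = \<mu> * \<xi> y"
    and g: "g \<in> cochains n"
  shows "theta x (wedge \<xi> g) = wedge \<xi> (theta x g) - cscale \<mu> (wedge \<xi> g)"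
  using g
proof (induction n arbitrary: g)
  case 0
  show ?case
    by (rule cochains_eqI[where n = 0 and g = "wedge \<xi> (theta x g) - cscale \<mu> (wedge \<xi> g)"]; use 0 x \<xi> in
        \<open>simp add: contract_wedge contract_theta eig theta_scale\<close>)
next
  case (Suc n)
  note f = Suc.prems
  note g = contract_cochain[OF f]
  show ?case
  proof (rule cochains_eqI[where n = "Suc n"])
    fix z assume z: "z \<in> L"
    show "contract z (theta x (wedge \<xi> g)) = contract z (wedge \<xi> (theta x g) - cscale \<mu> (wedge \<xi> g))"
      using f x z \<xi>
      by (simp add: contract_wedge contract_theta eig theta_scale theta_diff wedge_diff
          values_in_M_cochain[OF g] values_in_M_cochain[OF cochains_closed(5)[OF f]]
          values_in_M_cochain[OF wedge_closed[OF \<xi> g]] fn.scale_right_diff_distrib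
          Suc.IH[OF g[OF z]])
  qed (use f x \<xi> in simp_all)
qed

text \<open>
  The general rule is \<open>d (\<xi> \<and> g) = d\<xi> \<and> g - \<xi> \<and> dg\<close>, and \<open>d\<xi> = 0\<close> because \<open>\<xi>\<close> vanishes on brackets.
\<close>

lemma ce_d_wedge:
  assumes \<xi>: "functional \<xi>" and closed: "\<And>a b. a \<in> L \<Longrightarrow> b \<in> L \<Longrightarrow> \<xi> (bracket a b) = 0"
    and g: "g \<in> cochains n"
  shows "ce_d (wedge \<xi> g) = - wedge \<xi> (ce_d g)"
  using g
proof (induction n arbitrary: g)
  case 0
  show ?case
    by (rule cochains_eqI[where n = "Suc 0" and g = "- wedge \<xi> (ce_d g)"]; use 0 \<xi> in
        \<open>simp add: contract_wedge contract_ce_d closed ce_d_scale theta_wedge[OF \<xi>, where \<mu> = 0]\<close>)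
next
  case (Suc n)
  note f = Suc.prems
  note g = contract_cochain[OF f]
  show ?case
  proof (rule cochains_eqI[where n = "Suc (Suc n)"])
    fix z assume z: "z \<in> L"
    show "contract z (ce_d (wedge \<xi> g)) = contract z (- wedge \<xi> (ce_d g))"
      using f z \<xi>
      by (simp add: contract_wedge contract_ce_d closed ce_d_scale ce_d_diff wedge_diff
          theta_wedge[OF \<xi> _ _ f, where \<mu> = 0]
          values_in_M_cochain[OF cochains_closed(5)[OF f]]
          values_in_M_cochain[OF wedge_closed[OF \<xi> g]] Suc.IH[OF g[OF z]])
  qed (use f \<xi> in simp_all)
qed

section \<open>The Chevalley--Eilenberg differential\<close>

text \<open>
  Moving an argument from position \<open>j\<close> to the front takes \<open>j\<close> transpositions.
\<close>

lemma contract_move: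
  assumes "g \<in> cochains n" "ys \<in> tuples n" "j < n" "z \<in> L"
  shows "g (z # nths ys (- {j})) = (- 1) ^ j *\<^sub>M g (ys[j := z])"
  using assms
proof (induction j arbitrary: g ys n)
  case 0
  then obtain y zs where "ys = y # zs" by (cases ys) (auto simp: tuples_def)
  then show ?case by simp
next
  case (Suc j)
  then obtain m where n: "n = Suc m" by (cases n) auto
  with Suc.prems obtain y zs where ys: "ys = y # zs" "y \<in> L" "zs \<in> tuples m"
    by (auto simp: tuples_Suc_iff)
  have "g (z # nths ys (- {Suc j})) = contract y (contract z g) (nths zs (- {j}))"
    by (simp add: ys contract_def)
  also have "\<dots> = - contract y g (z # nths zs (- {j}))"
    using contract_swap[OF Suc.prems(1) ys(2) \<open>z \<in> L\<close>]
    by (simp add: contract_def[of z] pointwise)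
  also have "contract y g (z # nths zs (- {j})) = (- 1) ^ j *\<^sub>M contract y g (zs[j := z])"
    using Suc.prems ys n by (intro Suc.IH) auto
  finally show ?case by (simp add: ys contract_def)
qed

lemma theta_expand:
  assumes "f \<in> cochains n" "ys \<in> tuples n" "x \<in> L"
  shows "theta x f ys = act x (f ys) - (\<Sum>j<n. f (ys[j := bracket x (ys ! j)]))"
  using assms
proof (induction n arbitrary: f ys)
  case 0
  then show ?case by (simp add: tuples_def)
next
  case (Suc n)
  then obtain y zs where ys: "ys = y # zs" "y \<in> L" "zs \<in> tuples n"
    by (auto simp: tuples_Suc_iff)
  have "theta x (contract y f) zs
      = act x (contract y f zs) - (\<Sum>j<n. contract y f (zs[j := bracket x (zs ! j)]))"
    using Suc.prems ys by (intro Suc.IH) auto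
  then show ?case
    by (simp add: ys sum.lessThan_Suc_shift contract_def del: sum.lessThan_Suc)
qed

text \<open>
  Sorting the terms of the explicit formula by whether they involve the first argument \<open>y\<close> gives
  \<open>i\<^sub>y \<circ> d = theta y - d \<circ> i\<^sub>y\<close>: the terms with \<open>y\<close> are those of \<open>theta y f\<close>, after moving each bracket
  \<open>[y, y\<^sub>j]\<close> back to position \<open>j\<close>, and the others are those of \<open>- d (i\<^sub>y f)\<close>.
\<close>

lemma differential_eq_ce_d:
  assumes "f \<in> cochains n"
  shows "differential n f = ce_d f"
proof
  fix xs
  have "differential n f (y # ys) = ce_d f (y # ys)" if "y \<in> L" "ys \<in> tuples n" for y ys
    using assms that
  proof (induction n arbitrary: f y ys)
    case 0
    then show ?case by (simp add: differential_def tuples_def pointwise)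
  next
    case (Suc n)
    then obtain z zs where ys: "ys = z # zs" "z \<in> L" "zs \<in> tuples n"
      by (auto simp: tuples_Suc_iff)
    let ?g = "contract y f"
    note neg = M.scale_minus_left
    have IH: "ce_d ?g ys = differential n ?g ys"
      using Suc.IH[of ?g z zs] Suc.prems ys by simp
    have tup: "y # ys \<in> tuples (Suc (Suc n))" "ys \<in> tuples (Suc n)"
      using Suc.prems by (auto simp: tuples_Suc_iff)
    have ysL: "ys ! l \<in> L" if "l < Suc n" for l
      using tup(2) that by (auto simp: tuples_def)
    have A: "(\<Sum>i\<le>Suc n. (- 1) ^ i *\<^sub>M act ((y # ys) ! i) (f (nths (y # ys) (- {i}))))
        = act y (f ys) - (\<Sum>i\<le>n. (- 1) ^ i *\<^sub>M act (ys ! i) (?g (nths ys (- {i}))))"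
      by (simp add: sum.atMost_Suc_shift contract_def sum_negf del: sum.atMost_Suc)
    have B: "(\<Sum>j\<le>Suc n. \<Sum>i<j. (- 1) ^ (i + j) *\<^sub>M
          f (bracket ((y # ys) ! i) ((y # ys) ! j) # nths (y # ys) (- {i, j})))
        = (\<Sum>l\<le>n. (- 1) ^ Suc l *\<^sub>M f (bracket y (ys ! l) # nths ys (- {l}))
            + (\<Sum>k<l. (- 1) ^ (k + l) *\<^sub>M f (bracket (ys ! k) (ys ! l) # y # nths ys (- {k, l}))))"
      by (simp add: sum.atMost_Suc_shift sum.lessThan_Suc_shift sum_negf
          del: sum.atMost_Suc sum.lessThan_Suc)
    have B1: "(- 1) ^ Suc l *\<^sub>M f (bracket y (ys ! l) # nths ys (- {l}))
        = - f (ys[l := bracket y (ys ! l)])" if "l \<le> n" for l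
      using contract_move[OF Suc.prems(1) tup(2), of l "bracket y (ys ! l)"] that Suc.prems ysL
      by (simp flip: power_add)
    have B2: "(- 1) ^ (k + l) *\<^sub>M f (bracket (ys ! k) (ys ! l) # y # nths ys (- {k, l}))
        = - ((- 1) ^ (k + l) *\<^sub>M ?g (bracket (ys ! k) (ys ! l) # nths ys (- {k, l})))"
      if "k < l" "l \<le> n" for k l
    proof -
      have "bracket (ys ! k) (ys ! l) \<in> L" using that ysL by simp
      from fun_cong[OF contract_swap[OF Suc.prems(1,2) this], of "nths ys (- {k, l})"]
      show ?thesis by (simp add: contract_def pointwise)
    qed
    have "differential (Suc n) f (y # ys)
        = act y (f ys) - (\<Sum>i\<le>n. (- 1) ^ i *\<^sub>M act (ys ! i) (?g (nths ys (- {i}))))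
          + (\<Sum>l\<le>n. - f (ys[l := bracket y (ys ! l)])
            + (\<Sum>k<l. - ((- 1) ^ (k + l) *\<^sub>M ?g (bracket (ys ! k) (ys ! l) # nths ys (- {k, l})))))"
      unfolding differential_def A B using tup(1) B1 B2 by (simp cong: sum.cong_simp)
    also have "\<dots> = (act y (f ys) - (\<Sum>j<Suc n. f (ys[j := bracket y (ys ! j)])))
        - differential n ?g ys"
      using tup(2) by (simp add: differential_def sum_subtractf sum_negf lessThan_Suc_atMost)
    also have "\<dots> = ce_d f (y # ys)"
      using Suc.prems by (simp add: IH theta_expand[OF Suc.prems(1) tup(2)])
    finally show ?case .
  qed
  moreover have "xs \<notin> tuples (Suc n) \<Longrightarrow> ce_d f xs = 0"
    using cochainsD(2)[OF ce_d_closed[OF assms]] .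
  ultimately show "differential n f xs = ce_d f xs"
    by (cases "xs \<in> tuples (Suc n)") (auto simp: tuples_Suc_iff differential_def)
qed

text \<open>
  For the span \<open>A\<close> of \<open>X\<close>, these are the cochains of the complex relative to \<open>A\<close>.
\<close>

definition basic :: "'l set \<Rightarrow> nat \<Rightarrow> ('l list \<Rightarrow> 'm) set" where
  "basic X n = {f \<in> cochains n. \<forall>x\<in>X. theta x f = 0 \<and> contract x f = 0}"

definition exact_at :: "'l set \<Rightarrow> nat \<Rightarrow> bool" where
  "exact_at X n \<longleftrightarrow> (\<forall>f\<in>basic X n. ce_d f = 0 \<longrightarrow>
     (case n of 0 \<Rightarrow> f = 0 | Suc m \<Rightarrow> \<exists>g\<in>basic X m. f = ce_d g))"

text \<open>
  The zero class is the set of coboundaries, so the cosets of all cocycles agree with it exactly when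
  every cocycle is a coboundary.
\<close>

lemma cohomology_vanishes_iff_exact_at: "cohomology_vanishes n \<longleftrightarrow> exact_at {} n"
proof -
  have cob: "coboundaries n = (case n of 0 \<Rightarrow> {0} | Suc m \<Rightarrow> ce_d ` cochains m)"
    by (cases n) (auto simp: differential_eq_ce_d)
  have coc: "cocycles n = {f \<in> cochains n. ce_d f = 0}"
    by (auto simp: cocycles_def differential_eq_ce_d)
  have ex: "exact_at {} n \<longleftrightarrow> cocycles n \<subseteq> coboundaries n"
    unfolding exact_at_def basic_def cob coc by (cases n) auto
  have zero: "0 \<in> coboundaries n"
    unfolding cob by (cases n) (auto intro!: image_eqI[where x = 0])
  have add: "u + v \<in> coboundaries n" if u: "u \<in> coboundaries n" and v: "v \<in> coboundaries n" for u v
  proof (cases n)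
    case (Suc m)
    with u v obtain g h where "g \<in> cochains m" "h \<in> cochains m" "u = ce_d g" "v = ce_d h"
      unfolding cob by auto
    then show ?thesis
      unfolding cob Suc by (auto intro!: image_eqI[where x = "g + h"] simp: ce_d_add differential_eq_ce_d)
  qed (use u v cob in simp)
  have neg: "- u \<in> coboundaries n" if u: "u \<in> coboundaries n" for u
  proof (cases n)
    case (Suc m)
    with u obtain g where "g \<in> cochains m" "u = ce_d g"
      unfolding cob by auto
    then show ?thesis
      unfolding cob Suc by (auto intro!: image_eqI[where x = "- g"] simp: ce_d_neg differential_eq_ce_d)
  qed (use u cob in simp)
  have coset: "(+) f ` coboundaries n = coboundaries n" if "f \<in> coboundaries n" for f
  proof
    show "(+) f ` coboundaries n \<subseteq> coboundaries n" using add that by auto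
    show "coboundaries n \<subseteq> (+) f ` coboundaries n"
    proof
      fix u assume "u \<in> coboundaries n"
      then have "- f + u \<in> coboundaries n" using add neg that by blast
      then show "u \<in> (+) f ` coboundaries n" by (rule image_eqI[rotated]) simp
    qed
  qed
  have "0 \<in> cocycles n" by (simp add: coc)
  then have "cohomology n \<noteq> {}" by (auto simp: cohomology_def)
  then have "cohomology_vanishes n \<longleftrightarrow> (\<forall>A\<in>cohomology n. A = coboundaries n)"
    unfolding cohomology_vanishes_def by (auto intro!: equalityI)
  also have "\<dots> \<longleftrightarrow> (\<forall>f\<in>cocycles n. (+) f ` coboundaries n = coboundaries n)"
    by (simp only: cohomology_def ball_simps)
  also have "\<dots> \<longleftrightarrow> cocycles n \<subseteq> coboundaries n"
  proof
    assume *: "\<forall>f\<in>cocycles n. (+) f ` coboundaries n = coboundaries n"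
    show "cocycles n \<subseteq> coboundaries n"
    proof
      fix f assume "f \<in> cocycles n"
      then have "(+) f ` coboundaries n = coboundaries n" using * by blast
      moreover have "f + 0 \<in> (+) f ` coboundaries n" using zero by (rule imageI)
      ultimately show "f \<in> coboundaries n" by simp
    qed
  qed (use coset in blast)
  finally show ?thesis using ex by simp
qed

section \<open>Semisimple elements acting on cochains\<close>

definition semisimple :: "'l \<Rightarrow> bool" where
  "semisimple x \<longleftrightarrow> x \<in> L \<and>
     (\<exists>\<Lambda>. finite \<Lambda> \<and> L \<subseteq> span {y \<in> L. \<exists>\<mu>\<in>\<Lambda>. bracket x y = \<mu> *\<^sub>L y}) \<and>
     (\<exists>\<Lambda>. finite \<Lambda> \<and> M \<subseteq> M.span {m \<in> M. \<exists>\<mu>\<in>\<Lambda>. act x m = \<mu> *\<^sub>M m})"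

lemma cochain_eq_0_on_span:
  assumes f: "f \<in> cochains n" and S: "S \<subseteq> L" "L \<subseteq> span S"
    and z: "\<And>y. y \<in> S \<Longrightarrow> contract y f = 0" and y: "y \<in> L"
  shows "contract y f = 0"
proof -
  have "y \<in> span S" using S y by blast
  then have "y \<in> L \<and> contract y f = 0"
  proof (induction rule: span_induct_alt)
    case base
    then show ?case using f by simp
  next
    case (step c x y)
    then have "x \<in> L" using S by blast
    then show ?case
      using step z f contract_add_vec[OF f, of "c *\<^sub>L x" y] contract_scale_vec[OF f, of x c] by simp
  qed
  then show ?thesis by simp
qed

lemma endomorphism_on_theta: "x \<in> L \<Longrightarrow> endomorphism_on cscale (cochains n) (theta x)"
  by unfold_locales (simp_all add: fn_subspace_cochains theta_add theta_scale)

lemma endomorphism_on_act: "x \<in> L \<Longrightarrow> endomorphism_on scaleM M (act x)"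
  by unfold_locales (simp_all add: subspace_M act_add_right act_scale_right)

text \<open>
  Contraction with an eigenvector of eigenvalue \<open>\<mu>\<close> shifts the eigenvalues of \<open>theta x\<close> by \<open>\<mu>\<close>.
\<close>

lemma contract_factors_theta:
  assumes "x \<in> L" "y \<in> L" "bracket x y = \<mu> *\<^sub>L y" "f \<in> cochains (Suc n)"
  shows "contract y (factors cscale (theta x) ms f) = factors cscale (theta x) (map ((+) \<mu>) ms) (contract y f)"
  using assms(4)
proof (induction ms arbitrary: f)
  case (Cons m ms)
  have "theta x f - cscale m f \<in> cochains (Suc n)" using Cons.prems assms by simp
  moreover have "contract y (theta x f - cscale m f)
      = theta x (contract y f) - cscale (\<mu> + m) (contract y f)"
    using assms Cons.prems
    by (simp add: contract_theta contract_scale_vec[OF Cons.prems] fn.scale_left_distrib)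
  ultimately show ?case using Cons.IH by simp
qed simp

text \<open>
  Each eigenvalue of \<open>theta x\<close> on cochains is an eigenvalue on the module minus a sum of eigenvalues on
  the algebra.
\<close>

lemma theta_annihilated:
  assumes "semisimple x"
  shows "\<exists>ms. distinct ms \<and> (\<forall>f\<in>cochains n. factors cscale (theta x) ms f = 0)"
proof (induction n)
  case 0
  obtain \<Lambda> where fin: "finite \<Lambda>" and \<Lambda>: "M \<subseteq> M.span {m \<in> M. \<exists>\<mu>\<in>\<Lambda>. act x m = \<mu> *\<^sub>M m}"
    and x: "x \<in> L"
    using assms by (auto simp: semisimple_def)
  obtain ms where ms: "set ms = \<Lambda>" "distinct ms" using finite_distinct_list[OF fin] by blast
  have ev: "factors cscale (theta x) ns f [] = factors scaleM (act x) ns (f [])" if "f \<in> cochains 0" for f ns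
    using that
  proof (induction ns arbitrary: f)
    case (Cons n ns)
    have "theta x f - cscale n f \<in> cochains 0" using Cons.prems x by simp
    moreover have "(theta x f - cscale n f) [] = act x (f []) - n *\<^sub>M f []"
      by (simp add: pointwise)
    ultimately show ?case using Cons.IH[of "theta x f - cscale n f"] by (simp only: factors.simps)
  qed simp
  have "factors cscale (theta x) ms f = 0" if f: "f \<in> cochains 0" for f
  proof (rule cochains_0_eqI)
    show "factors cscale (theta x) ms f \<in> cochains 0"
      by (rule endomorphism_on.factors_closed[OF endomorphism_on_theta[OF x] f])
    have "f [] \<in> M.span {m \<in> M. \<exists>\<mu>\<in>set ms. act x m = \<mu> *\<^sub>M m}"
      using \<Lambda> f ms values_in_M_D[OF values_in_M_cochain[OF f]] by blast
    then show "factors cscale (theta x) ms f [] = 0 []"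
      using endomorphism_on.factors_span[OF endomorphism_on_act[OF x]] by (simp add: ev[OF f] pointwise)
  qed simp
  then show ?case using ms by blast
next
  case (Suc n)
  then obtain ms where ms: "distinct ms" "\<And>f. f \<in> cochains n \<Longrightarrow> factors cscale (theta x) ms f = 0"
    by blast
  obtain \<Lambda> where fin: "finite \<Lambda>" and \<Lambda>: "L \<subseteq> span {y \<in> L. \<exists>\<mu>\<in>\<Lambda>. bracket x y = \<mu> *\<^sub>L y}"
    and x: "x \<in> L"
    using assms by (auto simp: semisimple_def)
  let ?D = "(\<lambda>(m, \<mu>). m - \<mu>) ` (set ms \<times> \<Lambda>)"
  have "finite ?D" using fin by simp
  from finite_distinct_list[OF this] obtain ns where ns: "set ns = ?D" "distinct ns"
    by (elim exE conjE)
  have "factors cscale (theta x) ns f = 0" if f: "f \<in> cochains (Suc n)" for f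
  proof (rule cochains_eqI)
    let ?F = "factors cscale (theta x) ns f"
    show F: "?F \<in> cochains (Suc n)" by (rule endomorphism_on.factors_closed[OF endomorphism_on_theta[OF x] f])
    have "contract y ?F = 0" if "y \<in> {y \<in> L. \<exists>\<mu>\<in>\<Lambda>. bracket x y = \<mu> *\<^sub>L y}" for y
    proof -
      from that obtain \<mu> where y: "y \<in> L" "\<mu> \<in> \<Lambda>" "bracket x y = \<mu> *\<^sub>L y" by blast
      have "set ms \<subseteq> set (map ((+) \<mu>) ns)"
        using y(2) by (force simp: ns image_image)
      then have "factors cscale (theta x) (map ((+) \<mu>) ns) (contract y f) = 0"
        by (rule endomorphism_on.factors_superset[OF endomorphism_on_theta[OF x] contract_cochain[OF f y(1)]
              ms(2)[OF contract_cochain[OF f y(1)]] ms(1)])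
      then show ?thesis using contract_factors_theta[OF x y(1,3) f] by simp
    qed
    then show "contract y ?F = contract y 0" if "y \<in> L" for y
      using cochain_eq_0_on_span[OF F _ \<Lambda>] that by auto
  qed simp
  then show ?case using ns by blast
qed

text \<open>
  \<open>theta x\<close> is annihilated by a product of distinct factors, in which \<open>0\<close> is at most a simple root; so
  every stable subspace \<open>U\<close> splits into invariants and the image of \<open>theta x\<close>.
\<close>

lemma theta_split:
  assumes x: "semisimple x" and U: "fn.subspace U" "U \<subseteq> cochains n" "\<And>u. u \<in> U \<Longrightarrow> theta x u \<in> U"
    and f: "f \<in> U"
  shows "\<exists>k\<in>U. \<exists>w\<in>U. f = k + theta x w \<and> theta x k = 0"
proof -
  have xL: "x \<in> L" using x by (simp add: semisimple_def)
  interpret A: endomorphism_on cscale U "theta x"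
    using U(1,3) by unfold_locales
      (use xL U(2) in \<open>simp_all add: subset_iff theta_add[OF xL] theta_scale[OF xL] values_in_M_cochain[of _ n]\<close>)
  obtain ms where ms: "distinct ms" "\<And>f. f \<in> cochains n \<Longrightarrow> factors cscale (theta x) ms f = 0"
    using theta_annihilated[OF x] by blast
  have "factors cscale (theta x) (0 # removeAll 0 ms) f = 0"
    by (rule A.factors_superset[OF f ms(2)[OF subsetD[OF U(2) f]] ms(1)]) auto
  then show ?thesis by (intro A.kernel_image_split[OF f]) auto
qed

section \<open>Reduction to basic cochains\<close>

lemma basicD:
  assumes "f \<in> basic X n"
  shows "f \<in> cochains n" "x \<in> X \<Longrightarrow> theta x f = 0" "x \<in> X \<Longrightarrow> contract x f = 0"
  using assms by (auto simp: basic_def)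

lemma basic_closed:
  assumes "X \<subseteq> L"
  shows "0 \<in> basic X n"
    "f \<in> basic X n \<Longrightarrow> g \<in> basic X n \<Longrightarrow> f + g \<in> basic X n"
    "f \<in> basic X n \<Longrightarrow> g \<in> basic X n \<Longrightarrow> f - g \<in> basic X n"
    "f \<in> basic X n \<Longrightarrow> cscale c f \<in> basic X n"
proof -
  have "x \<in> L" if "x \<in> X" for x using that assms by blast
  then show "0 \<in> basic X n"
    "f \<in> basic X n \<Longrightarrow> g \<in> basic X n \<Longrightarrow> f + g \<in> basic X n"
    "f \<in> basic X n \<Longrightarrow> g \<in> basic X n \<Longrightarrow> f - g \<in> basic X n"
    "f \<in> basic X n \<Longrightarrow> cscale c f \<in> basic X n"
    by (simp_all add: basic_def theta_add theta_diff theta_scale values_in_M_cochain[of _ n])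
qed

lemma basic_ce_d:
  assumes "X \<subseteq> L" "f \<in> basic X n"
  shows "ce_d f \<in> basic X (Suc n)"
proof -
  note D = basicD[OF assms(2)]
  have "theta x (ce_d f) = 0" "contract x (ce_d f) = 0" if "x \<in> X" for x
  proof -
    have "x \<in> L" using that assms by blast
    then show "theta x (ce_d f) = 0" "contract x (ce_d f) = 0"
      using D that by (simp_all add: theta_ce_d[OF D(1)] contract_ce_d)
  qed
  then show ?thesis using D by (simp add: basic_def)
qed

lemma basic_theta:
  assumes "X \<subseteq> L" "f \<in> basic X n" "x \<in> L" "\<And>y. y \<in> X \<Longrightarrow> bracket x y = 0"
  shows "theta x f \<in> basic X n"
proof -
  note D = basicD[OF assms(2)]
  have "theta y (theta x f) = 0" "contract y (theta x f) = 0" if "y \<in> X" for y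
  proof -
    have y: "y \<in> L" using that assms by blast
    have "bracket y x = - bracket x y" using assms(3) y by (intro bracket_anticomm)
    moreover have "theta 0 f = 0"
      using theta_scale_vec[OF D(1) assms(3), of 0] by simp
    ultimately show "theta y (theta x f) = 0"
      using theta_commutator[OF D(1) y assms(3)] that assms D(2) by simp
    show "contract y (theta x f) = 0"
      using y that assms D by (simp add: contract_theta)
  qed
  then show ?thesis using D assms by (simp add: basic_def)
qed

lemma basic_contract:
  assumes "X \<subseteq> L" "f \<in> basic X (Suc n)" "x \<in> L" "\<And>y. y \<in> X \<Longrightarrow> bracket x y = 0"
  shows "contract x f \<in> basic X n"
proof -
  note D = basicD[OF assms(2)]
  have "theta y (contract x f) = 0" "contract y (contract x f) = 0" if "y \<in> X" for y
  proof -
    have y: "y \<in> L" using that assms by blast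
    have "bracket y x = - bracket x y" using assms(3) y by (intro bracket_anticomm)
    then show "theta y (contract x f) = 0"
      using contract_theta[OF assms(3), of y f] that assms D(1,2) by simp
    show "contract y (contract x f) = 0"
      using contract_swap[OF D(1) y assms(3)] D(3)[OF that] by simp
  qed
  then show ?thesis using D assms by (simp add: basic_def)
qed

lemma basic_wedge:
  assumes X: "X \<subseteq> L" and f: "f \<in> basic X n" and \<xi>: "functional \<xi>"
    and closed: "\<And>a b. a \<in> L \<Longrightarrow> b \<in> L \<Longrightarrow> \<xi> (bracket a b) = 0"
    and z: "\<And>y. y \<in> X \<Longrightarrow> \<xi> y = 0"
  shows "wedge \<xi> f \<in> basic X (Suc n)"
proof -
  note D = basicD[OF f]
  have "theta y (wedge \<xi> f) = 0" "contract y (wedge \<xi> f) = 0" if "y \<in> X" for y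
  proof -
    have y: "y \<in> L" using that X by blast
    show "theta y (wedge \<xi> f) = 0"
      using theta_wedge[OF \<xi> y _ D(1), of 0] D(2)[OF that] closed y by simp
    show "contract y (wedge \<xi> f) = 0"
      using y that D z by (simp add: contract_wedge)
  qed
  then show ?thesis using D \<xi> by (simp add: basic_def)
qed

text \<open>
  Subtracting \<open>wedge \<xi> (contract x g)\<close> kills the contraction with \<open>x\<close>; as \<open>\<xi>\<close> is closed, it turns an
  invariant primitive of a basic cochain into a basic one.
\<close>

lemma exact_at_insert:
  assumes X: "X \<subseteq> L" and x: "semisimple x" and comm: "\<And>y. y \<in> X \<Longrightarrow> bracket x y = 0"
    and \<xi>: "functional \<xi>" "\<And>a b. a \<in> L \<Longrightarrow> b \<in> L \<Longrightarrow> \<xi> (bracket a b) = 0"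
      "\<xi> x = 1" "\<And>y. y \<in> X \<Longrightarrow> \<xi> y = 0"
    and ex: "exact_at X n"
  shows "exact_at (insert x X) n"
  unfolding exact_at_def
proof (intro ballI impI)
  fix f assume f: "f \<in> basic (insert x X) n" and df: "ce_d f = 0"
  have xL: "x \<in> L" using x by (simp add: semisimple_def)
  have fX: "f \<in> basic X n" and fx: "theta x f = 0" "contract x f = 0" using f by (auto simp: basic_def)
  show "case n of 0 \<Rightarrow> f = 0 | Suc m \<Rightarrow> \<exists>g\<in>basic (insert x X) m. f = ce_d g"
  proof (cases n)
    case 0
    then show ?thesis using ex fX df by (auto simp: exact_at_def)
  next
    case (Suc m)
    then obtain g where g: "g \<in> basic X m" "f = ce_d g"
      using ex fX df by (auto simp: exact_at_def)
    \<comment> \<open>Primitives of multiples of \<open>f\<close>: \<open>theta x\<close> maps this space into its cocycles, as \<open>theta x f = 0\<close>.\<close>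
    let ?U = "{g \<in> basic X m. \<exists>c. ce_d g = cscale c f}"
    have vm: "values_in_M u" if "u \<in> basic X m" for u using basicD(1)[OF that] by simp
    have "fn.subspace ?U"
    proof (rule fn.subspaceI)
      show "0 \<in> ?U" using basic_closed(1)[OF X] by (auto intro!: exI[of _ 0])
      show "u + v \<in> ?U" if u: "u \<in> ?U" and v: "v \<in> ?U" for u v
      proof -
        from u v obtain c d where "ce_d u = cscale c f" "ce_d v = cscale d f" by auto
        then have "ce_d (u + v) = cscale (c + d) f"
          using u v vm by (simp add: ce_d_add fn.scale_left_distrib)
        then show ?thesis using u v basic_closed(2)[OF X] by blast
      qed
      show "cscale a u \<in> ?U" if u: "u \<in> ?U" for a u
      proof -
        from u obtain c where "ce_d u = cscale c f" by auto
        then have "ce_d (cscale a u) = cscale (a * c) f"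
          using u vm by (simp add: ce_d_scale)
        then show ?thesis using u basic_closed(4)[OF X] by blast
      qed
    qed
    moreover have "?U \<subseteq> cochains m" by (auto simp: basic_def)
    moreover have d\<theta>: "ce_d (theta x u) = 0" if u: "u \<in> ?U" for u
    proof -
      from u obtain c where c: "ce_d u = cscale c f" by blast
      have "ce_d (theta x u) = theta x (cscale c f)"
        using theta_ce_d[OF basicD(1) xL, of u X m] u c by simp
      then show ?thesis using theta_scale[OF xL, of f c] basicD(1)[OF fX] fx by simp
    qed
    moreover have "theta x u \<in> ?U" if u: "u \<in> ?U" for u
    proof -
      have "ce_d (theta x u) = cscale 0 f" using d\<theta>[OF u] by simp
      then show ?thesis using basic_theta[OF X _ xL comm] u by blast
    qed
    moreover have "g \<in> ?U" using g by (auto intro!: exI[of _ 1])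
    ultimately obtain k w where k: "k \<in> ?U" and w: "w \<in> ?U" and gkw: "g = k + theta x w"
      and kx: "theta x k = 0"
      using theta_split[OF x, of ?U m g] by blast
    have kX: "k \<in> basic X m" and kC: "k \<in> cochains m" using k by (auto simp: basic_def)
    have "theta x w \<in> cochains m" using w xL by (simp add: basic_def)
    then have fk: "f = ce_d k"
      using g gkw kC d\<theta>[OF w] by (simp add: ce_d_add)
    show ?thesis
    proof (cases m)
      case 0
      then have "k \<in> basic (insert x X) m" using kX kx kC by (simp add: basic_def)
      then show ?thesis using fk Suc by auto
    next
      case m: (Suc l)
      let ?c = "contract x k"
      have c: "?c \<in> basic X l" using basic_contract[OF X _ xL comm, of k l] kX m by blast
      have cC: "?c \<in> cochains l" using c by (rule basicD)
      have c\<theta>: "theta x ?c = 0"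
        using contract_theta[OF xL, of x k] kx kC xL by simp
      let ?h = "k - wedge \<xi> ?c"
      have wc: "wedge \<xi> ?c \<in> basic X m"
        unfolding m by (rule basic_wedge[OF X c \<xi>(1,2,4)])
      have wC: "wedge \<xi> ?c \<in> cochains m" using wc by (rule basicD)
      have h: "?h \<in> basic X m" using wc kX basic_closed(3)[OF X] by blast
      have "theta x (wedge \<xi> ?c) = 0"
        using theta_wedge[OF \<xi>(1) xL _ cC, of 0] \<xi>(2) xL c\<theta> by simp
      then have "theta x ?h = 0" using kx theta_diff[OF xL, of k "wedge \<xi> ?c"] kC wC by simp
      moreover have "contract x ?h = 0"
        using xL \<xi>(3) kC by (simp add: contract_wedge)
      ultimately have "?h \<in> basic (insert x X) m" using h by (auto simp: basic_def)
      moreover have "ce_d ?c = 0"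
        using contract_ce_d[OF xL, of k] kx fk fx by simp
      then have "ce_d (wedge \<xi> ?c) = 0"
        using ce_d_wedge[OF \<xi>(1,2) cC] by simp
      then have "f = ce_d ?h" using fk kC wC by (simp add: ce_d_diff)
      ultimately show ?thesis using Suc by auto
    qed
  qed
qed

text \<open>
  A cocycle may be made invariant under \<open>x\<close>, since \<open>theta x\<close> of a cocycle is the coboundary of its
  contraction. Then \<open>f - wedge \<xi> (contract x f)\<close> and \<open>contract x f\<close> are both basic cocycles.
\<close>

lemma exact_at_remove:
  assumes X: "X \<subseteq> L" and x: "semisimple x" and comm: "\<And>y. y \<in> X \<Longrightarrow> bracket x y = 0"
    and \<xi>: "functional \<xi>" "\<And>a b. a \<in> L \<Longrightarrow> b \<in> L \<Longrightarrow> \<xi> (bracket a b) = 0"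
      "\<xi> x = 1" "\<And>y. y \<in> X \<Longrightarrow> \<xi> y = 0"
    and ex: "\<And>n. exact_at (insert x X) n"
  shows "exact_at X n"
  unfolding exact_at_def
proof (intro ballI impI)
  fix f assume f: "f \<in> basic X n" and df: "ce_d f = 0"
  have xL: "x \<in> L" using x by (simp add: semisimple_def)
  let ?U = "{g \<in> basic X n. ce_d g = 0}"
  have vm: "values_in_M u" if "u \<in> basic X n" for u n using basicD(1)[OF that] by simp
  have "fn.subspace ?U"
    using basic_closed(1,2,4)[OF X] vm by (auto simp: fn.subspace_def ce_d_add ce_d_scale)
  moreover have "?U \<subseteq> cochains n" by (auto simp: basic_def)
  moreover have "theta x u \<in> ?U" if u: "u \<in> ?U" for u
    using u basic_theta[OF X _ xL comm] theta_ce_d[OF basicD(1) xL, of u X n] xL by simp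
  ultimately obtain k w where k: "k \<in> ?U" and w: "w \<in> ?U" and fkw: "f = k + theta x w"
    and kx: "theta x k = 0"
    using theta_split[OF x, of ?U n f] f df by blast
  have kC: "k \<in> cochains n" and kX: "k \<in> basic X n" and dk: "ce_d k = 0"
    using k by (auto simp: basic_def)
  have th: "theta x w = ce_d (contract x w)"
    using contract_ce_d[OF xL, of w] w by simp
  show "case n of 0 \<Rightarrow> f = 0 | Suc m \<Rightarrow> \<exists>g\<in>basic X m. f = ce_d g"
  proof (cases n)
    case 0
    then have "theta x w = 0" using th w basicD(1)[of w X 0] by simp
    moreover have "k \<in> basic (insert x X) 0" using kX kx kC 0 by (auto simp: basic_def)
    then have "k = 0" using ex[of 0] dk by (auto simp: exact_at_def)
    ultimately show ?thesis using fkw 0 by simp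
  next
    case (Suc m)
    have wc: "contract x w \<in> basic X m"
      using basic_contract[OF X _ xL comm, of w m] w Suc by blast
    let ?c = "contract x k"
    have c: "?c \<in> basic X m" using basic_contract[OF X _ xL comm, of k m] kX Suc by blast
    have cC: "?c \<in> cochains m" using c by (rule basicD)
    have c\<theta>: "theta x ?c = 0"
      using contract_theta[OF xL, of x k] kx kC xL by simp
    have dc: "ce_d ?c = 0"
      using contract_ce_d[OF xL, of k] kx dk by simp
    have cb: "?c \<in> basic (insert x X) m"
      using c c\<theta> kC xL by (auto simp: basic_def)
    have "\<exists>p\<in>basic X m. wedge \<xi> ?c = ce_d p"
    proof (cases m)
      case 0
      then have "?c = 0" using ex[of m] cb dc by (auto simp: exact_at_def)
      then show ?thesis using basic_closed(1)[OF X] by (auto intro!: bexI[of _ 0])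
    next
      case m: (Suc l)
      then obtain g where g: "g \<in> basic (insert x X) l" "?c = ce_d g"
        using ex[of m] cb dc by (auto simp: exact_at_def)
      then have gX: "g \<in> basic X l" by (auto simp: basic_def)
      have wg: "wedge \<xi> g \<in> basic X m"
        unfolding m by (rule basic_wedge[OF X gX \<xi>(1,2,4)])
      have "wedge \<xi> ?c = - ce_d (wedge \<xi> g)"
        using ce_d_wedge[OF \<xi>(1,2) basicD(1)[OF gX]] g by simp
      then have "wedge \<xi> ?c = ce_d (- wedge \<xi> g)"
        using vm[OF wg] by (simp add: ce_d_neg)
      moreover have "- wedge \<xi> g \<in> basic X m"
        using basic_closed(4)[OF X wg, of "- 1"] by simp
      ultimately show ?thesis by blast
    qed
    then obtain p where p: "p \<in> basic X m" "wedge \<xi> ?c = ce_d p" by blast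
    let ?h = "k - wedge \<xi> ?c"
    have wX: "wedge \<xi> ?c \<in> basic X n"
      unfolding Suc by (rule basic_wedge[OF X c \<xi>(1,2,4)])
    have wC: "wedge \<xi> ?c \<in> cochains n" using wX by (rule basicD)
    have h: "?h \<in> basic X n" using wX kX basic_closed(3)[OF X] by blast
    have "theta x (wedge \<xi> ?c) = 0"
      using theta_wedge[OF \<xi>(1) xL _ cC, of 0] \<xi>(2) xL c\<theta> by simp
    then have "theta x ?h = 0" using kx theta_diff[OF xL, of k "wedge \<xi> ?c"] kC wC by simp
    moreover have "contract x ?h = 0"
      using xL \<xi>(3) kC by (simp add: contract_wedge)
    ultimately have "?h \<in> basic (insert x X) n" using h by (auto simp: basic_def)
    moreover have "ce_d ?h = 0"
      using ce_d_wedge[OF \<xi>(1,2) cC] dc dk kC wC by (simp add: ce_d_diff)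
    ultimately obtain q where q: "q \<in> basic (insert x X) m" "?h = ce_d q"
      using ex[of n] Suc by (auto simp: exact_at_def)
    have qX: "q \<in> basic X m" using q by (auto simp: basic_def)
    have "f = ?h + wedge \<xi> ?c + theta x w" using fkw by simp
    also have "\<dots> = ce_d (q + p + contract x w)"
      using q(2) p th vm[OF qX] vm[OF wc] vm[OF p(1)] vm[OF basic_closed(2)[OF X qX p(1)]]
      by (simp only: ce_d_add)
    finally have "f = ce_d (q + p + contract x w)" .
    moreover have "q + p + contract x w \<in> basic X m"
      using basic_closed(2)[OF X] qX p wc by blast
    ultimately show ?thesis using Suc by auto
  qed
qed

text \<open>
  Commuting semisimple elements with a dual system of closed 1-forms, i.e. of 1-forms that vanish on
  brackets. In other words, a basis of a torus that complements an ideal.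
\<close>

definition split_toral :: "'l set \<Rightarrow> bool" where
  "split_toral X \<longleftrightarrow> finite X \<and> (\<forall>x\<in>X. semisimple x) \<and> (\<forall>x\<in>X. \<forall>y\<in>X. bracket x y = 0) \<and>
     (\<forall>x\<in>X. \<exists>\<xi>. functional \<xi> \<and> (\<forall>a\<in>L. \<forall>b\<in>L. \<xi> (bracket a b) = 0) \<and>
        \<xi> x = 1 \<and> (\<forall>y\<in>X. y \<noteq> x \<longrightarrow> \<xi> y = 0))"

lemma split_toral_insertD:
  assumes "split_toral (insert x X)" "x \<notin> X"
  shows "split_toral X" "X \<subseteq> L" "semisimple x" "\<And>y. y \<in> X \<Longrightarrow> bracket x y = 0"
    "\<exists>\<xi>. functional \<xi> \<and> (\<forall>a\<in>L. \<forall>b\<in>L. \<xi> (bracket a b) = 0) \<and> \<xi> x = 1 \<and> (\<forall>y\<in>X. \<xi> y = 0)"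
proof -
  note T = assms(1)[unfolded split_toral_def]
  note T4 = T[THEN conjunct2, THEN conjunct2, THEN conjunct2]
  have "\<exists>\<xi>. functional \<xi> \<and> (\<forall>a\<in>L. \<forall>b\<in>L. \<xi> (bracket a b) = 0) \<and> \<xi> u = 1 \<and>
      (\<forall>y\<in>X. y \<noteq> u \<longrightarrow> \<xi> y = 0)" if "u \<in> X" for u
  proof -
    from bspec[OF T4 insertI2[OF that]] obtain \<xi> where "functional \<xi> \<and>
        (\<forall>a\<in>L. \<forall>b\<in>L. \<xi> (bracket a b) = 0) \<and> \<xi> u = 1 \<and>
        (\<forall>y\<in>insert x X. y \<noteq> u \<longrightarrow> \<xi> y = 0)"
      by (rule exE)
    then show ?thesis by (intro exI[of _ \<xi>]) simp
  qed
  then show "split_toral X" unfolding split_toral_def using T by simp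
  have "\<forall>y\<in>X. semisimple y" using T by simp
  then show "X \<subseteq> L" by (auto simp: semisimple_def)
  show "semisimple x" "\<And>y. y \<in> X \<Longrightarrow> bracket x y = 0" using T by simp_all
  from bspec[OF T4 insertI1] obtain \<xi> where "functional \<xi> \<and>
      (\<forall>a\<in>L. \<forall>b\<in>L. \<xi> (bracket a b) = 0) \<and> \<xi> x = 1 \<and>
      (\<forall>y\<in>insert x X. y \<noteq> x \<longrightarrow> \<xi> y = 0)"
    by (rule exE)
  then show "\<exists>\<xi>. functional \<xi> \<and> (\<forall>a\<in>L. \<forall>b\<in>L. \<xi> (bracket a b) = 0) \<and> \<xi> x = 1 \<and> (\<forall>y\<in>X. \<xi> y = 0)"
    using assms(2) by (intro exI[of _ \<xi>]) auto
qed

text \<open>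
  The first implication holds degree by degree. The second treats all degrees at once, since removing \<open>x\<close> uses
  exactness both for \<open>f - \<xi> \<and> i\<^sub>x f\<close> and, one degree lower, for \<open>i\<^sub>x f\<close>.
\<close>

lemma exact_at_split_toral:
  assumes "split_toral X"
  shows "exact_at {} n \<Longrightarrow> exact_at X n" and "(\<And>n. exact_at X n) \<Longrightarrow> exact_at {} n"
proof -
  have fin: "finite X" using assms by (simp add: split_toral_def)
  have "exact_at {} n \<longrightarrow> exact_at X n"
    using fin assms
  proof (induction X)
    case (insert x X)
    note D = split_toral_insertD[OF insert.prems insert.hyps(2)]
    from D(5) obtain \<xi> where \<xi>: "functional \<xi>" "\<And>a b. a \<in> L \<Longrightarrow> b \<in> L \<Longrightarrow> \<xi> (bracket a b) = 0"
      "\<xi> x = 1" "\<And>y. y \<in> X \<Longrightarrow> \<xi> y = 0" by blast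
    show ?case
    proof
      assume "exact_at {} n"
      then have ex: "exact_at X n" using insert.IH[OF D(1)] by simp
      show "exact_at (insert x X) n"
        by (rule exact_at_insert[OF D(2,3,4) \<xi>]; (assumption | rule ex))
    qed
  qed simp
  then show "exact_at {} n \<Longrightarrow> exact_at X n" by simp
  have "(\<forall>n. exact_at X n) \<longrightarrow> (\<forall>n. exact_at {} n)"
    using fin assms
  proof (induction X)
    case (insert x X)
    note D = split_toral_insertD[OF insert.prems insert.hyps(2)]
    from D(5) obtain \<xi> where \<xi>: "functional \<xi>" "\<And>a b. a \<in> L \<Longrightarrow> b \<in> L \<Longrightarrow> \<xi> (bracket a b) = 0"
      "\<xi> x = 1" "\<And>y. y \<in> X \<Longrightarrow> \<xi> y = 0" by blast
    show ?case
    proof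
      assume *: "\<forall>n. exact_at (insert x X) n"
      have "exact_at X n" for n
        by (rule exact_at_remove[OF D(2,3,4) \<xi>]; (assumption | rule *[THEN spec]))
      then show "\<forall>n. exact_at {} n" using insert.IH[OF D(1)] by simp
    qed
  qed simp
  then show "(\<And>n. exact_at X n) \<Longrightarrow> exact_at {} n" by simp
qed

section \<open>Evaluation of cochains\<close>

lemma theta_on_eigenvectors:
  assumes f: "f \<in> cochains n" and ys: "ys \<in> tuples n" and x: "x \<in> L"
    and eig: "\<And>j. j < n \<Longrightarrow> bracket x (ys ! j) = \<mu> j *\<^sub>L (ys ! j)"
  shows "theta x f ys = act x (f ys) - (\<Sum>j<n. \<mu> j) *\<^sub>M f ys"
proof -
  have "f (ys[j := bracket x (ys ! j)]) = \<mu> j *\<^sub>M f ys" if "j < n" for j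
  proof -
    have "ys ! j \<in> L" using ys that by (auto simp: tuples_def)
    then show ?thesis
      using cochainsD(4)[OF f ys that, of "ys ! j" "\<mu> j"] eig[OF that] by simp
  qed
  then show ?thesis
    by (simp add: theta_expand[OF f ys x] M.scale_sum_left)
qed

lemma cochain_eqI_on_span:
  assumes S: "S \<subseteq> L" "L \<subseteq> span S"
  shows "f \<in> cochains n \<Longrightarrow> (\<And>ys. ys \<in> lists S \<Longrightarrow> length ys = n \<Longrightarrow> f ys = 0) \<Longrightarrow> f = 0"
proof (induction n arbitrary: f)
  case 0
  then show ?case by (intro cochains_0_eqI[where g = 0]) (auto simp: zero_fun_apply)
next
  case (Suc n)
  have "contract y f = 0" if y: "y \<in> S" for y
  proof (rule Suc.IH)
    show "contract y f \<in> cochains n" using Suc.prems y S by auto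
    show "contract y f ys = 0" if "ys \<in> lists S" "length ys = n" for ys
      using Suc.prems(2)[of "y # ys"] y that by (simp add: contract_def)
  qed
  then have "contract y f = contract y 0" if "y \<in> L" for y
    using cochain_eq_0_on_span[OF Suc.prems(1) S _ that] by simp
  with cochains_eqI[OF Suc.prems(1), of 0] show ?case by simp
qed

lemma cochain_eq_0_if_contract_eq_0:
  assumes x: "x \<in> L"
  shows "f \<in> cochains n \<Longrightarrow> contract x f = 0 \<Longrightarrow> x \<in> set ys \<Longrightarrow> f ys = 0"
proof (induction ys arbitrary: f n)
  case (Cons y ys)
  show ?case
  proof (cases "y = x")
    case True
    then show ?thesis using fun_cong[OF Cons.prems(2), of ys] by (simp add: contract_def zero_fun_apply)
  next
    case False
    show ?thesis
    proof (cases "n = 0 \<or> y \<notin> L")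
      case True
      then show ?thesis
        using Cons.prems(1) cochainsD(2)[OF Cons.prems(1), of "y # ys"] by (auto simp: tuples_def)
    next
      case y: False
      then obtain m where m: "n = Suc m" by (cases n) auto
      have "contract x (contract y f) = 0"
        using contract_swap[OF Cons.prems(1) x, of y] y Cons.prems(2) by simp
      then have "contract y f ys = 0"
        using Cons.prems(1,3) False y m Cons.IH[of "contract y f" m] by simp
      then show ?thesis by (simp add: contract_def)
    qed
  qed
qed simp

text \<open>A permutation of the arguments changes at most the sign.\<close>

lemma cochain_eq_0_mset:
  "f \<in> cochains n \<Longrightarrow> set as \<subseteq> L \<Longrightarrow> mset as = mset bs \<Longrightarrow> f as = 0 \<Longrightarrow> f bs = 0"
proof (induction as arbitrary: f n bs)
  case Nil
  then have "bs = []" by simp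
  then show ?case using Nil by simp
next
  case (Cons a as)
  have aL: "a \<in> L" and asL: "set as \<subseteq> L" using Cons.prems by auto
  have len: "length (a # as) = length bs" using Cons.prems(3) by (metis size_mset)
  show ?case
  proof (cases "length bs = n")
    case False
    then show ?thesis using cochainsD(2)[OF Cons.prems(1)] by (auto simp: tuples_def)
  next
    case True
    then obtain m where m: "n = Suc m" using len by (cases n) auto
    have "a \<in> set bs" using Cons.prems(3) by (metis list.set_intros(1) mset_eq_setD)
    then obtain b1 b2 where bs: "bs = b1 @ a # b2" by (metis split_list)
    have ms: "mset as = mset (b1 @ b2)" using Cons.prems(3) bs by simp
    then have bL: "set (b1 @ b2) \<subseteq> L" using asL by (metis mset_eq_setD)
    have "contract a f (b1 @ b2) = 0"
    proof (rule Cons.IH[OF _ asL ms])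
      show "contract a f \<in> cochains m" using Cons.prems(1) m aL by simp
      show "contract a f as = 0" using Cons.prems(4) by (simp add: contract_def)
    qed
    moreover have "bs \<in> tuples n" using True bs bL aL by (auto simp: tuples_def)
    then have "f (a # nths bs (- {length b1})) = (- 1) ^ length b1 *\<^sub>M f (bs[length b1 := a])"
      using Cons.prems(1) bs aL True by (intro contract_move) auto
    moreover have "bs[length b1 := a] = bs" by (simp add: bs)
    moreover have "nths bs (- {length b1}) = b1 @ b2"
    proof -
      have "nths b1 (- {length b1}) = b1" by (rule nths_all) auto
      moreover have "nths (a # b2) {j. j + length b1 \<in> - {length b1}} = b2"
        by (simp add: nths_Cons nths_all)
      ultimately show ?thesis by (simp add: bs nths_append)
    qed
    ultimately show ?thesis by (simp add: contract_def)
  qed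
qed

lemma distinct_if_cochain_nonzero:
  assumes f: "f \<in> cochains n" and nz: "f xs \<noteq> 0"
  shows "distinct xs"
proof -
  have tup: "xs \<in> tuples n" using cochainsD(2)[OF f] nz by blast
  then have len: "length xs = n" by (simp add: tuples_def)
  have lt: "xs ! i \<noteq> xs ! j" if "i < j" "j < n" for i j
    using cochainsD(5)[OF f tup that] nz by blast
  have "xs ! i \<noteq> xs ! j" if "i < n" "j < n" "i \<noteq> j" for i j
  proof (cases "i < j")
    case True
    then show ?thesis using lt that by simp
  next
    case False
    then have "xs ! j \<noteq> xs ! i" using lt that by simp
    then show ?thesis by simp
  qed
  then show ?thesis by (simp add: distinct_conv_nth len)
qed

lemma wedge_eq_0:
  assumes "\<And>y. y \<in> set ys \<Longrightarrow> \<xi> y = 0"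
  shows "wedge \<xi> g ys = 0"
  using assms by (induction ys arbitrary: g) auto

lemma wedge_values:
  assumes "M.subspace W" "\<And>ys. g ys \<in> W"
  shows "wedge \<xi> g ys \<in> W"
  using assms(2)
proof (induction ys arbitrary: g)
  case Nil
  then show ?case using M.subspace_0[OF assms(1)] by simp
next
  case (Cons y ys)
  have "wedge \<xi> (contract y g) ys \<in> W"
    using Cons.prems by (intro Cons.IH) (simp add: contract_def)
  then show ?case
    using Cons.prems M.subspace_0[OF assms(1)] M.subspace_diff[OF assms(1)] M.subspace_scale[OF assms(1)]
    by simp
qed

end

context fin_dim_lie_algebra
begin

section \<open>Weight vectors of a torus\<close>

lemma torus_linear:
  assumes "torus T" "x \<in> T"
  shows "x (u + v) = x u + x v" "x (c *\<^sub>N u) = c *\<^sub>N x u" "x (u - v) = x u - x v" "x 0 = 0"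
    "x (bracket u v) = bracket (x u) v + bracket u (x v)" "x (sum f A) = (\<Sum>a\<in>A. x (f a))"
proof -
  interpret Vector_Spaces.linear scale scale x
    using assms by (auto simp: torus_def derivations_def)
  show "x (u + v) = x u + x v" "x (c *\<^sub>N u) = c *\<^sub>N x u" "x (u - v) = x u - x v" "x 0 = 0"
    "x (sum f A) = (\<Sum>a\<in>A. x (f a))"
    by (simp_all add: add scale diff zero sum)
  show "x (bracket u v) = bracket (x u) v + bracket u (x v)"
    using assms by (auto simp: torus_def derivations_def)
qed

lemma torus_commute:
  assumes "torus T" "x \<in> T" "y \<in> T"
  shows "x (y v) = y (x v)"
proof -
  have "(x \<circ> y) - (y \<circ> x) = 0" using assms by (auto simp: torus_def)
  then show ?thesis by (metis comp_apply eq_iff_diff_eq_0)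
qed

lemma ex_finite_basis: "\<exists>B. finite B \<and> independent B \<and> span B = UNIV"
proof -
  obtain C where C: "finite C" "span C = UNIV" using finite_dimensional by blast
  obtain B where "independent B" "UNIV \<subseteq> span B"
    using maximal_independent_subset[of UNIV] by blast
  moreover have "finite B" using independent_span_bound[OF C(1) \<open>independent B\<close>] C by simp
  ultimately show ?thesis by blast
qed

definition weight_vectors :: "('n \<Rightarrow> 'n) set \<Rightarrow> 'n set" where
  "weight_vectors T = {v. \<forall>x\<in>T. \<exists>c. x v = c *\<^sub>N v}"

text \<open>
  A torus-stable subspace on which not every element acts by a scalar splits into proper torus-stable
  eigenspaces, so induction on the dimension applies.
\<close>

lemma stable_subspace_spanned_by_weight_vectors:
  assumes T: "torus T"
  shows "subspace U \<Longrightarrow> (\<And>x u. x \<in> T \<Longrightarrow> u \<in> U \<Longrightarrow> x u \<in> U) \<Longrightarrow> U \<subseteq> span (weight_vectors T)"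
proof (induction "dim U" arbitrary: U rule: less_induct)
  case less
  note lin = torus_linear[OF T]
  obtain B0 where B0: "finite B0" "independent B0" "span B0 = UNIV" using ex_finite_basis by blast
  interpret fd: finite_dimensional_vector_space scale B0
    using B0 by unfold_locales
  show ?case
  proof (cases "\<forall>x\<in>T. \<exists>c. \<forall>u\<in>U. x u = c *\<^sub>N u")
    case True
    then have "U \<subseteq> weight_vectors T" unfolding weight_vectors_def by blast
    then show ?thesis using span_superset by blast
  next
    case False
    then obtain x where x: "x \<in> T" "\<And>c. \<not> (\<forall>u\<in>U. x u = c *\<^sub>N u)" by blast
    interpret U: endomorphism_on scale U x
      using less.prems x lin by unfold_locales auto
    interpret N: endomorphism_on scale UNIV x
      using lin[OF x(1)] by unfold_locales auto
    have "diagonalizable x" using T x by (auto simp: torus_def)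
    then obtain B where B: "independent B" "span B = UNIV" "\<forall>b\<in>B. \<exists>c. x b = c *\<^sub>N b"
      unfolding diagonalizable_def by blast
    have "finite B" using independent_span_bound[OF B0(1) B(1)] B0 by simp
    obtain c where c: "\<And>b. b \<in> B \<Longrightarrow> x b = c b *\<^sub>N b" using B(3) by metis
    obtain ms where ms: "set ms = c ` B" "distinct ms"
      using finite_distinct_list[of "c ` B"] \<open>finite B\<close> by auto
    have "B \<subseteq> {u \<in> UNIV. \<exists>c\<in>set ms. x u = c *\<^sub>N u}" using c ms by auto
    from span_mono[OF this] have ann: "factors scale x ms v = 0" for v
      using N.factors_span[of v ms] B(2) by blast
    have eig: "{u \<in> U. x u = d *\<^sub>N u} \<subseteq> span (weight_vectors T)" for d
    proof (rule less.hyps)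
      let ?V = "{u \<in> U. x u = d *\<^sub>N u}"
      show V: "subspace ?V"
        using lin[OF x(1)] by (intro subspaceI) (auto simp: scale_right_distrib mult.commute)
      show "y u \<in> ?V" if "y \<in> T" "u \<in> ?V" for y u
        using that less.prems torus_commute[OF T x(1) that(1), of u] lin[OF that(1)] by auto
      have "?V \<noteq> U" using x(2)[of d] by blast
      then have "?V \<subset> U" by blast
      then have "span ?V \<subset> span U"
        using V less.prems(1) by (simp add: span_eq_iff[THEN iffD2])
      then show "dim ?V < dim U" by (rule fd.dim_psubset)
    qed
    show ?thesis
    proof
      fix u assume "u \<in> U"
      then have "u \<in> span {u \<in> U. \<exists>c\<in>set ms. x u = c *\<^sub>N u}"
        using U.eigenvector_decomposition[OF _ ann ms(2)] by blast
      moreover have "{u \<in> U. \<exists>c\<in>set ms. x u = c *\<^sub>N u} \<subseteq> span (weight_vectors T)"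
        using eig by blast
      ultimately show "u \<in> span (weight_vectors T)"
        using span_minimal[OF _ subspace_span] by blast
    qed
  qed
qed

text \<open>
  A basis modulo \<open>W\<close> together with a basis of \<open>W\<close> is a basis of the whole space. So all bases modulo \<open>W\<close>
  have the same size, and the arbitrary choice in the definition of \<open>quotient_dim\<close> does not matter.
\<close>

lemma basis_modulo_card:
  assumes B2: "independent B2" "span B2 = W" and B: "basis_modulo UNIV W B"
  shows "card B + card B2 = dim UNIV" "independent B"
proof -
  have fin: "finite A" if "independent A" for A
    using ex_finite_basis independent_span_bound that by (metis UNIV_I subsetI)
  have span: "span (B \<union> W) = UNIV"
    and ind: "\<And>F c. finite F \<Longrightarrow> F \<subseteq> B \<Longrightarrow> (\<Sum>b\<in>F. c b *\<^sub>N b) \<in> W \<Longrightarrow> \<forall>b\<in>F. c b = 0"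
    using B unfolding basis_modulo_def by blast+
  have B2W: "B2 \<subseteq> W" using B2 span_superset by blast
  have disj: "B \<inter> B2 = {}"
  proof (rule ccontr)
    assume "B \<inter> B2 \<noteq> {}"
    then obtain b where "b \<in> B" "b \<in> W" using B2W by blast
    then show False using ind[of "{b}" "\<lambda>_. 1"] by simp
  qed
  have indep: "independent (B \<union> B2)"
    unfolding independent_explicit_module
  proof (intro allI impI)
    fix t u v assume t: "finite t" "t \<subseteq> B \<union> B2" "(\<Sum>v\<in>t. u v *\<^sub>N v) = 0" and v: "v \<in> t"
    have split: "(\<Sum>v\<in>t. u v *\<^sub>N v) = (\<Sum>v\<in>t \<inter> B. u v *\<^sub>N v) + (\<Sum>v\<in>t - B. u v *\<^sub>N v)"
      using t(1) by (rule sum.Int_Diff)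
    have tB2: "t - B \<subseteq> B2" using t by blast
    have "(\<Sum>v\<in>t - B. u v *\<^sub>N v) \<in> W"
      using tB2 unfolding B2(2)[symmetric] by (intro span_sum span_scale span_base) blast
    moreover have "subspace W" using B2 by auto
    ultimately have "(\<Sum>v\<in>t \<inter> B. u v *\<^sub>N v) \<in> W"
      using t(3) split by (metis add_eq_0_iff2 subspace_neg)
    then have zB: "\<forall>b\<in>t \<inter> B. u b = 0" using t(1) by (intro ind) auto
    then have "(\<Sum>v\<in>t - B. u v *\<^sub>N v) = 0" using split t(3) by simp
    then have "\<forall>b\<in>t - B. u b = 0"
      using independentD[OF B2(1) _ tB2] t(1) by blast
    then show "u v = 0" using zB v by blast
  qed
  then show "independent B" by (rule independent_mono) blast
  have "W \<subseteq> span (B \<union> B2)" unfolding B2(2)[symmetric] by (rule span_mono) blast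
  then have "span (B \<union> W) \<subseteq> span (B \<union> B2)"
    by (intro span_minimal) (auto intro: span_base)
  then have "span (B \<union> B2) = span UNIV" using span by auto
  then have "dim UNIV = card (B \<union> B2)" using indep by (rule dim_eq_card)
  also have "\<dots> = card B + card B2"
    using disj fin[OF indep] by (intro card_Un_disjoint) auto
  finally show "card B + card B2 = dim UNIV" by simp
qed

text \<open>
  Extend a basis of \<open>W\<close> by elements of the spanning set \<open>V\<close>. Applied to weight vectors, this produces
  generators that are weight vectors.
\<close>

lemma ex_basis_modulo_subset:
  assumes W: "subspace W" and V: "span V = UNIV"
  shows "\<exists>E\<subseteq>V. finite E \<and> independent E \<and> span (E \<union> W) = UNIV \<and> card E = quotient_dim UNIV W"
proof -
  obtain B2 where B2: "B2 \<subseteq> W" "independent B2" "W \<subseteq> span B2"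
    using maximal_independent_subset[of W] by blast
  have B2W: "span B2 = W" using B2 W by (intro span_subspace) auto
  obtain B where B: "B2 \<subseteq> B" "B \<subseteq> B2 \<union> V" "independent B" "B2 \<union> V \<subseteq> span B"
    using maximal_independent_subset_extend[of B2 "B2 \<union> V"] B2 by blast
  let ?E = "B - B2"
  have "span V \<subseteq> span B" using B(4) by (intro span_minimal) auto
  then have spB: "span B = UNIV" using V by blast
  have "span B \<subseteq> span (?E \<union> W)" using B2 by (intro span_mono) blast
  then have spE: "span (?E \<union> W) = UNIV" using spB by blast
  have "basis_modulo UNIV W ?E"
    unfolding basis_modulo_def
  proof (intro conjI allI impI)
    fix F c assume F: "finite F \<and> F \<subseteq> ?E \<and> (\<Sum>b\<in>F. c b *\<^sub>N b) \<in> W"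
    then have w: "(\<Sum>b\<in>F. c b *\<^sub>N b) \<in> span B2" using B2W by simp
    show "\<forall>b\<in>F. c b = 0"
    proof (rule ccontr)
      assume "\<not> (\<forall>b\<in>F. c b = 0)"
      then obtain b where b: "b \<in> F" "c b \<noteq> 0" by blast
      have "(\<Sum>b\<in>F. c b *\<^sub>N b) = c b *\<^sub>N b + (\<Sum>a\<in>F - {b}. c a *\<^sub>N a)"
        using F b by (intro sum.remove) auto
      then have "c b *\<^sub>N b = (\<Sum>b\<in>F. c b *\<^sub>N b) - (\<Sum>a\<in>F - {b}. c a *\<^sub>N a)" by simp
      moreover have "(\<Sum>b\<in>F. c b *\<^sub>N b) \<in> span (B - {b})"
        using w by (rule rev_subsetD) (rule span_mono, use F B(1) b in blast)
      moreover have "(\<Sum>a\<in>F - {b}. c a *\<^sub>N a) \<in> span (B - {b})"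
        using F by (intro span_sum span_scale span_base) blast
      ultimately have "c b *\<^sub>N b \<in> span (B - {b})" by (simp add: span_diff)
      from span_scale[OF this, of "1 / c b"] have "b \<in> span (B - {b})" using b by simp
      then show False using B(3) F b unfolding dependent_def by blast
    qed
  qed (use spE in auto)
  moreover have "basis_modulo UNIV W (SOME B. basis_modulo UNIV W B)"
    using calculation by (rule someI)
  ultimately have "card ?E = quotient_dim UNIV W"
    using basis_modulo_card(1)[OF B2(2) B2W] unfolding quotient_dim_def by (metis add_right_cancel)
  moreover have "independent ?E" using B(3) independent_mono by blast
  moreover have "finite ?E"
    using ex_finite_basis independent_span_bound[OF _ \<open>independent ?E\<close>] by (metis UNIV_I subsetI)
  ultimately show ?thesis using B(2) spE by blast
qed

section \<open>Generators of a nilpotent Lie algebra and the torus of maximal rank\<close>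

fun iterated_bracket :: "'n list \<Rightarrow> 'n" where
  "iterated_bracket [] = 0"
| "iterated_bracket [e] = e"
| "iterated_bracket (e # f # es) = bracket e (iterated_bracket (f # es))"

lemma iterated_bracket_Cons:
  "es \<noteq> [] \<Longrightarrow> iterated_bracket (e # es) = bracket e (iterated_bracket es)"
  by (cases es) auto

lemma bracket_linear:
  "bracket (u + v) w = bracket u w + bracket v w" "bracket w (u + v) = bracket w u + bracket w v"
  "bracket (c *\<^sub>N u) v = c *\<^sub>N bracket u v" "bracket u (c *\<^sub>N v) = c *\<^sub>N bracket u v"
  "bracket 0 v = 0" "bracket v 0 = 0"
  using bracket_scale_left[of 0 v 0] bracket_scale_right[of v 0 0]
  by (simp_all add: bracket_add_left bracket_add_right bracket_scale_left bracket_scale_right)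

lemma subspace_lower_central: "subspace (lower_central k)"
  by (cases k rule: lower_central.cases) (auto simp: set_bracket_def subspace_L)

lemma bracket_in_lower_central:
  assumes "k \<ge> 1" "y \<in> lower_central k"
  shows "bracket x y \<in> lower_central (Suc k)"
  using assms by (cases k) (auto simp: set_bracket_def intro!: span_base)

lemma lower_central_2: "lower_central 2 = span {bracket x y | x y. True}"
  by (simp add: numeral_2_eq_2 set_bracket_def)

declare lower_central.simps(3) [simp del]

text \<open>By the Jacobi identity \<open>[[a, b], y] = [a, [b, y]] - [b, [a, y]]\<close>.\<close>

lemma derived_bracket_in_lower_central:
  assumes k: "k \<ge> 1" and y: "y \<in> lower_central k" and x: "x \<in> lower_central 2"
  shows "bracket x y \<in> lower_central (Suc (Suc k))"
  using x unfolding lower_central_2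
proof (induction rule: span_induct_alt)
  case base
  then show ?case by (simp add: bracket_linear subspace_0[OF subspace_lower_central])
next
  case (step c z w)
  then obtain a b where z: "z = bracket a b" by blast
  have "bracket z y = - bracket y z" by (rule bracket_anticomm) auto
  moreover have "bracket b (bracket y a) = - bracket b (bracket a y)"
    using bracket_anticomm[of y a] bracket_linear(4)[of b "- 1" "bracket a y"] by simp
  ultimately have "bracket z y = bracket a (bracket b y) - bracket b (bracket a y)"
    using jacobi[of a b y] z by (simp add: algebra_simps)
  moreover have "bracket a (bracket b y) \<in> lower_central (Suc (Suc k))"
    "bracket b (bracket a y) \<in> lower_central (Suc (Suc k))"
    using k y by (intro bracket_in_lower_central; simp)+
  ultimately have "bracket z y \<in> lower_central (Suc (Suc k))"
    using subspace_diff[OF subspace_lower_central] by simp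
  then show ?case
    using step.IH subspace_add[OF subspace_lower_central] subspace_scale[OF subspace_lower_central]
    by (simp add: bracket_linear)
qed

definition words :: "'n set \<Rightarrow> 'n list set" where
  "words E = {ks \<in> lists E. ks \<noteq> []}"

lemma iterated_bracket_in_lower_central:
  "ks \<noteq> [] \<Longrightarrow> iterated_bracket ks \<in> lower_central (length ks)"
proof (induction ks)
  case (Cons e ks)
  then show ?case
    by (cases "ks = []") (auto simp: iterated_bracket_Cons Suc_le_eq intro!: bracket_in_lower_central)
qed simp

lemma lower_central_eventually_0:
  assumes "lower_central (Suc s) = {0}" "k > s"
  shows "lower_central k = {0}"
  using assms(2)
proof (induction k)
  case (Suc k)
  show ?case
  proof (cases "k = s")
    case False
    then have "lower_central k = {0}" "k > 0" using Suc by auto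
    then have "lower_central (Suc k) = set_bracket UNIV {0}"
      by (cases k) (auto simp: lower_central.simps(3))
    also have "{bracket x y |x y. x \<in> UNIV \<and> y \<in> {0}} = {0}" by (auto simp: bracket_linear)
    then have "set_bracket UNIV {0} = {0}" by (simp add: set_bracket_def)
    finally show ?thesis .
  qed (use assms(1) in simp)
qed simp

text \<open>
  For \<open>y\<close> in the \<open>k\<close>-th term, \<open>[x, y]\<close> depends modulo the \<open>(k + 2)\<close>-nd term only on \<open>x\<close> modulo \<open>[N, N]\<close>
  and on \<open>y\<close> modulo the \<open>(k + 1)\<close>-st term.
\<close>

lemma lower_central_spanned:
  assumes gen: "span (E \<union> lower_central 2) = UNIV"
  shows "lower_central (Suc k) \<subseteq>
    span (iterated_bracket ` {ks \<in> words E. length ks = Suc k} \<union> lower_central (Suc (Suc k)))"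
    (is "_ \<subseteq> span (?S k \<union> _)")
proof (induction k)
  case 0
  have "E \<subseteq> ?S 0"
  proof
    fix e assume "e \<in> E"
    then show "e \<in> ?S 0" by (intro image_eqI[of _ _ "[e]"]) (auto simp: words_def)
  qed
  then have "span (E \<union> lower_central 2) \<subseteq> span (?S 0 \<union> lower_central (Suc (Suc 0)))"
    by (intro span_mono) (auto simp: numeral_2_eq_2)
  then show ?case using gen by auto
next
  case (Suc k)
  let ?Z = "span (?S (Suc k) \<union> lower_central (Suc (Suc (Suc k))))"
  have one: "bracket e y \<in> ?Z" if e: "e \<in> E" and y: "y \<in> lower_central (Suc k)" for e y
  proof -
    have "y \<in> span (?S k \<union> lower_central (Suc (Suc k)))" using Suc.IH y by blast
    then show ?thesis
    proof (induction rule: span_induct_alt)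
      case base
      then show ?case by (simp add: bracket_linear span_zero)
    next
      case (step c z w)
      have "bracket e z \<in> ?Z"
        using step.hyps
      proof
        assume "z \<in> ?S k"
        then obtain ks where ks: "ks \<in> words E" "length ks = Suc k" "z = iterated_bracket ks" by auto
        then have "bracket e z = iterated_bracket (e # ks)"
          by (simp add: words_def iterated_bracket_Cons)
        moreover have "e # ks \<in> words E" using ks e by (auto simp: words_def)
        ultimately show ?thesis using ks(2) by (intro span_base UnI1 image_eqI[of _ _ "e # ks"]) auto
      next
        assume "z \<in> lower_central (Suc (Suc k))"
        then show ?thesis by (intro span_base UnI2 bracket_in_lower_central) auto
      qed
      then show ?case using step.IH by (simp add: bracket_linear span_add span_scale)
    qed
  qed
  have "bracket x y \<in> ?Z" if y: "y \<in> lower_central (Suc k)" for x y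
  proof -
    have "x \<in> span (E \<union> lower_central 2)" using gen by simp
    then show ?thesis
    proof (induction rule: span_induct_alt)
      case base
      then show ?case by (simp add: bracket_linear span_zero)
    next
      case (step c z w)
      have "bracket z y \<in> ?Z"
        using step.hyps one[OF _ y] derived_bracket_in_lower_central[OF _ y, of z]
        by (auto intro: span_base)
      then show ?case using step.IH by (simp add: bracket_linear span_add span_scale)
    qed
  qed
  then show ?case
    by (subst lower_central.simps(3), unfold set_bracket_def, intro span_minimal) auto
qed

text \<open>
  The descent through the lower central series ends at \<open>0\<close> because of nilpotency.
\<close>

lemma span_iterated_brackets:
  assumes gen: "span (E \<union> lower_central 2) = UNIV" and nil: "lower_central (Suc s) = {0}"
  shows "span (iterated_bracket ` words E) = UNIV"
proof -
  have "UNIV \<subseteq> span (iterated_bracket ` words E \<union> lower_central (Suc k))" for k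
  proof (induction k)
    case 0
    show ?case by (auto intro: span_base)
  next
    case (Suc k)
    let ?Y = "span (iterated_bracket ` words E \<union> lower_central (Suc (Suc k)))"
    have "lower_central (Suc k) \<subseteq> ?Y"
      using lower_central_spanned[OF gen, of k] by (rule order_trans) (intro span_mono, blast)
    then have "span (iterated_bracket ` words E \<union> lower_central (Suc k)) \<subseteq> ?Y"
      by (intro span_minimal) (auto intro: span_base)
    then show ?case using Suc.IH by blast
  qed
  from this[of s] have "UNIV \<subseteq> span (insert 0 (iterated_bracket ` words E))" by (simp add: nil)
  then show ?thesis by (simp add: span_insert_0 top.extremum_unique)
qed

text \<open>
  Restriction to the generators embeds \<open>T\<close> into the diagonal endomorphisms of their span; by
  maximality of the rank this is onto, and evaluation at the sum of the generators detects it.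
\<close>

lemma ex_dual_basis_of_torus:
  assumes T: "torus T" and E: "finite E" "independent E" "E \<subseteq> weight_vectors T"
    and gen: "span (iterated_bracket ` words E) = UNIV" and card: "endo.dim T = card E"
  shows "\<exists>X. (\<forall>e\<in>E. X e \<in> T \<and> (\<forall>f\<in>E. X e f = (if e = f then f else 0))) \<and>
    T \<subseteq> endo.span (X ` E)"
proof -
  note lin = torus_linear[OF T]
  have sub: "endo.subspace T" using T by (simp add: torus_def)
  have "\<forall>x e. \<exists>c. x \<in> T \<longrightarrow> e \<in> E \<longrightarrow> x e = c *\<^sub>N e"
    using E(3) by (auto simp: weight_vectors_def)
  then obtain a where a: "\<And>x e. x \<in> T \<Longrightarrow> e \<in> E \<Longrightarrow> x e = a x e *\<^sub>N e" by metis
  \<comment> \<open>A diagonal endomorphism of the span of \<open>E\<close> is determined by its value at \<open>u\<close>.\<close>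
  define u where "u = (\<Sum>e\<in>E. e)"
  have xu: "x u = (\<Sum>e\<in>E. a x e *\<^sub>N e)" if "x \<in> T" for x
    using a[OF that] by (simp add: u_def lin(6)[OF that])
  have zero: "x = 0" if x: "x \<in> T" and z: "\<And>e. e \<in> E \<Longrightarrow> x e = 0" for x
  proof -
    have words: "x (iterated_bracket ks) = 0" if "ks \<in> words E" for ks
      using that
    proof (induction ks)
      case (Cons e ks)
      then show ?case
        using z x by (cases "ks = []") (auto simp: words_def iterated_bracket_Cons lin bracket_linear)
    qed (simp add: words_def)
    have "x v = 0" for v
    proof -
      have "v \<in> span (iterated_bracket ` words E)" using gen by simp
      then show ?thesis
        using words by (induction rule: span_induct_alt) (auto simp: lin[OF x])
    qed
    then show ?thesis by (simp add: fun_eq_iff)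
  qed
  define \<Psi> :: "('n \<Rightarrow> 'n) \<Rightarrow> 'n" where "\<Psi> = (\<lambda>x. x u)"
  interpret \<Psi>: Vector_Spaces.linear endo_scale scale \<Psi>
    by unfold_locales (auto simp: \<Psi>_def endo_scale_def scale_right_distrib scale_left_distrib)
  have inj: "inj_on \<Psi> T"
  proof (rule inj_onI)
    fix x y assume x: "x \<in> T" and y: "y \<in> T" and xy: "\<Psi> x = \<Psi> y"
    have d: "x - y \<in> T" using endo.subspace_diff[OF sub x y] .
    have "(x - y) u = 0" using xy by (simp add: \<Psi>_def)
    then have "(\<Sum>e\<in>E. a (x - y) e *\<^sub>N e) = 0" using xu[OF d] by simp
    then have "a (x - y) e = 0" if "e \<in> E" for e
      using independentD[OF E(2,1) subset_refl] that by blast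
    then have "x - y = 0" using a[OF d] by (intro zero[OF d]) simp
    then show "x = y" by simp
  qed
  obtain BT where BT: "BT \<subseteq> T" "endo.independent BT" "T \<subseteq> endo.span BT" "card BT = endo.dim T"
    using endo.basis_exists[of T] by blast
  have spBT: "endo.span BT = T" using BT sub by (intro endo.span_subspace)
  have indB: "independent (\<Psi> ` BT)"
    using \<Psi>.independent_injective_image[OF BT(2)] inj spBT by simp
  have in_span: "\<Psi> ` BT \<subseteq> span E"
  proof
    fix v assume "v \<in> \<Psi> ` BT"
    then obtain x where "x \<in> T" "v = x u" using BT(1) by (auto simp: \<Psi>_def)
    then have "v = (\<Sum>e\<in>E. a x e *\<^sub>N e)" using xu by (simp only:)
    then show "v \<in> span E" by (auto intro: span_sum span_scale span_base)
  qed
  have finB: "finite (\<Psi> ` BT)" using independent_span_bound[OF E(1) indB in_span] by simp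
  have cardB: "card (\<Psi> ` BT) = card E"
    using card_image[OF inj_on_subset[OF inj BT(1)]] BT(4) card by simp
  have onto: "e \<in> \<Psi> ` T" if e: "e \<in> E" for e
  proof (rule ccontr)
    assume "e \<notin> \<Psi> ` T"
    then have ne: "e \<notin> span (\<Psi> ` BT)" using \<Psi>.span_image[of BT] spBT by simp
    then have "independent (insert e (\<Psi> ` BT))" using indB by (rule independent_insertI)
    moreover have "insert e (\<Psi> ` BT) \<subseteq> span E" using in_span e span_base by auto
    ultimately have "card (insert e (\<Psi> ` BT)) \<le> card E"
      using independent_span_bound[OF E(1)] by blast
    moreover have "e \<notin> \<Psi> ` BT" using ne span_base by blast
    ultimately show False using finB cardB by simp
  qed
  have "\<forall>e. \<exists>x. e \<in> E \<longrightarrow> x \<in> T \<and> x u = e" using onto by (auto simp: \<Psi>_def)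
  then obtain X where X: "\<And>e. e \<in> E \<Longrightarrow> X e \<in> T" "\<And>e. e \<in> E \<Longrightarrow> X e u = e" by metis
  have XE: "X e f = (if e = f then f else 0)" if e: "e \<in> E" and f: "f \<in> E" for e f
  proof -
    have "(\<Sum>g\<in>E. (a (X e) g - (if g = e then 1 else 0)) *\<^sub>N g)
        = (\<Sum>g\<in>E. a (X e) g *\<^sub>N g) - (\<Sum>g\<in>E. (if g = e then 1 else 0) *\<^sub>N g)"
      by (simp add: scale_left_diff_distrib sum_subtractf)
    also have "(\<Sum>g\<in>E. (if g = e then 1 else 0) *\<^sub>N g) = (\<Sum>g\<in>E. if g = e then g else 0)"
      by (intro sum.cong) auto
    also have "\<dots> = e" using E(1) e by simp
    also have "(\<Sum>g\<in>E. a (X e) g *\<^sub>N g) - e = 0" using xu[OF X(1)[OF e]] X(2)[OF e] by simp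
    finally have "(\<Sum>g\<in>E. (a (X e) g - (if g = e then 1 else 0)) *\<^sub>N g) = 0" .
    from independentD[OF E(2,1) subset_refl this f]
    have "a (X e) f - (if f = e then 1 else 0) = 0" .
    then show ?thesis using a[OF X(1)[OF e] f] by (auto split: if_splits)
  qed
  have "x \<in> endo.span (X ` E)" if x: "x \<in> T" for x
  proof -
    let ?y = "\<Sum>e\<in>E. endo_scale (a x e) (X e)"
    have y: "?y \<in> T" using X(1) by (intro endo.subspace_sum[OF sub] endo.subspace_scale[OF sub])
    have ap: "(\<Sum>e\<in>F. endo_scale (a x e) (X e)) v = (\<Sum>e\<in>F. a x e *\<^sub>N X e v)" if "finite F" for F v
      using that by (induction F) (auto simp: endo_scale_def)
    have "(x - ?y) f = 0" if f: "f \<in> E" for f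
    proof -
      have "?y f = (\<Sum>e\<in>E. if e = f then a x f *\<^sub>N f else 0)"
        unfolding ap[OF E(1)] by (intro sum.cong) (auto simp: XE f)
      then show ?thesis using a[OF x f] E(1) f by simp
    qed
    then have "x - ?y = 0" using endo.subspace_diff[OF sub x y] by (intro zero)
    then have "x = ?y" by simp
    moreover have "?y \<in> endo.span (X ` E)"
      by (intro endo.span_sum endo.span_scale endo.span_base) auto
    ultimately show ?thesis by simp
  qed
  then show ?thesis using X(1) XE by (intro exI[of _ X]) blast
qed

lemma iterated_bracket_last_two:
  "iterated_bracket (as @ [p, q]) \<noteq> 0 \<Longrightarrow> bracket p q \<noteq> 0"
proof (induction as)
  case (Cons a as)
  have "iterated_bracket (as @ [p, q]) \<noteq> 0"
  proof
    assume "iterated_bracket (as @ [p, q]) = 0"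
    then show False using Cons.prems by (simp add: iterated_bracket_Cons bracket_linear)
  qed
  then show ?case by (rule Cons.IH)
qed simp

end

section \<open>Weights of the semidirect product\<close>

lemma sum_count_list_concat:
  "(\<Sum>j<length kss. of_nat (count_list (kss ! j) e) :: complex) = of_nat (count_list (concat kss) e)"
proof (induction kss)
  case (Cons ks kss)
  then show ?case by (simp add: sum.lessThan_Suc_shift del: sum.lessThan_Suc)
qed simp

text \<open>
  The outcome of the structure theory: generators \<open>E\<close> of \<open>N\<close> and the basis \<open>X e\<close> of \<open>T\<close> dual to them, with
  \<open>s\<close> bounding the length of nonzero iterated brackets.
\<close>

locale split_solvable = fin_dim_lie_algebra scale bracket
  for scale :: "complex \<Rightarrow> 'n::ab_group_add \<Rightarrow> 'n" (infixr \<open>*\<^sub>N\<close> 75) and bracket +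
  fixes T :: "('n \<Rightarrow> 'n) set" and E :: "'n set" and X :: "'n \<Rightarrow> 'n \<Rightarrow> 'n" and s :: nat
  assumes torus_T: "torus T"
    and finite_E: "finite E" and zero_notin_E: "0 \<notin> E"
    and X_in_T: "e \<in> E \<Longrightarrow> X e \<in> T"
    and X_apply: "e \<in> E \<Longrightarrow> f \<in> E \<Longrightarrow> X e f = (if e = f then f else 0)"
    and T_spanned: "T \<subseteq> endo.span (X ` E)"
    and words_span: "span (iterated_bracket ` words E) = UNIV"
    and words_vanish: "ks \<in> words E \<Longrightarrow> length ks > s \<Longrightarrow> iterated_bracket ks = 0"
    and s_ge_2: "s \<ge> 2"
begin

sublocale CE: lie_module_on sd_scale "semidirect T" sd_bracket sd_scale "semidirect T" sd_bracket
  by (rule lie_algebra_on.adjoint_module[OF lie_algebra_semidirect[OF torus_T]])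

abbreviation emb :: "'n \<Rightarrow> 'n \<times> ('n \<Rightarrow> 'n)" where "emb v \<equiv> (v, 0)"

abbreviation tor :: "'n \<Rightarrow> 'n \<times> ('n \<Rightarrow> 'n)" where "tor e \<equiv> (0, X e)"

lemmas X_linear = torus_linear[OF torus_T X_in_T]

lemma zero_in_T [simp]: "0 \<in> T"
  using torus_T endo.subspace_0 by (auto simp: torus_def)

lemma emb_in [simp]: "emb v \<in> semidirect T"
  by (simp add: semidirect_def)

lemma tor_in [simp]: "e \<in> E \<Longrightarrow> tor e \<in> semidirect T"
  by (simp add: semidirect_def X_in_T)

lemma sd_bracket_tor:
  assumes "e \<in> E" "t \<in> T"
  shows "sd_bracket (tor e) (v, t) = (X e v, 0)"
proof -
  have "(X e \<circ> t) - (t \<circ> X e) = 0"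
    using torus_T X_in_T[OF assms(1)] assms(2) by (simp add: torus_def)
  then show ?thesis
    using torus_linear(4)[OF torus_T assms(2)] by (simp add: sd_bracket_def bracket_linear)
qed

lemma sd_bracket_emb: "sd_bracket (emb u) (emb v) = emb (bracket u v)"
  by (simp add: sd_bracket_def zero_fun_apply zero_fun_def comp_def fun_eq_iff minus_apply)

lemma X_iterated_bracket:
  assumes "e \<in> E" "ks \<in> words E"
  shows "X e (iterated_bracket ks) = of_nat (count_list ks e) *\<^sub>N iterated_bracket ks"
  using assms(2)
proof (induction ks)
  case (Cons f ks)
  show ?case
  proof (cases "ks = []")
    case True
    then show ?thesis using Cons.prems X_apply[OF assms(1), of f] by (auto simp: words_def)
  next
    case False
    then have "X e (iterated_bracket ks) = of_nat (count_list ks e) *\<^sub>N iterated_bracket ks"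
      using Cons by (auto simp: words_def)
    then show ?thesis
      using False Cons.prems X_apply[OF assms(1), of f]
      by (auto simp: words_def iterated_bracket_Cons X_linear[OF assms(1)] bracket_linear
          scale_left_distrib)
  qed
qed (simp add: words_def)

definition has_weight :: "'n \<Rightarrow> ('n \<Rightarrow> complex) \<Rightarrow> bool" where
  "has_weight v \<beta> \<longleftrightarrow> (\<forall>e\<in>E. X e v = \<beta> e *\<^sub>N v)"

text \<open>
  If the weight of \<open>u a\<close> differs from \<open>\<beta>\<close> at \<open>e\<close>, then \<open>X e - w a e\<close> removes \<open>u a\<close> from the sum, multiplies
  \<open>v\<close> by a nonzero scalar and keeps all other weights.
\<close>

lemma weights_independent_sum:
  assumes "finite F" "\<And>a. a \<in> F \<Longrightarrow> has_weight (u a) (w a)" "\<And>a. a \<in> F \<Longrightarrow> \<exists>e\<in>E. w a e \<noteq> \<beta> e"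
    and "has_weight v \<beta>" "v = (\<Sum>a\<in>F. u a)"
  shows "v = 0"
  using assms
proof (induction F arbitrary: u v rule: finite_induct)
  case (insert a F)
  obtain e where e: "e \<in> E" "w a e \<noteq> \<beta> e" using insert.prems(2)[of a] by auto
  have Xu: "X e (u b) = w b e *\<^sub>N u b" if "b \<in> insert a F" for b
    using insert.prems(1)[OF that] e by (simp add: has_weight_def)
  have "(\<beta> e - w a e) *\<^sub>N v = X e v - w a e *\<^sub>N v"
    using insert.prems(3) e by (simp add: has_weight_def scale_left_diff_distrib)
  also have "X e v = w a e *\<^sub>N u a + (\<Sum>b\<in>F. w b e *\<^sub>N u b)"
    using insert.hyps insert.prems(4) Xu by (simp add: X_linear[OF e(1)])
  also have "w a e *\<^sub>N v = w a e *\<^sub>N u a + (\<Sum>b\<in>F. w a e *\<^sub>N u b)"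
    using insert.hyps insert.prems(4) by (simp add: scale_right_distrib scale_sum_right)
  finally have eq: "(\<beta> e - w a e) *\<^sub>N v = (\<Sum>b\<in>F. (w b e - w a e) *\<^sub>N u b)"
    by (simp add: scale_left_diff_distrib sum_subtractf)
  have "(\<beta> e - w a e) *\<^sub>N v = 0"
  proof (rule insert.IH)
    show "has_weight ((w b e - w a e) *\<^sub>N u b) (w b)" if "b \<in> F" for b
      using insert.prems(1)[of b] that by (simp add: has_weight_def X_linear mult.commute)
    show "\<exists>e\<in>E. w b e \<noteq> \<beta> e" if "b \<in> F" for b using insert.prems(2) that by simp
    show "has_weight ((\<beta> e - w a e) *\<^sub>N v) \<beta>"
      using insert.prems(3) by (simp add: has_weight_def X_linear mult.commute)
  qed (rule eq)
  then show ?case using e by simp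
qed simp

lemma weights_independent:
  assumes S: "\<And>a. a \<in> S \<Longrightarrow> \<exists>w. has_weight a w \<and> (\<exists>e\<in>E. w e \<noteq> \<beta> e)"
    and v: "has_weight v \<beta>" "v \<in> span S"
  shows "v = 0"
proof -
  obtain t r where t: "finite t" "t \<subseteq> S" "v = (\<Sum>a\<in>t. r a *\<^sub>N a)"
    using v(2) unfolding span_explicit by blast
  have "\<forall>a. \<exists>w. a \<in> S \<longrightarrow> has_weight a w \<and> (\<exists>e\<in>E. w e \<noteq> \<beta> e)" using S by blast
  then obtain w where w: "\<And>a. a \<in> S \<Longrightarrow> has_weight a (w a)" "\<And>a. a \<in> S \<Longrightarrow> \<exists>e\<in>E. w a e \<noteq> \<beta> e"
    by metis
  show ?thesis
  proof (rule weights_independent_sum[OF t(1) _ _ v(1) t(3)])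
    show "has_weight (r a *\<^sub>N a) (w a)" if "a \<in> t" for a
    proof -
      have "has_weight a (w a)" using w(1) t(2) that by blast
      then show ?thesis by (simp add: has_weight_def X_linear mult.commute)
    qed
    show "\<exists>e\<in>E. w a e \<noteq> \<beta> e" if "a \<in> t" for a using w(2) t(2) that by blast
  qed
qed

lemma word_has_weight: "ks \<in> words E \<Longrightarrow> has_weight (iterated_bracket ks) (\<lambda>e. of_nat (count_list ks e))"
  by (simp add: has_weight_def X_iterated_bracket)

text \<open>
  The nonzero iterated brackets are weight vectors that span \<open>N\<close>; if none of them had the weight \<open>\<beta>\<close>,
  independence of weights would give \<open>v = 0\<close>.
\<close>

lemma weight_is_word_count:
  assumes v: "has_weight v \<beta>" "v \<noteq> 0"
  shows "\<exists>ks\<in>words E. iterated_bracket ks \<noteq> 0 \<and> (\<forall>e\<in>E. of_nat (count_list ks e) = \<beta> e)"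
proof (rule ccontr)
  assume neg: "\<not> ?thesis"
  have "v \<in> span (iterated_bracket ` words E - {0})" using words_span by simp
  then have "v = 0"
  proof (rule weights_independent[OF _ v(1), rotated])
    fix a assume "a \<in> iterated_bracket ` words E - {0}"
    then obtain ks where "ks \<in> words E" "a = iterated_bracket ks" "a \<noteq> 0" by blast
    then show "\<exists>w. has_weight a w \<and> (\<exists>e\<in>E. w e \<noteq> \<beta> e)"
      using neg word_has_weight by (intro exI[of _ "\<lambda>e. of_nat (count_list ks e)"]) auto
  qed
  then show False using v(2) by simp
qed

text \<open>
  Linear forms on \<open>N\<close> that vanish on all weight spaces but that of \<open>\<beta>\<close>.
\<close>

definition weight_form :: "('n \<Rightarrow> complex) \<Rightarrow> ('n \<Rightarrow> complex) \<Rightarrow> bool" where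
  "weight_form \<phi> \<beta> \<longleftrightarrow> Vector_Spaces.linear scale (*) \<phi> \<and> (\<forall>e\<in>E. \<forall>u. \<phi> (X e u) = \<beta> e * \<phi> u)"

lemma weight_form_word:
  assumes "weight_form \<phi> \<beta>" "ks \<in> words E" "e \<in> E" "of_nat (count_list ks e) \<noteq> \<beta> e"
  shows "\<phi> (iterated_bracket ks) = 0"
proof -
  interpret \<phi>: Vector_Spaces.linear scale "(*)" \<phi> using assms(1) by (simp add: weight_form_def)
  have "of_nat (count_list ks e) * \<phi> (iterated_bracket ks) = \<beta> e * \<phi> (iterated_bracket ks)"
    using assms(1,3) X_iterated_bracket[OF assms(3,2)] \<phi>.scale by (metis weight_form_def)
  then show ?thesis using assms(4) by simp
qed

text \<open>
  By independence of weights, \<open>v\<close> lies outside the span of the iterated brackets of other weights, so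
  there is a linear form that is \<open>1\<close> at \<open>v\<close> and \<open>0\<close> on that span.
\<close>

lemma ex_weight_form:
  assumes v: "has_weight v \<beta>" "v \<noteq> 0"
  shows "\<exists>\<phi>. weight_form \<phi> \<beta> \<and> \<phi> v = 1"
proof -
  let ?S = "{iterated_bracket ks | ks. ks \<in> words E \<and> (\<exists>e\<in>E. of_nat (count_list ks e) \<noteq> \<beta> e)}"
  interpret c: vector_space "(*) :: complex \<Rightarrow> complex \<Rightarrow> complex"
    by unfold_locales (auto simp: algebra_simps)
  interpret vp: vector_space_pair scale "(*) :: complex \<Rightarrow> complex \<Rightarrow> complex" ..
  have "\<exists>w. has_weight a w \<and> (\<exists>e\<in>E. w e \<noteq> \<beta> e)" if "a \<in> ?S" for a
    using that word_has_weight by blast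
  then have vS: "v \<notin> span ?S" using weights_independent[of ?S \<beta> v] v by blast
  obtain B where B: "B \<subseteq> ?S" "independent B" "?S \<subseteq> span B"
    using maximal_independent_subset[of ?S] by blast
  have "v \<notin> span B" using vS span_mono[OF B(1)] by blast
  then have "independent (insert v B)" using B(2) by (rule independent_insertI)
  then obtain \<phi> where \<phi>: "Vector_Spaces.linear scale (*) \<phi>"
    "\<forall>x\<in>insert v B. \<phi> x = (if x = v then 1 else 0)"
    using vp.linear_independent_extend[of "insert v B" "\<lambda>x. if x = v then 1 else 0"] by blast
  interpret \<phi>: Vector_Spaces.linear scale "(*)" \<phi> by (rule \<phi>(1))
  have "\<phi> x = 0" if "x \<in> B" for x
    using \<phi>(2) that \<open>v \<notin> span B\<close> span_base by (metis insertCI)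
  then have "\<phi> x = 0" if "x \<in> span B" for x
    using \<phi>.eq_0_on_span that by blast
  then have \<phi>S: "\<phi> x = 0" if "x \<in> ?S" for x using B(3) that by blast
  have "\<phi> (X e u) = \<beta> e * \<phi> u" if e: "e \<in> E" for e u
  proof -
    have "u \<in> span (iterated_bracket ` words E)" using words_span by simp
    then show ?thesis
    proof (induction rule: span_induct_alt)
      case base
      then show ?case by (simp add: X_linear[OF e])
    next
      case (step c x y)
      then obtain ks where ks: "ks \<in> words E" "x = iterated_bracket ks" by blast
      have "\<phi> (X e x) = \<beta> e * \<phi> x"
      proof (cases "of_nat (count_list ks e) = \<beta> e")
        case True
        then show ?thesis using X_iterated_bracket[OF e ks(1)] ks(2) \<phi>.scale by simp
      next
        case False
        then have "\<phi> x = 0" using \<phi>S ks e by blast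
        then show ?thesis using X_iterated_bracket[OF e ks(1)] ks(2) \<phi>.scale by simp
      qed
      then show ?case
        using step.IH
        by (simp only: X_linear[OF e] \<phi>.add \<phi>.scale distrib_left mult.left_commute)
    qed
  qed
  then show ?thesis using \<phi> by (auto simp: weight_form_def)
qed

section \<open>Basic cochains on the semidirect product\<close>

text \<open>
  A spanning set of \<open>N \<rtimes> T\<close> that consists of simultaneous eigenvectors of the \<open>tor e\<close>.
\<close>

definition gens :: "('n \<times> ('n \<Rightarrow> 'n)) set" where
  "gens = (\<lambda>ks. emb (iterated_bracket ks)) ` words E \<union> tor ` E"

lemma gens_subset: "gens \<subseteq> semidirect T"
  by (auto simp: gens_def)

lemma semidirect_spanned: "semidirect T \<subseteq> CE.span gens"
proof
  fix y assume "y \<in> semidirect T"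
  then obtain v t where y: "y = (v, t)" and t: "t \<in> T" by (auto simp: semidirect_def)
  have "v \<in> span (iterated_bracket ` words E)" using words_span by simp
  then have v': "emb v \<in> CE.span gens"
  proof (induction rule: span_induct_alt)
    case base
    have "emb 0 = 0" by (simp add: zero_prod_def)
    then show ?case using CE.span_zero by simp
  next
    case (step c x y)
    then have "emb x \<in> CE.span gens" by (intro CE.span_base) (auto simp: gens_def)
    then have "sd_scale c (emb x) + emb y \<in> CE.span gens"
      using step.IH by (intro CE.span_add CE.span_scale)
    moreover have "sd_scale c (emb x) + emb y = emb (c *\<^sub>N x + y)"
      by (simp add: sd_scale_def)
    ultimately show ?case by simp
  qed
  have "t \<in> endo.span (X ` E)" using T_spanned t by blast
  then have "(0, t) \<in> CE.span gens"
  proof (induction rule: endo.span_induct_alt)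
    case base
    have "(0, 0) = (0 :: 'n \<times> ('n \<Rightarrow> 'n))" by (simp add: zero_prod_def)
    then show ?case using CE.span_zero by simp
  next
    case (step c x y)
    then have "(0, x) \<in> CE.span gens" by (intro CE.span_base) (auto simp: gens_def)
    then have "sd_scale c (0, x) + (0, y) \<in> CE.span gens"
      using step.IH by (intro CE.span_add CE.span_scale)
    moreover have "sd_scale c (0, x) + (0, y) = (0, endo_scale c x + y)"
      by (simp add: sd_scale_def)
    ultimately show ?case by simp
  qed
  then have "emb v + (0, t) \<in> CE.span gens" using v' by (intro CE.span_add)
  then show "y \<in> CE.span gens" by (simp add: y)
qed

lemma tor_bracket_word:
  assumes "e \<in> E" "ks \<in> words E"
  shows "sd_bracket (tor e) (emb (iterated_bracket ks))
    = sd_scale (of_nat (count_list ks e)) (emb (iterated_bracket ks))"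
  using assms by (simp add: sd_bracket_tor X_iterated_bracket sd_scale_def)

lemma tor_bracket_tor:
  assumes "e \<in> E" "f \<in> E"
  shows "sd_bracket (tor e) (tor f) = 0"
  using assms by (simp add: sd_bracket_tor X_in_T X_linear zero_prod_def)

lemma semisimple_tor:
  assumes e: "e \<in> E"
  shows "CE.semisimple (tor e)"
proof -
  let ?\<Lambda> = "of_nat ` {..s} :: complex set"
  let ?V = "{y \<in> semidirect T. \<exists>\<mu>\<in>?\<Lambda>. sd_bracket (tor e) y = sd_scale \<mu> y}"
  have "gens \<subseteq> ?V"
  proof
    fix y assume "y \<in> gens"
    then consider ks where "ks \<in> words E" "y = emb (iterated_bracket ks)" | f where "f \<in> E" "y = tor f"
      by (auto simp: gens_def)
    then show "y \<in> ?V"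
    proof cases
      case 1
      show ?thesis
      proof (cases "length ks > s")
        case True
        then have "y = 0" using 1 words_vanish by (simp add: zero_prod_def)
        moreover have "sd_scale 0 (0 :: 'n \<times> ('n \<Rightarrow> 'n)) = 0" by simp
        moreover have "sd_bracket (tor e) 0 = 0" using e by simp
        moreover have "(0 :: complex) \<in> ?\<Lambda>" by (rule image_eqI[of _ _ 0]) auto
        ultimately show ?thesis by (auto intro!: bexI[of _ "0 :: complex"])
      next
        case False
        then have "count_list ks e \<le> s" using count_le_length[of ks e] by simp
        then show ?thesis using 1 tor_bracket_word[OF e 1(1)] by auto
      qed
    next
      case 2
      have "(0 :: complex) \<in> ?\<Lambda>" by (rule image_eqI[of _ _ 0]) auto
      then show ?thesis using 2 tor_bracket_tor[OF e 2(1)] by (auto intro!: bexI[of _ "0 :: complex"])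
    qed
  qed
  then have "semidirect T \<subseteq> CE.span ?V" using semidirect_spanned CE.span_mono by blast
  then show ?thesis
    using e unfolding CE.semisimple_def by (intro conjI exI[of _ ?\<Lambda>]) simp_all
qed

definition toral_part :: "('n \<times> ('n \<Rightarrow> 'n)) set" where
  "toral_part = tor ` E"

lemma toral_part_subset: "toral_part \<subseteq> semidirect T"
  by (auto simp: toral_part_def)

lemma generator_has_weight: "e \<in> E \<Longrightarrow> has_weight e (\<lambda>f. of_nat (count_list [e] f))"
  using word_has_weight[of "[e]"] by (simp add: words_def)

text \<open>
  The coordinate of a torus element at \<open>tor e\<close> is its eigenvalue on \<open>e\<close>; a linear form with value \<open>1\<close> at
  \<open>e\<close> reads it off.
\<close>

lemma split_toral_toral_part: "CE.split_toral toral_part"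
  unfolding CE.split_toral_def
proof (intro conjI ballI)
  show "finite toral_part" using finite_E by (simp add: toral_part_def)
  fix x assume "x \<in> toral_part"
  then obtain e where e: "e \<in> E" and x: "x = tor e" by (auto simp: toral_part_def)
  show "CE.semisimple x" using semisimple_tor e x by simp
  show "sd_bracket x y = 0" if "y \<in> toral_part" for y
    using that tor_bracket_tor e x by (auto simp: toral_part_def)
  have "e \<noteq> 0" using e zero_notin_E by auto
  then obtain \<phi> where "weight_form \<phi> (\<lambda>f. of_nat (count_list [e] f))" and \<phi>e: "\<phi> e = 1"
    using ex_weight_form[OF generator_has_weight[OF e]] by blast
  then interpret \<phi>: Vector_Spaces.linear scale "(*)" \<phi> by (simp add: weight_form_def)
  let ?\<xi> = "\<lambda>y. \<phi> (snd y e)"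
  have "CE.functional ?\<xi>"
    by (auto simp: CE.functional_def \<phi>.add \<phi>.scale sd_scale_def endo_scale_def plus_fun_apply
        snd_add split: prod.splits)
  moreover have "?\<xi> (sd_bracket a b) = 0" if "a \<in> semidirect T" "b \<in> semidirect T" for a b
  proof -
    obtain u t v r where ab: "a = (u, t)" "b = (v, r)" by (metis surj_pair)
    have "(t \<circ> r) - (r \<circ> t) = 0" using that ab torus_T by (simp add: semidirect_def torus_def)
    then show ?thesis using ab by (simp add: sd_bracket_def \<phi>.zero zero_fun_apply)
  qed
  moreover have "?\<xi> x = 1" using x X_apply[OF e e] \<phi>e by simp
  moreover have "?\<xi> y = 0" if "y \<in> toral_part" "y \<noteq> x" for y
  proof -
    obtain f where f: "f \<in> E" "y = tor f" "f \<noteq> e" using \<open>y \<in> toral_part\<close> \<open>y \<noteq> x\<close> x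
      by (auto simp: toral_part_def)
    then show ?thesis using X_apply[OF f(1) e] by (simp add: \<phi>.zero)
  qed
  ultimately show "\<exists>\<xi>. CE.functional \<xi> \<and>
      (\<forall>a\<in>semidirect T. \<forall>b\<in>semidirect T. \<xi> (sd_bracket a b) = 0) \<and>
      \<xi> x = 1 \<and> (\<forall>y\<in>toral_part. y \<noteq> x \<longrightarrow> \<xi> y = 0)"
    by (intro exI[of _ ?\<xi>]) blast
qed

abbreviation embw :: "'n list list \<Rightarrow> ('n \<times> ('n \<Rightarrow> 'n)) list" where
  "embw kss \<equiv> map (\<lambda>ks. emb (iterated_bracket ks)) kss"

text \<open>
  Evaluate \<open>theta (tor e) f = 0\<close> on eigenvectors. As \<open>T\<close> is abelian, the part of the value in \<open>T\<close> has
  weight \<open>0\<close>, so it vanishes as soon as a generator occurs among the arguments.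
\<close>

lemma basic_value_weight:
  assumes f: "f \<in> CE.basic toral_part n" and kss: "kss \<in> lists (words E)" "length kss = n"
    and vt: "f (embw kss) = (v, t)"
  shows "has_weight v (\<lambda>e. of_nat (count_list (concat kss) e))"
    and "e \<in> E \<Longrightarrow> e \<in> set (concat kss) \<Longrightarrow> t = 0"
proof -
  have fC: "f \<in> CE.cochains n" using f by (rule CE.basicD)
  have tup: "embw kss \<in> CE.tuples n" using kss(2) by (auto simp: CE.tuples_def)
  have eq: "X e v = of_nat (count_list (concat kss) e) *\<^sub>N v \<and>
      endo_scale (of_nat (count_list (concat kss) e)) t = 0" if e: "e \<in> E" for e
  proof -
    let ?c = "of_nat (count_list (concat kss) e) :: complex"
    have "t \<in> T"
      using CE.cochainsD(1)[OF fC tup] vt by (simp add: semidirect_def)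
    have "0 = CE.theta (tor e) f (embw kss)"
      using CE.basicD(2)[OF f, of "tor e"] e by (simp add: toral_part_def zero_fun_apply)
    also have "\<dots> = sd_bracket (tor e) (f (embw kss))
        - sd_scale (\<Sum>j<n. of_nat (count_list (kss ! j) e)) (f (embw kss))"
    proof (rule CE.theta_on_eigenvectors[OF fC tup tor_in[OF e]])
      fix j assume "j < n"
      then have "kss ! j \<in> words E" "embw kss ! j = emb (iterated_bracket (kss ! j))"
        using kss by (auto simp: in_lists_conv_set)
      then show "sd_bracket (tor e) (embw kss ! j)
          = sd_scale (of_nat (count_list (kss ! j) e)) (embw kss ! j)"
        using tor_bracket_word[OF e] by simp
    qed
    also have "(\<Sum>j<n. of_nat (count_list (kss ! j) e)) = ?c"
      using sum_count_list_concat[of kss e] kss(2) by simp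
    also have "sd_bracket (tor e) (f (embw kss)) = (X e v, 0)"
      using sd_bracket_tor[OF e \<open>t \<in> T\<close>] vt by simp
    finally have "(X e v, 0) = sd_scale ?c (v, t)" using vt by simp
    then show ?thesis by (simp add: sd_scale_def)
  qed
  then show "has_weight v (\<lambda>e. of_nat (count_list (concat kss) e))" by (simp add: has_weight_def)
  assume e: "e \<in> E" and "e \<in> set (concat kss)"
  then have "of_nat (count_list (concat kss) e) \<noteq> (0 :: complex)"
    by (simp add: count_list_0_iff)
  then show "t = 0" using eq[OF e] by (simp add: endo.scale_eq_0_iff)
qed

text \<open>
  A nonzero value forces its weight, hence the total length of the argument words, to occur in \<open>N\<close>.
\<close>

lemma basic_value_nonzero:
  assumes f: "f \<in> CE.basic toral_part n" and kss: "kss \<in> lists (words E)" "length kss = n" and n: "n > 0"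
    and nz: "f (embw kss) \<noteq> 0"
  shows "snd (f (embw kss)) = 0"
    and "\<exists>ks\<in>words E. iterated_bracket ks \<noteq> 0 \<and> mset ks = mset (concat kss)"
    and "length (concat kss) \<le> s"
proof -
  obtain v t where vt: "f (embw kss) = (v, t)" by (metis surj_pair)
  note W = basic_value_weight[OF f kss vt]
  have sub: "set (concat kss) \<subseteq> E" using kss(1) by (auto simp: words_def)
  obtain ks kss' where "kss = ks # kss'" "ks \<in> words E" using kss n by (cases kss) auto
  then obtain e where "e \<in> set (concat kss)" by (cases ks) (auto simp: words_def)
  then have t: "t = 0" using W(2)[of e] sub by blast
  then show "snd (f (embw kss)) = 0" using vt by simp
  have "v \<noteq> 0" using nz vt t by (simp add: zero_prod_def)
  then obtain ks where ks: "ks \<in> words E" "iterated_bracket ks \<noteq> 0"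
    and c: "\<And>e. e \<in> E \<Longrightarrow> count_list ks e = count_list (concat kss) e"
    using weight_is_word_count[OF W(1)] by auto
  have "count_list ks e = count_list (concat kss) e" for e
  proof (cases "e \<in> E")
    case False
    then have "e \<notin> set ks" "e \<notin> set (concat kss)" using ks(1) sub by (auto simp: words_def)
    then show ?thesis by (metis count_list_0_iff)
  qed (rule c)
  then have m: "mset ks = mset (concat kss)"
    by (intro multiset_eqI) (simp add: count_mset)
  then show "\<exists>ks\<in>words E. iterated_bracket ks \<noteq> 0 \<and> mset ks = mset (concat kss)" using ks by blast
  have "length ks \<le> s" using words_vanish[OF ks(1)] ks(2) by (meson not_le)
  then show "length (concat kss) \<le> s" using m by (metis size_mset)
qed

text \<open>
  Arguments in \<open>T\<close> give \<open>0\<close>, so only iterated brackets have to be tested.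
\<close>

lemma basic_eqI:
  assumes f: "f \<in> CE.basic toral_part n"
    and z: "\<And>kss. kss \<in> lists (words E) \<Longrightarrow> length kss = n \<Longrightarrow> f (embw kss) = 0"
  shows "f = 0"
proof (rule CE.cochain_eqI_on_span[OF gens_subset semidirect_spanned])
  show fC: "f \<in> CE.cochains n" using f by (rule CE.basicD)
  fix ys assume ys: "ys \<in> lists gens" "length ys = n"
  show "f ys = 0"
  proof (cases "set ys \<inter> tor ` E = {}")
    case True
    then have "ys \<in> lists ((\<lambda>ks. emb (iterated_bracket ks)) ` words E)"
      using ys(1) by (auto simp: gens_def in_lists_conv_set)
    then obtain kss where "kss \<in> lists (words E)" "ys = embw kss"
      unfolding lists_image by blast
    then show ?thesis using z ys(2) by simp
  next
    case False
    then obtain e where e: "e \<in> E" "tor e \<in> set ys" by blast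
    then show ?thesis
      using CE.cochain_eq_0_if_contract_eq_0[OF tor_in fC] CE.basicD(3)[OF f, of "tor e"]
      by (simp add: toral_part_def)
  qed
qed

lemma length_le_length_concat:
  "kss \<in> lists (words E) \<Longrightarrow> length kss \<le> length (concat kss)"
proof (induction kss)
  case (Cons ks kss)
  then have "length ks \<ge> 1" by (cases ks) (auto simp: words_def)
  then show ?case using Cons by simp
qed simp

lemma exact_above:
  assumes n: "n > s"
  shows "CE.exact_at toral_part n"
proof -
  have "f = 0" if f: "f \<in> CE.basic toral_part n" for f
  proof (rule basic_eqI[OF f], rule ccontr)
    fix kss assume kss: "kss \<in> lists (words E)" "length kss = n" and nz: "f (embw kss) \<noteq> 0"
    have "length (concat kss) \<le> s" using basic_value_nonzero(3)[OF f kss _ nz] n by simp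
    then show False using length_le_length_concat[OF kss(1)] kss(2) n by simp
  qed
  moreover have "0 \<in> CE.basic toral_part m" for m
    by (rule CE.basic_closed[OF toral_part_subset])
  ultimately show ?thesis
    unfolding CE.exact_at_def by (cases n) (auto intro!: bexI[of _ 0])
qed

section \<open>Exactness in the top degree\<close>

lemma functional_of_weight_form:
  assumes "weight_form \<phi> \<beta>"
  shows "CE.functional (\<lambda>y. \<phi> (fst y))"
proof -
  interpret \<phi>: Vector_Spaces.linear scale "(*)" \<phi> using assms by (simp add: weight_form_def)
  show ?thesis
    by (auto simp: CE.functional_def \<phi>.add \<phi>.scale sd_scale_def split: prod.splits)
qed

lemma weight_form_zero:
  assumes "weight_form \<phi> \<beta>"
  shows "\<phi> 0 = 0"
proof -
  interpret \<phi>: Vector_Spaces.linear scale "(*)" \<phi> using assms by (simp add: weight_form_def)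
  show ?thesis by (rule \<phi>.zero)
qed

lemma weight_form_tor:
  assumes "weight_form \<phi> \<beta>" "e \<in> E" "y \<in> semidirect T"
  shows "\<phi> (fst (sd_bracket (tor e) y)) = \<beta> e * \<phi> (fst y)"
proof -
  obtain u t where y: "y = (u, t)" "t \<in> T" using assms(3) by (auto simp: semidirect_def)
  then show ?thesis using assms(1,2) sd_bracket_tor[OF assms(2) y(2), of u] by (simp add: weight_form_def)
qed

definition coordinate_form :: "'n \<Rightarrow> 'n \<Rightarrow> complex" where
  "coordinate_form j = (SOME \<phi>. weight_form \<phi> (\<lambda>f. of_nat (count_list [j] f)) \<and> \<phi> j = 1)"

lemma coordinate_form:
  assumes "j \<in> E"
  shows "weight_form (coordinate_form j) (\<lambda>f. of_nat (count_list [j] f))"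
    and "e \<in> E \<Longrightarrow> coordinate_form j e = (if e = j then 1 else 0)"
proof -
  have "j \<noteq> 0" using assms zero_notin_E by auto
  from someI_ex[OF ex_weight_form[OF generator_has_weight[OF assms] this]]
  have *: "weight_form (coordinate_form j) (\<lambda>f. of_nat (count_list [j] f))" "coordinate_form j j = 1"
    unfolding coordinate_form_def by blast+
  show "weight_form (coordinate_form j) (\<lambda>f. of_nat (count_list [j] f))" by (rule *)
  show "coordinate_form j e = (if e = j then 1 else 0)" if "e \<in> E"
    using *(2) weight_form_word[OF *(1), of "[e]" e] that by (auto simp: words_def)
qed

text \<open>
  \<open>\<epsilon>\<^sub>1 \<and> \<dots> \<and> \<epsilon>\<^sub>k \<otimes> c\<close> for the coordinate forms of the generators in \<open>js\<close>.
\<close>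

fun monomial :: "'n list \<Rightarrow> 'n \<times> ('n \<Rightarrow> 'n) \<Rightarrow> ('n \<times> ('n \<Rightarrow> 'n)) list \<Rightarrow> 'n \<times> ('n \<Rightarrow> 'n)" where
  "monomial [] c = (\<lambda>xs. if xs = [] then c else 0)"
| "monomial (j # js) c = CE.wedge (\<lambda>y. coordinate_form j (fst y)) (monomial js c)"

lemma monomial_closed:
  assumes "js \<in> lists E" "c \<in> semidirect T"
  shows "monomial js c \<in> CE.cochains (length js)"
  using assms(1)
proof (induction js)
  case Nil
  then show ?case using assms(2) by (auto simp: CE.cochains_0_iff)
next
  case (Cons j js)
  then show ?case using CE.wedge_closed[OF functional_of_weight_form[OF coordinate_form(1)]] by auto
qed

lemma monomial_theta:
  assumes "js \<in> lists E" "c \<in> semidirect T" "e \<in> E" "sd_bracket (tor e) c = sd_scale \<mu> c"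
  shows "CE.theta (tor e) (monomial js c)
    = CE.cscale (\<mu> - of_nat (count_list js e)) (monomial js c)"
  using assms(1)
proof (induction js)
  case Nil
  have m: "monomial [] c \<in> CE.cochains 0" using monomial_closed[of "[]"] assms(2) by simp
  show ?case
  proof (rule CE.cochains_0_eqI)
    show "CE.theta (tor e) (monomial [] c) \<in> CE.cochains 0"
      by (rule CE.theta_closed[OF tor_in[OF assms(3)] m])
    show "CE.cscale (\<mu> - of_nat (count_list [] e)) (monomial [] c) \<in> CE.cochains 0"
      by (rule CE.cochains_closed(5)[OF m])
  qed (simp add: assms(4) CE.cscale_apply)
next
  case (Cons j js)
  then have j: "j \<in> E" and js: "js \<in> lists E" by auto
  note w = coordinate_form(1)[OF j]
  have "CE.theta (tor e) (monomial (j # js) c)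
      = CE.wedge (\<lambda>y. coordinate_form j (fst y)) (CE.theta (tor e) (monomial js c))
        - CE.cscale (of_nat (count_list [j] e)) (monomial (j # js) c)"
    using CE.theta_wedge[OF functional_of_weight_form[OF w] tor_in[OF assms(3)] weight_form_tor[OF w assms(3)]
        monomial_closed[OF js assms(2)]] by simp
  also have "\<dots> = CE.cscale (\<mu> - of_nat (count_list js e) - of_nat (count_list [j] e))
      (monomial (j # js) c)"
    by (simp only: Cons.IH CE.wedge_scale CE.wedge_diff CE.fn.scale_left_diff_distrib monomial.simps)
  also have "\<mu> - of_nat (count_list js e) - of_nat (count_list [j] e)
      = \<mu> - of_nat (count_list (j # js) e)" by simp
  finally show ?case .
qed

lemma monomial_contract:
  assumes "js \<in> lists E" "e \<in> E"
  shows "CE.contract (tor e) (monomial js c) = 0"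
  using assms(1)
proof (induction js)
  case Nil
  then show ?case by (simp add: CE.contract_def zero_fun_def)
next
  case (Cons j js)
  then show ?case
    using assms(2) weight_form_zero[OF coordinate_form(1), of j] by (simp add: CE.contract_wedge)
qed

lemma monomial_values: "monomial js c ys \<in> CE.span {c}"
proof (induction js arbitrary: ys)
  case Nil
  then show ?case by (simp add: CE.span_zero CE.span_base)
next
  case (Cons j js)
  then show ?case by (simp add: CE.wedge_values CE.subspace_span)
qed

lemma monomial_eval:
  assumes "js \<in> lists E" "distinct js"
  shows "monomial js c (map emb js) = c"
  using assms
proof (induction js)
  case (Cons j js)
  then have j: "j \<in> E" by simp
  have zero: "coordinate_form j (fst y) = 0" if y: "y \<in> set (map emb js)" for y
  proof -
    obtain e where "e \<in> set js" "y = emb e" using y by auto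
    then show ?thesis using coordinate_form(2)[OF j, of e] Cons.prems Cons.hyps by auto
  qed
  have "CE.wedge (\<lambda>y. coordinate_form j (fst y)) h (map emb js) = 0" for h
    by (rule CE.wedge_eq_0) (rule zero)
  then show ?case using Cons coordinate_form(2)[OF j j] by simp
qed simp

lemma embw_singletons: "embw (map (\<lambda>e. [e]) es) = map emb es" "concat (map (\<lambda>e. [e]) es) = es"
  by (induction es) auto

lemma singletons_words: "es \<in> lists E \<Longrightarrow> map (\<lambda>e. [e]) es \<in> lists (words E)"
  by (auto simp: words_def)

lemma basic_value_on_generators:
  assumes f: "f \<in> CE.basic toral_part n" and es: "es \<in> lists E" "length es = n"
  shows "f (map emb es) = (v, t) \<Longrightarrow> has_weight v (\<lambda>e. of_nat (count_list es e))"
    and "n > 0 \<Longrightarrow> f (map emb es) \<noteq> 0 \<Longrightarrow> snd (f (map emb es)) = 0"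
    and "n > 0 \<Longrightarrow> f (map emb es) \<noteq> 0 \<Longrightarrow>
      \<exists>ks\<in>words E. iterated_bracket ks \<noteq> 0 \<and> mset ks = mset es"
  using basic_value_weight(1)[OF f singletons_words[OF es(1)], unfolded embw_singletons length_map, OF es(2)]
    basic_value_nonzero(1,2)[OF f singletons_words[OF es(1)], unfolded embw_singletons length_map, OF es(2)]
  by blast+

text \<open>
  On generators only the bracket terms of the coboundary of \<open>wedge \<phi> (monomial js c)\<close> survive,
  because \<open>\<phi>\<close> kills all generators; each of them pairs \<open>\<phi>\<close> with a bracket of two generators.
\<close>

lemma ce_d_on_generators:
  assumes g: "g \<in> CE.cochains (Suc m)" and z: "\<And>ys. ys \<in> lists (emb ` E) \<Longrightarrow> g ys = 0"
    and bs: "bs \<in> lists E" "length bs = Suc (Suc m)"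
  shows "CE.ce_d g (map emb bs) = (\<Sum>j\<le>Suc m. \<Sum>i<j. sd_scale ((- 1) ^ (i + j))
    (g (emb (bracket (bs ! i) (bs ! j)) # nths (map emb bs) (- {i, j}))))"
proof -
  have tup: "map emb bs \<in> CE.tuples (Suc (Suc m))" using bs(2) by (auto simp: CE.tuples_def)
  have "g (nths (map emb bs) (- {i})) = 0" for i
  proof (rule z)
    have "set (nths (map emb bs) (- {i})) \<subseteq> set (map emb bs)" by (rule set_nths_subset)
    then show "nths (map emb bs) (- {i}) \<in> lists (emb ` E)" using bs(1) by auto
  qed
  moreover have "sd_bracket (map emb bs ! i) (map emb bs ! j) = emb (bracket (bs ! i) (bs ! j))"
    if "j \<le> Suc m" "i < j" for i j
    using that bs(2) sd_bracket_emb by simp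
  moreover have "map emb bs ! i \<in> semidirect T" if "i \<le> Suc m" for i
    using that bs(2) by simp
  ultimately show ?thesis
    unfolding CE.differential_eq_ce_d[OF g, symmetric] CE.differential_def using tup
    by (simp cong: sum.cong_simp)
qed

text \<open>
  The tuple \<open>es'\<close> is the rearrangement of \<open>es\<close> that begins with the two innermost letters \<open>p, q\<close> of a
  nonvanishing iterated bracket; \<open>g = \<phi> \<and> monomial as c\<close> for the remaining letters \<open>as\<close>, where \<open>\<phi>\<close> is
  dual to \<open>[p, q]\<close> and \<open>c\<close> is the value of \<open>f\<close> on \<open>es'\<close>. The values of \<open>d g\<close> on generators are multiples
  of \<open>c\<close> and have the weight of the arguments, so they vanish unless the arguments rearrange \<open>es\<close>.
\<close>

lemma cancel_top_value:
  assumes f: "f \<in> CE.basic toral_part s" and es: "es \<in> lists E" "length es = s"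
    and nz: "f (map emb es) \<noteq> 0"
  shows "\<exists>g\<in>CE.basic toral_part (s - 1). \<exists>es'. es' \<in> lists E \<and> mset es' = mset es \<and>
    f (map emb es') \<noteq> 0 \<and> f (map emb es') + CE.ce_d g (map emb es') = 0 \<and>
    (\<forall>bs\<in>lists E. length bs = s \<longrightarrow> mset bs \<noteq> mset es \<longrightarrow> CE.ce_d g (map emb bs) = 0)"
proof -
  have fC: "f \<in> CE.cochains s" using f by (rule CE.basicD)
  have s0: "s > 0" using s_ge_2 by simp
  obtain ks where ks: "ks \<in> words E" "iterated_bracket ks \<noteq> 0" "mset ks = mset es"
    using basic_value_on_generators(3)[OF f es s0 nz] by blast
  have lks: "length ks = s" using ks(3) es(2) by (metis size_mset)
  obtain as0 q where as0: "ks = as0 @ [q]" using ks(1) by (cases ks rule: rev_cases) (auto simp: words_def)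
  obtain as p where as: "as0 = as @ [p]" using as0 lks s_ge_2 by (cases as0 rule: rev_cases) auto
  have ks_eq: "ks = as @ [p, q]" using as0 as by simp
  let ?es = "p # q # as"
  define m where "m = length as"
  have sm: "s = Suc (Suc m)" using lks ks_eq by (simp add: m_def)
  have mes: "mset ?es = mset es" using ks(3) ks_eq by simp
  have EE: "?es \<in> lists E" using ks(1) ks_eq by (auto simp: words_def)
  then have pE: "p \<in> E" and qE: "q \<in> E" and asE: "as \<in> lists E" by auto
  have les: "length ?es = s" using sm by (simp add: m_def)
  have embL: "set (map emb bs) \<subseteq> semidirect T" for bs by auto
  have "mset (map emb ?es) = mset (map emb es)" unfolding mset_map mes ..
  then have nz': "f (map emb ?es) \<noteq> 0"
    using CE.cochain_eq_0_mset[OF fC embL] nz by blast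
  have dist: "distinct ?es"
    using CE.distinct_if_cochain_nonzero[OF fC nz'] unfolding distinct_map by blast
  define c where "c = f (map emb ?es)"
  obtain v where c: "c = emb v"
    using basic_value_on_generators(2)[OF f EE les s0 nz'] unfolding c_def by (metis prod.collapse)
  have cT: "c \<in> semidirect T" using c by simp
  have v: "has_weight v (\<lambda>e. of_nat (count_list ?es e))"
    using basic_value_on_generators(1)[OF f EE les] c unfolding c_def by blast
  have cw: "sd_bracket (tor e) c = sd_scale (of_nat (count_list ?es e)) c" if "e \<in> E" for e
    using that v c by (simp add: sd_bracket_tor has_weight_def sd_scale_def)
  have pq: "[p, q] \<in> words E" using pE qE by (auto simp: words_def)
  have "bracket p q \<noteq> 0" using iterated_bracket_last_two ks(2) ks_eq by simp
  then obtain \<phi> where \<phi>: "weight_form \<phi> (\<lambda>e. of_nat (count_list [p, q] e))" and \<phi>1: "\<phi> (bracket p q) = 1"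
    using ex_weight_form[OF word_has_weight[OF pq]] by auto
  have \<phi>E: "\<phi> e = 0" if e: "e \<in> E" for e
  proof -
    obtain x where x: "x \<in> E" "count_list [e] x \<noteq> count_list [p, q] x"
    proof (cases "e = p")
      case True
      then show ?thesis using that[of q] qE dist by auto
    next
      case False
      then show ?thesis using that[of p] pE dist by auto
    qed
    have "[e] \<in> words E" using e by (auto simp: words_def)
    moreover have "of_nat (count_list [e] x) \<noteq> (of_nat (count_list [p, q] x) :: complex)"
      using x(2) by (simp only: of_nat_eq_iff) simp
    ultimately have "\<phi> (iterated_bracket [e]) = 0" using weight_form_word[OF \<phi> _ x(1)] by blast
    then show ?thesis by simp
  qed
  let ?\<phi> = "\<lambda>y :: 'n \<times> ('n \<Rightarrow> 'n). \<phi> (fst y)"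
  define g where "g = CE.wedge ?\<phi> (monomial as c)"
  note fun\<phi> = functional_of_weight_form[OF \<phi>]
  have mC: "monomial as c \<in> CE.cochains m" using monomial_closed[OF asE cT] by (simp add: m_def)
  have gC: "g \<in> CE.cochains (Suc m)" unfolding g_def by (rule CE.wedge_closed[OF fun\<phi> mC])
  have g_basic: "g \<in> CE.basic toral_part (Suc m)"
  proof -
    have "CE.theta (tor e) g = 0 \<and> CE.contract (tor e) g = 0" if e: "e \<in> E" for e
    proof
      have "CE.theta (tor e) g = CE.wedge ?\<phi> (CE.theta (tor e) (monomial as c))
          - CE.cscale (of_nat (count_list [p, q] e)) g"
        using CE.theta_wedge[OF fun\<phi> tor_in[OF e] weight_form_tor[OF \<phi> e] mC] by (simp add: g_def)
      also have "\<dots> = CE.cscale (of_nat (count_list ?es e) - of_nat (count_list as e)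
          - of_nat (count_list [p, q] e)) g"
        by (simp only: monomial_theta[OF asE cT e cw[OF e]] CE.wedge_scale CE.wedge_diff
            CE.fn.scale_left_diff_distrib g_def)
      also have "of_nat (count_list ?es e) - of_nat (count_list as e) - of_nat (count_list [p, q] e)
          = (0 :: complex)" by simp
      finally show "CE.theta (tor e) g = 0" by simp
      show "CE.contract (tor e) g = 0"
        using e weight_form_zero[OF \<phi>] monomial_contract[OF asE e] by (simp add: g_def CE.contract_wedge)
    qed
    then show ?thesis using gC by (auto simp: CE.basic_def toral_part_def)
  qed
  have g0: "g ys = 0" if "ys \<in> lists (emb ` E)" for ys
    unfolding g_def using that \<phi>E by (intro CE.wedge_eq_0) (auto simp: in_lists_conv_set)
  have gspan: "g ys \<in> CE.span {c}" for ys
    unfolding g_def by (intro CE.wedge_values CE.subspace_span monomial_values)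
  have bracket_term: "g (emb u # map emb bs) = sd_scale (\<phi> u) (monomial as c (map emb bs))"
    if "bs \<in> lists E" for u bs
  proof -
    have "CE.wedge ?\<phi> h (map emb bs) = 0" for h
      using that \<phi>E by (intro CE.wedge_eq_0) auto
    then show ?thesis by (simp add: g_def)
  qed
  have top: "CE.ce_d g (map emb ?es) = - c"
  proof -
    let ?t = "\<lambda>j i. sd_scale ((- 1) ^ (i + j))
      (g (emb (bracket (?es ! i) (?es ! j)) # nths (map emb ?es) (- {i, j})))"
    \<comment> \<open>The arguments are distinct, so no pair but the first two has the weight of \<open>[p, q]\<close>.\<close>
    have t0: "?t j i = 0" if "j \<ge> 2" "j \<le> Suc m" "i < j" for i j
    proof -
      have jl: "j < length ?es" "i < length ?es" using that les sm by auto
      have in_E: "?es ! i \<in> E" "?es ! j \<in> E"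
        using EE nth_mem[OF jl(1)] nth_mem[OF jl(2)] by (auto simp del: nth_mem)
      have "?es ! j \<noteq> ?es ! 0" "?es ! j \<noteq> ?es ! 1"
        using nth_eq_iff_index_eq[OF dist jl(1)] that(1) jl by force+
      then have "count_list [?es ! i, ?es ! j] (?es ! j) \<noteq> count_list [p, q] (?es ! j)"
        by auto
      then have "\<phi> (bracket (?es ! i) (?es ! j)) = 0"
        using weight_form_word[OF \<phi>, of "[?es ! i, ?es ! j]" "?es ! j"] in_E by (simp add: words_def)
      moreover have "nths (map emb ?es) (- {i, j}) = map emb (nths ?es (- {i, j}))"
        by (rule nths_map)
      moreover have "nths ?es (- {i, j}) \<in> lists E"
        using EE set_nths_subset[of ?es "- {i, j}"] by (auto simp: in_lists_conv_set)
      ultimately show ?thesis using bracket_term by simp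
    qed
    have "nths (map emb ?es) (- {0, 1}) = map emb as"
    proof -
      have "nths (emb p # map emb (q # as)) (- {0, Suc 0}) = nths (map emb (q # as)) (- {0})"
        by (rule nths_Cons_compl)
      also have "\<dots> = map emb as" by simp
      finally show ?thesis by simp
    qed
    then have t1: "?t 1 0 = - c"
      using bracket_term[OF asE, of "bracket p q"] \<phi>1 monomial_eval[OF asE, of c] dist by simp
    have "CE.ce_d g (map emb ?es) = (\<Sum>j\<le>Suc m. \<Sum>i<j. ?t j i)"
      using ce_d_on_generators[OF gC g0 EE] les sm by simp
    also have "\<dots> = (\<Sum>j\<le>Suc m. if j = 1 then - c else 0)"
    proof (rule sum.cong[OF refl])
      fix j assume j: "j \<in> {..Suc m}"
      consider "j = 0" | "j = 1" | "j \<ge> 2" by linarith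
      then show "(\<Sum>i<j. ?t j i) = (if j = 1 then - c else 0)"
      proof cases
        case 2
        then show ?thesis using t1 by simp
      next
        case 3
        then have "(\<Sum>i<j. ?t j i) = 0" using t0 j by (intro sum.neutral) auto
        then show ?thesis using 3 by simp
      qed simp
    qed
    also have "\<dots> = - c" by simp
    finally show ?thesis .
  qed
  have dg_basic: "CE.ce_d g \<in> CE.basic toral_part s"
    unfolding sm by (rule CE.basic_ce_d[OF toral_part_subset g_basic])
  have other: "CE.ce_d g (map emb bs) = 0"
    if bs: "bs \<in> lists E" "length bs = s" "mset bs \<noteq> mset es" for bs
  proof (rule ccontr)
    assume ne: "CE.ce_d g (map emb bs) \<noteq> 0"
    have "CE.ce_d g (map emb bs) \<in> CE.span {c}"
      using ce_d_on_generators[OF gC g0 bs(1)] bs(2) sm gspan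
      by (simp only:) (intro CE.span_sum CE.span_scale)
    then obtain a where a: "CE.ce_d g (map emb bs) = emb (a *\<^sub>N v)"
      using c by (auto simp: CE.span_singleton sd_scale_def)
    have w: "has_weight (a *\<^sub>N v) (\<lambda>e. of_nat (count_list bs e))"
      by (rule basic_value_on_generators(1)[OF dg_basic bs(1,2) a])
    obtain e where e: "count_list bs e \<noteq> count_list ?es e"
      using bs(3) mes by (metis count_mset multiset_eqI)
    then have "e \<in> set bs \<or> e \<in> set ?es" by (metis count_list_0_iff)
    then have eE: "e \<in> E" using bs(1) EE by auto
    have "of_nat (count_list bs e) *\<^sub>N (a *\<^sub>N v) = X e (a *\<^sub>N v)"
      using w eE by (simp add: has_weight_def)
    also have "\<dots> = of_nat (count_list ?es e) *\<^sub>N (a *\<^sub>N v)"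
      using v eE by (simp add: has_weight_def X_linear[OF eE] mult.commute)
    finally have "a *\<^sub>N v = 0"
      using e by (metis of_nat_eq_iff scale_cancel_right)
    then show False using ne a by (simp add: zero_prod_def)
  qed
  have "s - 1 = Suc m" using sm by simp
  then show ?thesis
    using g_basic EE mes nz' top other by (intro bexI[of _ g] exI[of _ ?es]) (auto simp: c_def)
qed

text \<open>
  Induction on the number of tuples of generators on which \<open>f\<close> does not vanish. If there is none, then
  \<open>f = 0\<close>: a nonzero value on \<open>s\<close> words forces total length at most \<open>s\<close>, so that all words are single
  generators.
\<close>

lemma exact_top: "CE.exact_at toral_part s"
proof -
  let ?supp = "\<lambda>f. {es \<in> lists E. length es = s \<and> f (map emb es) \<noteq> (0 :: 'n \<times> ('n \<Rightarrow> 'n))}"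
  have "finite {es. set es \<subseteq> E \<and> length es = s}" by (rule finite_lists_length_eq[OF finite_E])
  then have fin: "finite (?supp f)" for f by (rule rev_finite_subset) auto
  note closed = CE.basic_closed[OF toral_part_subset]
  have "\<exists>g\<in>CE.basic toral_part (s - 1). f = CE.ce_d g" if "f \<in> CE.basic toral_part s" for f
    using that
  proof (induction "card (?supp f)" arbitrary: f rule: less_induct)
    case less
    note f = less.prems
    show ?case
    proof (cases "?supp f = {}")
      case True
      have "f = 0"
      proof (rule basic_eqI[OF f], rule ccontr)
        fix kss assume kss: "kss \<in> lists (words E)" "length kss = s" and nz: "f (embw kss) \<noteq> 0"
        have "length (concat kss) \<le> length kss"
          using basic_value_nonzero(3)[OF f kss _ nz] kss s_ge_2 by simp
        then have "\<exists>es. kss = map (\<lambda>e. [e]) es"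
          using kss(1)
        proof (induction kss)
          case (Cons ks kss)
          have "length kss \<le> length (concat kss)" using length_le_length_concat Cons.prems by simp
          moreover have "ks \<noteq> []" using Cons.prems by (auto simp: words_def)
          then have "length ks \<ge> 1" by (cases ks) auto
          ultimately have l: "length ks = 1" "length (concat kss) \<le> length kss"
            using Cons.prems by auto
          then obtain es e where "kss = map (\<lambda>e. [e]) es" "ks = [e]"
            using Cons by (auto simp: length_Suc_conv)
          then show ?case by (intro exI[of _ "e # es"]) simp
        qed simp
        then obtain es where es: "kss = map (\<lambda>e. [e]) es" by blast
        have "f (map emb es) \<noteq> 0" using nz unfolding es embw_singletons .
        moreover have "es \<in> lists E" "length es = s"
          using kss unfolding es by (auto simp: words_def)
        ultimately show False using True by blast
      qed
      then show ?thesis using closed(1) by (intro bexI[of _ 0]) simp_all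
    next
      case False
      then obtain es where es: "es \<in> lists E" "length es = s" "f (map emb es) \<noteq> 0" by blast
      obtain g es' where g: "g \<in> CE.basic toral_part (s - 1)" and es': "es' \<in> lists E" "mset es' = mset es"
        "f (map emb es') \<noteq> 0" "f (map emb es') + CE.ce_d g (map emb es') = 0"
        and other: "\<And>bs. bs \<in> lists E \<Longrightarrow> length bs = s \<Longrightarrow> mset bs \<noteq> mset es \<Longrightarrow>
          CE.ce_d g (map emb bs) = 0"
        using cancel_top_value[OF f es] by blast
      let ?h = "f + CE.ce_d g"
      have s1: "Suc (s - 1) = s" using s_ge_2 by simp
      have dg: "CE.ce_d g \<in> CE.basic toral_part s"
        using CE.basic_ce_d[OF toral_part_subset g] s1 by simp
      have h: "?h \<in> CE.basic toral_part s" using f dg by (rule closed)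
      have "?supp ?h \<subseteq> ?supp f - {es'}"
      proof
        fix bs assume bs: "bs \<in> ?supp ?h"
        have hC: "?h \<in> CE.cochains s" using h by (rule CE.basicD)
        have "mset bs \<noteq> mset es"
        proof
          assume "mset bs = mset es"
          then have "mset (map emb es') = mset (map emb bs)" using es'(2) by simp
          moreover have "set (map emb es') \<subseteq> semidirect T" by auto
          moreover have "?h (map emb es') = 0" using es'(4) by (simp add: plus_fun_apply)
          ultimately have "?h (map emb bs) = 0" using CE.cochain_eq_0_mset[OF hC] by blast
          then show False using bs by simp
        qed
        then show "bs \<in> ?supp f - {es'}"
          using bs other[of bs] es'(2) by (auto simp: plus_fun_apply)
      qed
      moreover have "es' \<in> ?supp f" using es' es(2) by (simp) (metis size_mset)
      ultimately have "?supp ?h \<subset> ?supp f" by blast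
      then have "card (?supp ?h) < card (?supp f)" by (rule psubset_card_mono[OF fin])
      then obtain k where k: "k \<in> CE.basic toral_part (s - 1)" "?h = CE.ce_d k"
        using less.hyps[OF _ h] by blast
      have "f = CE.ce_d k - CE.ce_d g" using k(2) by (simp add: eq_diff_eq)
      also have "\<dots> = CE.ce_d (k - g)"
        using CE.ce_d_diff CE.basicD(1)[OF k(1)] CE.basicD(1)[OF g] by simp
      finally show ?thesis using closed(3)[OF k(1) g] by blast
    qed
  qed
  moreover obtain m where m: "s = Suc m" using s_ge_2 by (cases s) auto
  ultimately have "\<exists>g\<in>CE.basic toral_part m. f = CE.ce_d g" if "f \<in> CE.basic toral_part (Suc m)" for f
    using that by simp
  then show ?thesis unfolding CE.exact_at_def m by simp
qed

lemma cohomology_vanishes_from_low_degrees: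
  assumes "\<And>i. i < s \<Longrightarrow> CE.cohomology_vanishes i"
  shows "CE.cohomology_vanishes n"
proof -
  have "CE.exact_at toral_part i" for i
  proof (cases "i < s")
    case True
    then show ?thesis
      using assms CE.exact_at_split_toral(1)[OF split_toral_toral_part]
      by (simp add: CE.cohomology_vanishes_iff_exact_at)
  next
    case False
    then show ?thesis using exact_top exact_above by (cases "i = s") auto
  qed
  then show ?thesis
    using CE.exact_at_split_toral(2)[OF split_toral_toral_part]
    by (simp add: CE.cohomology_vanishes_iff_exact_at)
qed

end

section \<open>Vanishing in all degrees\<close>

lemma (in fin_dim_lie_algebra) ex_split_solvable:
  assumes T: "torus T" and rank: "maximal_rank T" and nil: "lower_central (Suc s) = {0}" and s: "s \<ge> 2"
  shows "\<exists>E X. split_solvable scale bracket T E X s"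
proof -
  have "span (weight_vectors T) = UNIV"
    using stable_subspace_spanned_by_weight_vectors[OF T, of UNIV] by auto
  from ex_basis_modulo_subset[OF subspace_lower_central[of 2] this]
  obtain E where E: "E \<subseteq> weight_vectors T" "finite E" "independent E"
    "span (E \<union> lower_central 2) = UNIV" "card E = quotient_dim UNIV (lower_central 2)"
    by (elim exE conjE)
  note words = span_iterated_brackets[OF E(4) nil]
  have "endo.dim T = card E" using rank E(5) by (simp add: maximal_rank_def)
  from ex_dual_basis_of_torus[OF T E(2,3,1) words this]
  obtain X where X: "\<forall>e\<in>E. X e \<in> T \<and> (\<forall>f\<in>E. X e f = (if e = f then f else 0))"
    "T \<subseteq> endo.span (X ` E)"
    by (elim exE conjE)
  have "iterated_bracket ks = 0" if "ks \<in> words E" "length ks > s" for ks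
    using iterated_bracket_in_lower_central[of ks] lower_central_eventually_0[OF nil that(2)] that(1)
    by (simp add: words_def)
  moreover have "0 \<notin> E" using E(3) dependent_zero by blast
  ultimately have "split_solvable scale bracket T E X s"
    using T E(2) X words s by unfold_locales auto
  then show ?thesis by blast
qed

theorem corollary3p6:
  fixes scale :: "complex \<Rightarrow> 'n::ab_group_add \<Rightarrow> 'n"
    and bracket :: "'n \<Rightarrow> 'n \<Rightarrow> 'n"
    and T :: "('n \<Rightarrow> 'n) set"
    and s :: nat
  assumes "fin_dim_lie_algebra scale bracket"
    and "lie_algebra_on.nilpotent scale UNIV bracket"
    and "fin_dim_lie_algebra.maximal_torus scale bracket T"
    and "fin_dim_lie_algebra.maximal_rank scale bracket T"
    and "fin_dim_lie_algebra.weight_condition scale bracket T"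
    and "lie_algebra_on.nilindex scale UNIV bracket = s + 1"
    and "s \<ge> 3"
    and "\<And>i. i \<le> s - 1 \<Longrightarrow> fin_dim_lie_algebra.semidirect_cohomology_vanishes scale bracket T i"
  shows "\<forall>i. fin_dim_lie_algebra.semidirect_cohomology_vanishes scale bracket T i"
proof -
  interpret fin_dim_lie_algebra scale bracket by (rule assms(1))
  have T: "torus T" using assms(3) by (simp add: maximal_torus_def)
  obtain k where k: "1 \<le> k \<and> lower_central k = {0}" using assms(2) by (auto simp: nilpotent_def)
  have "lower_central nilindex = {0}"
    unfolding nilindex_def using LeastI[of "\<lambda>k. 1 \<le> k \<and> lower_central k = {0}", OF k] by simp
  then have nil: "lower_central (Suc s) = {0}" using assms(6) by simp
  obtain E X where "split_solvable scale bracket T E X s"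
    using ex_split_solvable[OF T assms(4) nil] assms(7) by auto
  then interpret split_solvable scale bracket T E X s .
  have "CE.cohomology_vanishes i" if "i < s" for i
    using assms(8)[of i] that by (simp add: semidirect_cohomology_vanishes_def)
  then show ?thesis
    using cohomology_vanishes_from_low_degrees by (simp add: semidirect_cohomology_vanishes_def)
qed

end
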